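(* Let $\rho:\mathbb{R}^n\setminus\{0\}\to[0,\infty)$ be a kernel with compact support satisfying hypotheses (K0)-(K4) listed in the context and normalized by $\int_{\mathbb{R}^n}\rho(x)\,dx=n$. Let $1<p<\infty$. Then there exists a constant $c_p>0$ such that for all $u\in H^{\rho,p}(\mathbb{R}^n;\mathbb{R}^n)$, $$\|D_{\rho,\mathrm{sym}}u\|_{L^p(\mathbb{R}^n)}\ \geq\ c_p\,\|D_\rho u\|_{L^p(\mathbb{R}^n)}.$$
   Context: Hypotheses on the kernel. Since $\rho$ is radial we also write $\rho(x)=\rho(|x|)$. (K0) $\rho:\mathbb{R}^n\setminus\{0\}\to[0,\infty)$ is radial; $\rho\in L^1_{\mathrm{loc}}(\mathbb{R}^n)$ with $\int_{\mathbb{R}^n}\min\{1,|x|^{-1}\}\rho(x)\,dx<\infty$; and $\inf_{\overline{B(0,\varepsilon)}}\rho>0$ for some $\varepsilon>0$ (this $\varepsilon$ is fixed below). (K1) There is $\nu>0$ such that $f_\rho(r)=r^{n-2}\rho(r)$ and $r\mapsto r^\nu f_\rho(r)$ are decreasing (non-strictly) on $(0,\varepsilon)$. (K2) $f_\rho$ is smooth on $(0,\infty)$ and for every positive integer $k$ there is $C(k)>0$ with $\left|\frac{d^k f_\rho}{dr^k}(r)\right|\le C(k)r^{-k}f_\rho(r)$ for $r\in(0,\varepsilon)$. (K3) There is $s\in(0,1)$ such that $r\mapsto r^{n+s-1}\rho(r)$ is almost decreasing on $(0,\varepsilon)$. (K4) There is $t\in(0,1)$ such that $r\mapsto r^{n+t-1}\rho(r)$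 is almost increasing on $(0,\varepsilon)$. A function $h$ is almost decreasing if there is $C>0$ with $h(a)\ge C\,h(b)$ whenever $a\le b$; almost increasing if there is $C>0$ with $h(a)\le C\,h(b)$ whenever $a\le b$. Nonlocal gradient. For $u\in C_c^\infty(\mathbb{R}^n;\mathbb{R}^n)$, $D_\rho u(x)=\int_{\mathbb{R}^n}\frac{u(x)-u(y)}{|x-y|}\otimes\frac{x-y}{|x-y|}\rho(x-y)\,dy\in\mathbb{R}^{n\times n}$. Space. $H^{\rho,p}(\mathbb{R}^n;\mathbb{R}^n)=\{u\in L^p(\mathbb{R}^n;\mathbb{R}^n): D_\rho u\in L^p(\mathbb{R}^n;\mathbb{R}^{n\times n})\}$ with norm $\|u\|_{L^p}+\|D_\rho u\|_{L^p}$, where $D_\rho u$ is understood in the weak sense: $\int D_\rho u: \Phi\,dx=-\int u\cdot\operatorname{div}_\rho\Phi\,dx$ for all $\Phi\in C_c^\infty(\mathbb{R}^n;\mathbb{R}^{n\times n})$, with $\operatorname{div}_\rho\Phi(x)=\int_{\mathbb{R}^n}\frac{\Phi(x)-\Phi(y)}{|x-y|}\frac{x-y}{|x-y|}\rho(x-y)\,dy$. Equivalently, it is the closure of $C_c^\infty(\mathbb{R}^n;\mathbb{R}^n)$ in this norm, with $D_\rho$ extended by continuity. $D_{\rho,\mathrm{sym}}u=\tfrac12\big(D_\rho u+(D_\rho u)^T\big)$. Norms of matrices are Frobenius norms. *)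

theory Defs
  imports "HOL-Analysis.Analysis"
begin

section \<open>Kernels\<close>

text \<open>
  A kernel is a function on \<open>\<real>\<^sup>n\<close> without the origin, where \<open>n = CARD('n)\<close>. The value of the
  total function \<open>\<rho>\<close> at \<open>0\<close> plays no role: pointwise conditions exclude it, and it does not
  affect integrals.
\<close>

definition radial :: "(real ^ 'n \<Rightarrow> real) \<Rightarrow> bool" where
  "radial \<rho> \<longleftrightarrow> (\<forall>x y. x \<noteq> 0 \<and> y \<noteq> 0 \<and> norm x = norm y \<longrightarrow> \<rho> x = \<rho> y)"

text \<open>The profile \<open>r \<mapsto> \<rho>(r)\<close>, \<open>r > 0\<close>; for radial \<open>\<rho>\<close> the choice of unit vector is immaterial.\<close>

definition profile :: "(real ^ 'n \<Rightarrow> real) \<Rightarrow> real \<Rightarrow> real" where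
  "profile \<rho> r = \<rho> (r *\<^sub>R (SOME e. norm e = 1))"

definition f_rho :: "(real ^ 'n \<Rightarrow> real) \<Rightarrow> real \<Rightarrow> real" where
  "f_rho \<rho> r = r powr (real CARD('n) - 2) * profile \<rho> r"

definition almost_decreasing_on :: "real set \<Rightarrow> (real \<Rightarrow> real) \<Rightarrow> bool" where
  "almost_decreasing_on A h \<longleftrightarrow> (\<exists>C>0. \<forall>a\<in>A. \<forall>b\<in>A. a \<le> b \<longrightarrow> h a \<ge> C * h b)"

definition almost_increasing_on :: "real set \<Rightarrow> (real \<Rightarrow> real) \<Rightarrow> bool" where
  "almost_increasing_on A h \<longleftrightarrow> (\<exists>C>0. \<forall>a\<in>A. \<forall>b\<in>A. a \<le> b \<longrightarrow> h a \<le> C * h b)"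

definition K0 :: "real \<Rightarrow> (real ^ 'n \<Rightarrow> real) \<Rightarrow> bool" where
  "K0 \<epsilon> \<rho> \<longleftrightarrow>
     (\<forall>x. x \<noteq> 0 \<longrightarrow> \<rho> x \<ge> 0) \<and> radial \<rho> \<and>
     (\<forall>K. compact K \<longrightarrow> set_integrable lebesgue K \<rho>) \<and>
     integrable lebesgue (\<lambda>x. min 1 (1 / norm x) * \<rho> x) \<and>
     (INF x\<in>cball 0 \<epsilon> - {0}. \<rho> x) > 0"

definition K1 :: "real \<Rightarrow> (real ^ 'n \<Rightarrow> real) \<Rightarrow> bool" where
  "K1 \<epsilon> \<rho> \<longleftrightarrow>
     (\<exists>\<nu>>0. antimono_on {0<..<\<epsilon>} (f_rho \<rho>) \<and>
             antimono_on {0<..<\<epsilon>} (\<lambda>r. r powr \<nu> * f_rho \<rho> r))"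

definition K2 :: "real \<Rightarrow> (real ^ 'n \<Rightarrow> real) \<Rightarrow> bool" where
  "K2 \<epsilon> \<rho> \<longleftrightarrow>
     (\<forall>k. (deriv ^^ k) (f_rho \<rho>) differentiable_on {0<..}) \<and>
     (\<forall>k\<ge>1. \<exists>C>0. \<forall>r\<in>{0<..<\<epsilon>}. \<bar>(deriv ^^ k) (f_rho \<rho>) r\<bar> \<le> C / r ^ k * f_rho \<rho> r)"

definition K3 :: "real \<Rightarrow> (real ^ 'n \<Rightarrow> real) \<Rightarrow> bool" where
  "K3 \<epsilon> \<rho> \<longleftrightarrow>
     (\<exists>s\<in>{0<..<1}. almost_decreasing_on {0<..<\<epsilon>}
        (\<lambda>r. r powr (real CARD('n) + s - 1) * profile \<rho> r))"

definition K4 :: "real \<Rightarrow> (real ^ 'n \<Rightarrow> real) \<Rightarrow> bool" where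
  "K4 \<epsilon> \<rho> \<longleftrightarrow>
     (\<exists>t\<in>{0<..<1}. almost_increasing_on {0<..<\<epsilon>}
        (\<lambda>r. r powr (real CARD('n) + t - 1) * profile \<rho> r))"

definition kernel_compact_support :: "(real ^ 'n \<Rightarrow> real) \<Rightarrow> bool" where
  "kernel_compact_support \<rho> \<longleftrightarrow> compact (closure {x. x \<noteq> 0 \<and> \<rho> x \<noteq> 0})"


section \<open>Test functions and Lebesgue spaces\<close>

text \<open>
  \<open>C\<^sup>k\<close> regularity on the whole space, by iterating directional derivatives of a Frechet
  differentiable function; in finite dimension this is the usual notion.
\<close>

primrec Ck :: "nat \<Rightarrow> ('a::euclidean_space \<Rightarrow> 'b::euclidean_space) \<Rightarrow> bool" where
  "Ck 0 f \<longleftrightarrow> continuous_on UNIV f"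
| "Ck (Suc k) f \<longleftrightarrow>
     (\<forall>x. f differentiable at x) \<and> (\<forall>v. Ck k (\<lambda>x. frechet_derivative f (at x) v))"

definition test_function :: "('a::euclidean_space \<Rightarrow> 'b::euclidean_space) \<Rightarrow> bool" where
  "test_function \<Phi> \<longleftrightarrow> (\<forall>k. Ck k \<Phi>) \<and> compact (closure {x. \<Phi> x \<noteq> 0})"

definition Lp :: "real \<Rightarrow> ('a::euclidean_space \<Rightarrow> 'b::euclidean_space) set" where
  "Lp p = {u \<in> borel_measurable lebesgue. integrable lebesgue (\<lambda>x. norm (u x) powr p)}"

text \<open>On \<open>real ^ 'n ^ 'n\<close>, \<open>norm\<close> and \<open>\<bullet>\<close> are the Frobenius norm and inner product.\<close>

definition Lp_norm :: "real \<Rightarrow> ('a::euclidean_space \<Rightarrow> 'b::euclidean_space) \<Rightarrow> real" where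
  "Lp_norm p u = (LINT x|lebesgue. norm (u x) powr p) powr (1 / p)"


section \<open>The nonlocal gradient\<close>

definition nonlocal_div ::
  "(real ^ 'n \<Rightarrow> real) \<Rightarrow> (real ^ 'n \<Rightarrow> real ^ 'n ^ 'n) \<Rightarrow> real ^ 'n \<Rightarrow> real ^ 'n" where
  "nonlocal_div \<rho> \<Phi> x =
     (LINT y|lebesgue. \<rho> (x - y) *\<^sub>R
        (((\<Phi> x - \<Phi> y) /\<^sub>R norm (x - y)) *v ((x - y) /\<^sub>R norm (x - y))))"

text \<open>
  \<open>G\<close> is (a representative of) the weak nonlocal gradient \<open>D\<^sub>\<rho> u\<close> in \<open>L\<^sup>p\<close>; it is unique up to
  a null set, so it is expressed as a relation.
\<close>

definition weak_nonlocal_grad ::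
  "(real ^ 'n \<Rightarrow> real) \<Rightarrow> real \<Rightarrow> (real ^ 'n \<Rightarrow> real ^ 'n) \<Rightarrow> (real ^ 'n \<Rightarrow> real ^ 'n ^ 'n) \<Rightarrow> bool"
where
  "weak_nonlocal_grad \<rho> p u G \<longleftrightarrow> G \<in> Lp p \<and>
     (\<forall>\<Phi>. test_function \<Phi> \<longrightarrow>
        (LINT x|lebesgue. G x \<bullet> \<Phi> x) = - (LINT x|lebesgue. u x \<bullet> nonlocal_div \<rho> \<Phi> x))"

definition H_space :: "(real ^ 'n \<Rightarrow> real) \<Rightarrow> real \<Rightarrow> (real ^ 'n \<Rightarrow> real ^ 'n) set" where
  "H_space \<rho> p = {u \<in> Lp p. \<exists>G. weak_nonlocal_grad \<rho> p u G}"

definition sym_part :: "real ^ 'n ^ 'n \<Rightarrow> real ^ 'n ^ 'n" where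
  "sym_part A = (1 / 2) *\<^sub>R (A + transpose A)"

end

theory Submission
  imports Defs
begin

text \<open>
  The symmetry of a radial kernel makes a weak nonlocal gradient \<open>G\<close> curl free: \<open>\<partial>\<^sub>k G\<^sub>i\<^sub>j = \<partial>\<^sub>j G\<^sub>i\<^sub>k\<close> in the
  sense of distributions, because the difference of the two sides, tested with \<open>\<psi>\<close>, is the integral of a
  radial weight against an angular derivative. So the nonlocal operator disappears, and the inequality
  follows from Korn's inequality for curl free fields in \<open>L\<^sup>p\<close>.

  That inequality is proved for finite differences, with a constant independent of the step, and without
  singular integrals. With \<open>E\<close> the symmetric part of \<open>G\<close>, curl freeness gives
  \<open>\<delta>\<^sub>k G\<^sub>i\<^sub>j = \<delta>\<^sub>k E\<^sub>i\<^sub>j + \<delta>\<^sub>j E\<^sub>i\<^sub>k - \<delta>\<^sub>i E\<^sub>j\<^sub>k\<close>. Let \<open>M\<close> be the averaging operator of the lazy random walk on the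
  lattice of steps and \<open>g'\<close> the function in \<open>L\<^sup>q\<close> dual to \<open>G\<^sub>i\<^sub>j\<close>. Then \<open>\<parallel>G\<^sub>i\<^sub>j\<parallel>\<^sup>p\<close> is the sum over \<open>l\<close> of the pairings
  of \<open>(1 - M) M\<^sup>l G\<^sub>i\<^sub>j\<close> with \<open>M\<^sup>l (g' + M g')\<close>; summation by parts turns these into pairings of differences of
  \<open>M\<^sup>l E\<close> with differences of \<open>M\<^sup>l (g' + M g')\<close>. They are summable because a Bellman function
  \<open>B(s, t)\<close> of size \<open>\<bar>s\<bar>\<^sup>p + \<bar>t\<bar>\<^sup>q\<close> has a modulus of convexity dominating \<open>\<bar>a\<bar> \<bar>b\<bar>\<close>, so that the integral of
  \<open>B(M\<^sup>l E, M\<^sup>l g)\<close> decreases in \<open>l\<close> by at least the quantity to be summed.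
\<close>

section \<open>A Bellman function\<close>

text \<open>In the continuum the identity for \<open>G\<close> writes it as second order Riesz
  transforms of \<open>E\<close>; the lattice walk takes the place of the heat flow in the Bellman
  function proof that these are bounded on L^p. The Bellman function controls a product only if both
  factors were smoothed by the same number of steps. So the telescoping runs along even powers of
  the walk: self-adjointness shares the steps evenly, and 1 - M^2 = (1 - M)(1 + M) leaves one factor
  1 - M for the summation by parts. The obstacle lies between curl freeness and finite differences.
  Mollifying \<open>G\<close> with one kernel makes its partial derivatives commute in the required
  sense, but not its differences at a fixed step. Therefore each column gets a kernel of its own,
  made for the step. The price is that symmetrising no longer commutes with mollifying; both fields
  are compared with the original one in L^p, and the step tends to 0 while the constant
  stays.\<close>

lemma powr_tangent:
  fixes p x y :: real
  assumes "1 < p"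
  shows "\<bar>y\<bar> powr p \<ge> \<bar>x\<bar> powr p + p * \<bar>x\<bar> powr (p - 1) * sgn x * (y - x)"
proof -
  define q where "q = p / (p - 1)"
  have q: "q > 1" "1 / p + 1 / q = 1" using assms by (auto simp: q_def field_simps)
  have "\<bar>y\<bar> * \<bar>x\<bar> powr (p - 1) \<le> \<bar>y\<bar> powr p / p + (\<bar>x\<bar> powr (p - 1)) powr q / q"
    using Youngs_inequality[of p q "\<bar>y\<bar>" "\<bar>x\<bar> powr (p - 1)"] assms q by simp
  moreover have "(\<bar>x\<bar> powr (p - 1)) powr q = \<bar>x\<bar> powr p"
    using assms by (simp add: powr_powr q_def)
  ultimately have "p * (\<bar>y\<bar> * \<bar>x\<bar> powr (p - 1)) \<le> p * (\<bar>y\<bar> powr p / p + \<bar>x\<bar> powr p / q)"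
    using assms by (intro mult_left_mono) auto
  also have "\<dots> = \<bar>y\<bar> powr p + (p - 1) * \<bar>x\<bar> powr p"
    using assms by (simp add: q_def field_simps)
  finally have 1: "p * \<bar>y\<bar> * \<bar>x\<bar> powr (p - 1) \<le> \<bar>y\<bar> powr p + (p - 1) * \<bar>x\<bar> powr p" by (simp add: mult.assoc)
  have 2: "p * \<bar>x\<bar> powr (p - 1) * (sgn x * y) \<le> p * \<bar>x\<bar> powr (p - 1) * \<bar>y\<bar>"
    using assms by (intro mult_left_mono) (auto simp: sgn_if)
  have 3: "\<bar>x\<bar> powr (p - 1) * (sgn x * x) = \<bar>x\<bar> powr p"
    using powr_add[of "\<bar>x\<bar>" "p - 1" 1] by (cases "x = 0") (auto simp: sgn_if abs_if)
  have "p * \<bar>x\<bar> powr (p - 1) * sgn x * (y - x) = p * \<bar>x\<bar> powr (p - 1) * (sgn x * y) - p * (\<bar>x\<bar> powr (p - 1) * (sgn x * x))"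
    by (simp add: algebra_simps)
  then have 4: "p * \<bar>x\<bar> powr (p - 1) * sgn x * (y - x) = p * \<bar>x\<bar> powr (p - 1) * (sgn x * y) - p * \<bar>x\<bar> powr p"
    using 3 by simp
  have "p * \<bar>x\<bar> powr (p - 1) * \<bar>y\<bar> \<le> \<bar>y\<bar> powr p + p * \<bar>x\<bar> powr p - \<bar>x\<bar> powr p"
    using 1 by (simp add: algebra_simps)
  then show ?thesis using 2 4 by linarith
qed

lemma powr_superadd:
  fixes a b r :: real
  assumes "0 \<le> a" "0 \<le> b" "1 \<le> r"
  shows "a powr r + b powr r \<le> (a + b) powr r"
proof (cases "a + b = 0")
  case True
  then have "a = 0" "b = 0" using assms by auto
  then show ?thesis by simp
next
  case False
  then have ab: "a + b > 0" using assms by simp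
  have *: "x powr r \<le> x * (a + b) powr (r - 1)" if "0 \<le> x" "x \<le> a + b" for x
  proof (cases "x = 0")
    case False
    then have "x powr r = x * x powr (r - 1)" using that powr_add[of x 1 "r - 1"] by simp
    also have "\<dots> \<le> x * (a + b) powr (r - 1)" using that assms by (intro mult_left_mono powr_mono2) auto
    finally show ?thesis .
  qed auto
  have "a powr r + b powr r \<le> (a + b) * (a + b) powr (r - 1)"
    using *[of a] *[of b] assms by (simp add: algebra_simps)
  also have "\<dots> = (a + b) powr r" using ab powr_add[of "a + b" 1 "r - 1"] by simp
  finally show ?thesis .
qed

text \<open>Clarkson's inequality: with midpoint \<open>u\<close> and half difference
  \<open>v\<close>, |u|^p + |v|^p is at most the mean of |s|^p and |s + a|^p. The midpoint is then
  bounded below by the tangent at \<open>s\<close>; doubling turns its increment a/2 into the full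
  linear term.\<close>

lemma powr_gain_ge2:
  fixes p s a :: real
  assumes "2 \<le> p"
  shows "\<bar>s + a\<bar> powr p \<ge> \<bar>s\<bar> powr p + p * \<bar>s\<bar> powr (p - 1) * sgn s * a + 2 * (\<bar>a\<bar> / 2) powr p"
proof -
  have sq: "(z\<^sup>2) powr (p / 2) = \<bar>z\<bar> powr p" for z :: real
    using powr_powr[of "\<bar>z\<bar>" 2 "p / 2"] by (cases "z = 0") (auto simp: powr_numeral)
  define u v where "u = s + a / 2" and "v = a / 2"
  have "\<bar>u\<bar> powr p + \<bar>v\<bar> powr p \<le> (u\<^sup>2 + v\<^sup>2) powr (p / 2)"
    using powr_superadd[of "u\<^sup>2" "v\<^sup>2" "p / 2"] assms by (simp add: sq)
  also have "u\<^sup>2 + v\<^sup>2 = (s\<^sup>2 + (s + a)\<^sup>2) / 2"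
    by (simp add: u_def v_def power2_eq_square field_simps)
  also have "((s\<^sup>2 + (s + a)\<^sup>2) / 2) powr (p / 2) \<le> (\<bar>s\<bar> powr p + \<bar>s + a\<bar> powr p) / 2"
  proof -
    have "((x + y) / 2) powr r \<le> (x powr r + y powr r) / 2" if "0 \<le> x" "0 \<le> y" "1 \<le> r" for x y r :: real
    proof (cases "r = 1")
      case False
      define m where "m = (x + y) / 2"
      define l where "l = r * \<bar>m\<bar> powr (r - 1) * sgn m"
      have "m \<ge> 0" using that by (simp add: m_def)
      have "x powr r \<ge> m powr r + l * (x - m)" "y powr r \<ge> m powr r + l * (y - m)"
        using powr_tangent[of r m x] powr_tangent[of r m y] that False \<open>m \<ge> 0\<close> by (auto simp: l_def)
      moreover have "l * (x - m) + l * (y - m) = 0" by (simp add: m_def field_simps)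
      ultimately have "2 * m powr r \<le> x powr r + y powr r" by argo
      then show ?thesis by (simp add: m_def)
    qed (use that in auto)
    from this[of "s\<^sup>2" "(s + a)\<^sup>2" "p / 2"] show ?thesis using assms by (simp add: sq)
  qed
  finally have 1: "2 * \<bar>u\<bar> powr p + 2 * \<bar>v\<bar> powr p \<le> \<bar>s\<bar> powr p + \<bar>s + a\<bar> powr p" by simp
  have 2: "\<bar>u\<bar> powr p \<ge> \<bar>s\<bar> powr p + p * \<bar>s\<bar> powr (p - 1) * sgn s * (a / 2)"
    using powr_tangent[of p s u] assms by (simp add: u_def)
  have 3: "\<bar>v\<bar> = \<bar>a\<bar> / 2" by (simp add: v_def)
  have "2 * \<bar>u\<bar> powr p \<ge> 2 * \<bar>s\<bar> powr p + p * \<bar>s\<bar> powr (p - 1) * sgn s * a" using 2 by linarith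
  then show ?thesis using 1 unfolding 3 by linarith
qed

lemma abs_powr_DERIV:
  fixes q x :: real
  assumes "1 < q"
  shows "((\<lambda>x. \<bar>x\<bar> powr q) has_real_derivative q * \<bar>x\<bar> powr (q - 1) * sgn x) (at x)"
proof -
  consider "x > 0" | "x < 0" | "x = 0" by linarith
  then show ?thesis
  proof cases
    case 1
    have "((\<lambda>x. x powr q) has_real_derivative q * x powr (q - 1)) (at x)"
      using 1 by (auto intro!: derivative_eq_intros)
    then have "((\<lambda>x. \<bar>x\<bar> powr q) has_real_derivative q * x powr (q - 1)) (at x)"
      by (rule has_field_derivative_transform_within_open[of _ _ _ "{0<..}"]) (use 1 in auto)
    then show ?thesis using 1 by simp
  next
    case 2
    have "((\<lambda>x. (-x) powr q) has_real_derivative - (q * (-x) powr (q - 1))) (at x)"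
      using 2 by (auto intro!: derivative_eq_intros)
    then have "((\<lambda>x. \<bar>x\<bar> powr q) has_real_derivative - (q * (-x) powr (q - 1))) (at x)"
      by (rule has_field_derivative_transform_within_open[of _ _ _ "{..<0}"]) (use 2 in auto)
    then show ?thesis using 2 by simp
  next
    case 3
    have "((\<lambda>h::real. \<bar>h\<bar> powr (q - 1)) \<longlongrightarrow> 0) (at 0)"
      using assms by (auto intro!: tendsto_eq_intros simp: eventually_at_filter)
    then have "((\<lambda>h::real. \<bar>h\<bar> powr q / h) \<longlongrightarrow> 0) (at 0)"
    proof (rule Lim_null_comparison[rotated])
      show "\<forall>\<^sub>F h in at 0. norm (\<bar>h\<bar> powr q / h) \<le> \<bar>h\<bar> powr (q - 1)"
        by (auto simp: eventually_at_filter powr_diff)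
    qed
    then show ?thesis unfolding 3 DERIV_def by simp
  qed
qed

text \<open>The second derivative q (q - 1) |r|^(q - 2) of |r|^q is smallest at |r| = R, since the
  exponent is not positive. Subtracting the quadratic with that second derivative leaves
  \<open>F\<close>, which is convex on [-R, R] and so lies above its tangents.\<close>

lemma powr_gain_le2:
  fixes q t b :: real
  assumes q: "1 < q" "q \<le> 2" and R: "\<bar>t\<bar> \<le> R" "\<bar>t + b\<bar> \<le> R" "0 < R"
  shows "\<bar>t + b\<bar> powr q \<ge> \<bar>t\<bar> powr q + q * \<bar>t\<bar> powr (q - 1) * sgn t * b + q * (q - 1) / 2 * R powr (q - 2) * b\<^sup>2"
proof -
  define k where "k = (q - 1) * R powr (q - 2)"
  define g where "g r = \<bar>r\<bar> powr (q - 1) * sgn r - k * r" for r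
  have g_pos: "g x \<le> g y" if "0 \<le> x" "x \<le> y" "y \<le> R" for x y
  proof (cases "x = y")
    case False
    then have xy: "x < y" using that by simp
    have "continuous_on {x..y} (\<lambda>z. z powr (q - 1) - k * z)"
      using q that by (intro continuous_on_diff continuous_on_powr' continuous_on_mult continuous_intros) auto
    moreover have D: "((\<lambda>z. z powr (q - 1) - k * z) has_real_derivative (q - 1) * z powr (q - 2) - k) (at z)"
      if "x < z" for z
      using that \<open>0 \<le> x\<close> by (auto intro!: derivative_eq_intros simp: algebra_simps)
    ultimately obtain l z where z: "x < z" "z < y" and l: "DERIV (\<lambda>z. z powr (q - 1) - k * z) z :> l"
      and eq: "(y powr (q - 1) - k * y) - (x powr (q - 1) - k * x) = (y - x) * l"
      using MVT[OF xy, of "\<lambda>z. z powr (q - 1) - k * z"] by (auto simp: real_differentiable_def)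
    have l': "l = (q - 1) * z powr (q - 2) - k" using DERIV_unique[OF l D[OF z(1)]] .
    have "R powr (q - 2) \<le> z powr (q - 2)" using z that q by (intro powr_mono2') auto
    then have "0 \<le> (q - 1) * z powr (q - 2) - k" using q by (simp add: k_def)
    then have "x powr (q - 1) - k * x \<le> y powr (q - 1) - k * y"
      using eq xy unfolding l' by (smt (verit) mult_nonneg_nonneg)
    moreover have "r \<ge> 0 \<Longrightarrow> g r = r powr (q - 1) - k * r" for r by (auto simp: g_def sgn_if)
    ultimately show ?thesis using that by simp
  qed auto
  have g_odd: "g (- r) = - g r" for r by (simp add: g_def sgn_if)
  have g_mono: "g x \<le> g y" if "- R \<le> x" "x \<le> y" "y \<le> R" for x y
  proof -
    consider "0 \<le> x" | "y \<le> 0" | "x \<le> 0" "0 \<le> y" by linarith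
    then show ?thesis
    proof cases
      case 1 then show ?thesis using g_pos that by simp
    next
      case 2 then show ?thesis using g_pos[of "-y" "-x"] that by (simp add: g_odd)
    next
      case 3 
      then have "g 0 \<le> g y" "g 0 \<le> g (-x)" using g_pos that by simp_all
      then show ?thesis using 3 by (simp add: g_odd) (simp add: g_def)
    qed
  qed
  define F where "F r = \<bar>r\<bar> powr q - q * k / 2 * r\<^sup>2" for r
  have dF: "(F has_real_derivative q * g r) (at r)" for r
    unfolding F_def g_def
    by (rule derivative_eq_intros abs_powr_DERIV q refl | simp add: algebra_simps)+
  have "F (t + b) \<ge> F t + q * g t * b"
  proof -
    consider "b = 0" | "b > 0" | "b < 0" by linarith
    then show ?thesis
    proof cases
      case 2
      obtain z where z: "t < z" "z < t + b" "F (t + b) - F t = (t + b - t) * (q * g z)"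
        using MVT2[of t "t + b" F "\<lambda>r. q * g r"] dF 2 by auto
      have "g t \<le> g z" using z R by (intro g_mono) auto
      then have "b * (q * g t) \<le> b * (q * g z)" using 2 q by (intro mult_left_mono) auto
      then show ?thesis using z by (simp add: algebra_simps)
    next
      case 3
      obtain z where z: "t + b < z" "z < t" "F t - F (t + b) = (t - (t + b)) * (q * g z)"
        using MVT2[of "t + b" t F "\<lambda>r. q * g r"] dF 3 by auto
      have "g z \<le> g t" using z R by (intro g_mono) auto
      then have "b * (q * g t) \<le> b * (q * g z)" using 3 q by (intro mult_left_mono_neg mult_left_mono) auto
      moreover have "F (t + b) = F t + b * (q * g z)" using z(3) by (simp add: algebra_simps)
      ultimately show ?thesis by (simp add: mult.commute mult.left_commute)
    qed simp
  qed
  then show ?thesis unfolding F_def g_def k_def by (simp add: field_simps power2_eq_square)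
qed

lemma Young_eps:
  fixes p q \<eta> :: real
  assumes "1 < p" "1 / p + 1 / q = 1" "0 < \<eta>"
  shows "\<exists>C>0. \<forall>a b. 0 \<le> a \<longrightarrow> 0 \<le> b \<longrightarrow> a * b \<le> \<eta> * a powr p + C * b powr q"
proof -
  have q: "q > 1" using assms by (smt (verit) divide_less_eq_1_pos divide_nonpos_pos less_divide_eq_1_pos zero_less_divide_iff)
  define l where "l = \<eta> powr (1 / p)"
  have l: "l > 0" "l powr p = \<eta>" using assms by (auto simp: l_def powr_powr)
  have "a * b \<le> \<eta> * a powr p + l powr (- q) * b powr q" if "0 \<le> a" "0 \<le> b" for a b
  proof -
    have "a * b = (l * a) * (b / l)" using l by simp
    also have "\<dots> \<le> (l * a) powr p / p + (b / l) powr q / q"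
      using Youngs_inequality[of p q "l * a" "b / l"] assms q l that by simp
    also have "\<dots> \<le> (l * a) powr p + (b / l) powr q"
      using assms q by (intro add_mono) (auto simp: divide_le_eq mult_le_cancel_left1)
    also have "(l * a) powr p = \<eta> * a powr p" using l that by (simp add: powr_mult)
    also have "(b / l) powr q = l powr (- q) * b powr q" using l that by (simp add: powr_divide powr_minus field_simps)
    finally show ?thesis .
  qed
  then show ?thesis using l by (intro exI[of _ "l powr (- q)"]) auto
qed

text \<open>The maximum over \<open>T\<close> is a convex function whose supporting function at \<open>(s, t)\<close> can be chosen
  with \<open>T \<ge> \<bar>t\<bar>\<close>, so it has modulus of convexity at least \<open>\<bar>t\<bar> powr (2 - q) * a\<^sup>2\<close> in the first variable.\<close>

lemma envelope_exists:
  fixes p q :: real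
  assumes q: "1 < q" "q < 2" and pq: "1 / p + 1 / q = 1"
  shows "\<exists>H C. 0 < C \<and> (\<forall>s t. 0 \<le> H s t \<and> H s t \<le> C * (\<bar>s\<bar> powr p + \<bar>t\<bar> powr q)) \<and>
     (\<forall>s t. \<exists>l1 l2. \<forall>a b. H (s + a) (t + b) \<ge> H s t + l1 * a + l2 * b + \<bar>t\<bar> powr (2 - q) * a\<^sup>2)"
proof -
  have "p \<noteq> 0" using q pq by auto
  then have "p * (q - 1) = q" using q pq by (simp add: field_simps)
  then have p: "p = q / (q - 1)" using q by (simp add: field_simps)
  have "2 * (q - 1) < q" using q by simp
  then have p2: "p > 2" unfolding p using q by (simp add: field_simps)
  \<comment> \<open>The last two terms are the tangent of T^q at \<open>T\<close>, evaluated at |t|,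
    so for s = 0 the maximum is |t|^q, at T = |t|. The product |t|^(2 - q) s^2 is not jointly
    convex; with its weight frozen as T^(2 - q), each \<open>m\<close> is convex in (s, t), and so
    is the supremum.\<close>
  define m :: "real \<Rightarrow> real \<Rightarrow> real \<Rightarrow> real"
    where "m s t T = T powr (2 - q) * s\<^sup>2 + q * T powr (q - 1) * \<bar>t\<bar> - (q - 1) * T powr q" for s t T
  define H where "H s t = (SUP T\<in>{0..}. m s t T)" for s t
  \<comment> \<open>Each of the two Young inequalities spends a quarter of
    \<open>(q - 1) * T powr q\<close>. The half that is left makes \<open>m\<close> tend to minus
    infinity in \<open>T\<close>, so that the maximum is attained.\<close>
  obtain C1 where C1: "C1 > 0" "\<And>a b. 0 \<le> a \<Longrightarrow> 0 \<le> b \<Longrightarrow> a * b \<le> (q - 1) / 4 * a powr (q / (2 - q)) + C1 * b powr (p / 2)"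
    using Young_eps[of "q / (2 - q)" "p / 2" "(q - 1) / 4"] q p p2 by (auto simp: field_simps)
  obtain C2 where C2: "C2 > 0" "\<And>a b. 0 \<le> a \<Longrightarrow> 0 \<le> b \<Longrightarrow> a * b \<le> (q - 1) / 4 / q * a powr p + C2 * b powr q"
    using Young_eps[of p q "(q - 1) / 4 / q"] q p2 pq by auto
  have sq: "(z\<^sup>2) powr (p / 2) = \<bar>z\<bar> powr p" for z :: real
    using powr_powr[of "\<bar>z\<bar>" 2 "p / 2"] by (cases "z = 0") (auto simp: powr_numeral)
  have m_le: "m s t T \<le> C1 * \<bar>s\<bar> powr p + q * C2 * \<bar>t\<bar> powr q - (q - 1) / 2 * T powr q" if "T \<ge> 0" for s t T
  proof -
    have "T powr (2 - q) * s\<^sup>2 \<le> (q - 1) / 4 * T powr q + C1 * \<bar>s\<bar> powr p"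
      using C1(2)[of "T powr (2 - q)" "s\<^sup>2"] q by (simp add: powr_powr sq)
    moreover have "q * (T powr (q - 1) * \<bar>t\<bar>) \<le> q * ((q - 1) / 4 / q * T powr q + C2 * \<bar>t\<bar> powr q)"
      using C2(2)[of "T powr (q - 1)" "\<bar>t\<bar>"] q by (intro mult_left_mono) (auto simp: powr_powr p)
    moreover have "q * ((q - 1) / 4 / q * T powr q + C2 * \<bar>t\<bar> powr q) = (q - 1) / 4 * T powr q + q * C2 * \<bar>t\<bar> powr q"
      using q by (simp add: field_simps)
    moreover have "m s t T = T powr (2 - q) * s\<^sup>2 + q * (T powr (q - 1) * \<bar>t\<bar>) - (q - 1) * T powr q"
      by (simp add: m_def)
    moreover have "(q - 1) * T powr q = (q - 1) / 4 * T powr q + (q - 1) / 4 * T powr q + (q - 1) / 2 * T powr q"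
      by (simp add: field_simps)
    ultimately show ?thesis by linarith
  qed
  have m_le': "m s t T \<le> C1 * \<bar>s\<bar> powr p + q * C2 * \<bar>t\<bar> powr q" if "T \<ge> 0" for s t T
  proof -
    have "(q - 1) / 2 * T powr q \<ge> 0" using q by simp
    then show ?thesis using m_le[OF that, of s t] by linarith
  qed
  have bdd: "bdd_above (m s t ` {0..})" for s t
  proof (rule bdd_aboveI2)
    show "m s t T \<le> C1 * \<bar>s\<bar> powr p + q * C2 * \<bar>t\<bar> powr q" if "T \<in> {0..}" for T
      using m_le' that by simp
  qed
  have m_H: "m s t T \<le> H s t" if "T \<ge> 0" for s t T
    unfolding H_def using bdd that by (intro cSUP_upper) auto
  have H_nonneg: "0 \<le> H s t" for s t using m_H[of 0 s t] q by (simp add: m_def)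
  have H_le: "H s t \<le> C1 * \<bar>s\<bar> powr p + q * C2 * \<bar>t\<bar> powr q" for s t
    unfolding H_def using m_le' by (intro cSUP_least) auto
  have attained: "\<exists>T\<ge>\<bar>t\<bar>. H s t = m s t T" for s t
  proof -
    define A where "A = C1 * \<bar>s\<bar> powr p + q * C2 * \<bar>t\<bar> powr q"
    have "A \<ge> 0" unfolding A_def using C1 C2 q by auto
    define R where "R = max \<bar>t\<bar> ((2 * A / (q - 1)) powr (1 / q))"
    have cont: "continuous_on {\<bar>t\<bar>..R} (\<lambda>T. T powr c)" if "c > 0" for c
      by (rule continuous_on_powr') (use that in auto)
    have "continuous_on {\<bar>t\<bar>..R} (m s t)"
      unfolding m_def
      by (rule continuous_on_diff continuous_on_add continuous_on_mult continuous_on_const cont | use q in simp)+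
    moreover have "{\<bar>t\<bar>..R} \<noteq> {}" by (simp add: R_def)
    ultimately obtain T where T: "T \<in> {\<bar>t\<bar>..R}" "\<And>T'. T' \<in> {\<bar>t\<bar>..R} \<Longrightarrow> m s t T' \<le> m s t T"
      using continuous_attains_sup[OF compact_Icc] by blast
    have tq: "\<bar>t\<bar> powr (q - 1) * \<bar>t\<bar> = \<bar>t\<bar> powr q"
      using powr_add[of "\<bar>t\<bar>" "q - 1" 1] by (cases "t = 0") auto
    have m_t: "m s t \<bar>t\<bar> = \<bar>t\<bar> powr (2 - q) * s\<^sup>2 + \<bar>t\<bar> powr q"
    proof -
      have "m s t \<bar>t\<bar> = \<bar>t\<bar> powr (2 - q) * s\<^sup>2 + q * (\<bar>t\<bar> powr (q - 1) * \<bar>t\<bar>) - (q - 1) * \<bar>t\<bar> powr q"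
        by (simp add: m_def)
      then show ?thesis unfolding tq by (simp add: left_diff_distrib)
    qed
    then have t_nonneg: "m s t \<bar>t\<bar> \<ge> 0" by simp
    \<comment> \<open>Below |t| the quadratic term grows with T' and the tangent stays under |t|^q,
      which is its value at T' = |t|. Beyond \<open>R\<close> the choice of \<open>R\<close> gives m
      <= 0.\<close>
    have "m s t T' \<le> m s t T" if "T' \<ge> 0" for T'
    proof -
      consider "T' < \<bar>t\<bar>" | "T' \<in> {\<bar>t\<bar>..R}" | "T' > R"
        unfolding atLeastAtMost_iff by linarith
      then show ?thesis
      proof cases
        case 1
        have "T' powr (2 - q) * s\<^sup>2 \<le> \<bar>t\<bar> powr (2 - q) * s\<^sup>2" using 1 that q by (intro mult_right_mono powr_mono2) auto
        moreover have "q * T' powr (q - 1) * \<bar>t\<bar> - (q - 1) * T' powr q \<le> \<bar>t\<bar> powr q"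
        proof (cases "T' = 0")
          case False
          then have pos: "T' > 0" using that by simp
          then have "T' powr (q - 1) * T' = T' powr q" using powr_add[of T' "q - 1" 1] by simp
          then have "q * T' powr (q - 1) * (\<bar>t\<bar> - T') = q * T' powr (q - 1) * \<bar>t\<bar> - q * T' powr q"
            by (simp only: right_diff_distrib mult.assoc)
          moreover have "T' powr q + q * T' powr (q - 1) * (\<bar>t\<bar> - T') \<le> \<bar>t\<bar> powr q"
            using powr_tangent[of q T' "\<bar>t\<bar>"] pos q by simp
          ultimately show ?thesis by (simp only: left_diff_distrib mult_1)
        qed simp
        ultimately have "m s t T' \<le> m s t \<bar>t\<bar>" unfolding m_t unfolding m_def by linarith
        also have "\<dots> \<le> m s t T" using T by (auto simp: R_def)
        finally show ?thesis .
      next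
        case 3
        have "2 * A / (q - 1) = ((2 * A / (q - 1)) powr (1 / q)) powr q" using q \<open>A \<ge> 0\<close> by (simp add: powr_powr)
        also have "\<dots> \<le> T' powr q" using 3 q by (intro powr_mono2) (auto simp: R_def)
        finally have "A \<le> (q - 1) / 2 * T' powr q" using q by (simp add: field_simps)
        then have "m s t T' \<le> 0" using m_le[OF that, of s t] by (simp add: A_def)
        also have "0 \<le> m s t \<bar>t\<bar>" by (rule t_nonneg)
        also have "\<dots> \<le> m s t T" using T by (auto simp: R_def)
        finally show ?thesis .
      qed (use T in auto)
    qed
    then have "H s t \<le> m s t T" unfolding H_def by (intro cSUP_least) auto
    moreover have "m s t T \<le> H s t" using T by (intro m_H) auto
    ultimately show ?thesis using T by (intro exI[of _ T]) auto
  qed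
  have "\<exists>l1 l2. \<forall>a b. H (s + a) (t + b) \<ge> H s t + l1 * a + l2 * b + \<bar>t\<bar> powr (2 - q) * a\<^sup>2" for s t
  proof -
    obtain T where T: "T \<ge> \<bar>t\<bar>" "H s t = m s t T" using attained by blast
    \<comment> \<open>The supporting function is \<open>m\<close> with \<open>T\<close> frozen at
      the maximiser: it is exactly quadratic in the first variable, and T >= |t| bounds its
      coefficient from below.\<close>
    have "H (s + a) (t + b) \<ge> H s t + 2 * T powr (2 - q) * s * a + q * T powr (q - 1) * sgn t * b + \<bar>t\<bar> powr (2 - q) * a\<^sup>2" for a b
    proof -
      have "q * T powr (q - 1) * \<bar>t + b\<bar> \<ge> q * T powr (q - 1) * (\<bar>t\<bar> + sgn t * b)"
        using q by (intro mult_left_mono) (auto simp: sgn_if)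
      moreover have "\<bar>t\<bar> powr (2 - q) * a\<^sup>2 \<le> T powr (2 - q) * a\<^sup>2"
        using T q by (intro mult_right_mono powr_mono2) auto
      moreover have "T powr (2 - q) * (s + a)\<^sup>2 = T powr (2 - q) * s\<^sup>2 + 2 * T powr (2 - q) * s * a + T powr (2 - q) * a\<^sup>2"
        by (simp add: power2_eq_square algebra_simps)
      ultimately have "m s t T + 2 * T powr (2 - q) * s * a + q * T powr (q - 1) * sgn t * b + \<bar>t\<bar> powr (2 - q) * a\<^sup>2 \<le> m (s + a) (t + b) T"
        unfolding m_def by (simp add: algebra_simps)
      also have "\<dots> \<le> H (s + a) (t + b)" using T by (intro m_H) auto
      finally show ?thesis using T by simp
    qed
    then show ?thesis by blast
  qed
  moreover have "C1 * \<bar>s\<bar> powr p + q * C2 * \<bar>t\<bar> powr q \<le> (C1 + q * C2) * (\<bar>s\<bar> powr p + \<bar>t\<bar> powr q)" for s t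
    using C1 C2 q by (simp add: algebra_simps)
  moreover have "C1 + q * C2 > 0" using C1 C2 q by (simp add: add_pos_pos)
  ultimately have "0 < C1 + q * C2 \<and> (\<forall>s t. 0 \<le> H s t \<and> H s t \<le> (C1 + q * C2) * (\<bar>s\<bar> powr p + \<bar>t\<bar> powr q)) \<and>
     (\<forall>s t. \<exists>l1 l2. \<forall>a b. H (s + a) (t + b) \<ge> H s t + l1 * a + l2 * b + \<bar>t\<bar> powr (2 - q) * a\<^sup>2)"
    using H_nonneg order_trans[OF H_le] by simp
  then show ?thesis by blast
qed

text \<open>The convexity gain is split into a part for each increment, so that differences of the two
  arguments taken in different directions can be paired.\<close>

definition bellman :: "real \<Rightarrow> real \<Rightarrow> real \<Rightarrow> (real \<Rightarrow> real \<Rightarrow> real) \<Rightarrow> bool" where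
  "bellman p q C B \<longleftrightarrow>
     (\<forall>s t. 0 \<le> B s t \<and> B s t \<le> C * (\<bar>s\<bar> powr p + \<bar>t\<bar> powr q)) \<and>
     (\<forall>s t. \<exists>l1 l2 X Y. \<forall>a b. 0 \<le> X a \<and> 0 \<le> Y b \<and> \<bar>a\<bar> * \<bar>b\<bar> \<le> X a + Y b \<and>
        B (s + a) (t + b) \<ge> B s t + l1 * a + l2 * b + X a + Y b)"

lemma bellman_swap: "bellman p q C B \<Longrightarrow> bellman q p C (\<lambda>s t. B t s)"
proof -
  assume B: "bellman p q C B"
  have "\<exists>l1 l2 X Y. \<forall>a b. 0 \<le> X a \<and> 0 \<le> Y b \<and> \<bar>a\<bar> * \<bar>b\<bar> \<le> X a + Y b \<and>
        B (t + b) (s + a) \<ge> B t s + l1 * a + l2 * b + X a + Y b" for s t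
  proof -
    obtain l1 l2 X Y where "\<And>a b. 0 \<le> X a \<and> 0 \<le> Y b \<and> \<bar>a\<bar> * \<bar>b\<bar> \<le> X a + Y b \<and>
        B (t + a) (s + b) \<ge> B t s + l1 * a + l2 * b + X a + Y b"
      using B unfolding bellman_def by meson
    note l = this
    have "0 \<le> Y a \<and> 0 \<le> X b \<and> \<bar>a\<bar> * \<bar>b\<bar> \<le> Y a + X b \<and>
        B (t + b) (s + a) \<ge> B t s + l2 * a + l1 * b + Y a + X b" for a b
      using l[of b a] mult.commute[of "\<bar>b\<bar>" "\<bar>a\<bar>"] by (intro conjI; linarith)
    then show ?thesis by blast
  qed
  moreover have "0 \<le> B t s \<and> B t s \<le> C * (\<bar>s\<bar> powr q + \<bar>t\<bar> powr p)" for s t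
  proof -
    have "0 \<le> B t s \<and> B t s \<le> C * (\<bar>t\<bar> powr p + \<bar>s\<bar> powr q)" using B unfolding bellman_def by blast
    then show ?thesis by (simp add: add.commute)
  qed
  ultimately show ?thesis unfolding bellman_def by blast
qed

text \<open>The gains \<open>X\<close> and \<open>Y\<close> are nonnegative, so an affine function
  touches \<open>B\<close> from below at every point. Hence \<open>B\<close> is convex, and a finite
  convex function on the plane is continuous.\<close>

lemma bellman_borel:
  assumes B: "bellman p q C B"
  shows "(\<lambda>v. B (fst v) (snd v)) \<in> borel_measurable borel"
proof -
  have "convex_on UNIV (\<lambda>v::real \<times> real. B (fst v) (snd v))"
  proof (intro convex_onI)
    fix u :: real and x y :: "real \<times> real"
    assume u: "0 < u" "u < 1"
    define z where "z = (1 - u) *\<^sub>R x + u *\<^sub>R y"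
    obtain l1 l2 X Y where l: "\<And>a b. 0 \<le> X a \<and> 0 \<le> Y b \<and>
        B (fst z + a) (snd z + b) \<ge> B (fst z) (snd z) + l1 * a + l2 * b + X a + Y b"
      using B unfolding bellman_def by meson
    have l': "B (fst w) (snd w) \<ge> B (fst z) (snd z) + (l1 * (fst w - fst z) + l2 * (snd w - snd z))" for w
      using l[of "fst w - fst z" "snd w - snd z"] by simp
    have "(1 - u) * (B (fst z) (snd z) + (l1 * (fst x - fst z) + l2 * (snd x - snd z))) \<le> (1 - u) * B (fst x) (snd x)"
         "u * (B (fst z) (snd z) + (l1 * (fst y - fst z) + l2 * (snd y - snd z))) \<le> u * B (fst y) (snd y)"
      using l' u by (auto intro!: mult_left_mono)
    moreover have "(1 - u) * (B (fst z) (snd z) + (l1 * (fst x - fst z) + l2 * (snd x - snd z))) +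
        u * (B (fst z) (snd z) + (l1 * (fst y - fst z) + l2 * (snd y - snd z))) = B (fst z) (snd z)"
      by (simp add: z_def algebra_simps)
    ultimately show "B (fst ((1 - u) *\<^sub>R x + u *\<^sub>R y)) (snd ((1 - u) *\<^sub>R x + u *\<^sub>R y))
        \<le> (1 - u) * B (fst x) (snd x) + u * B (fst y) (snd y)"
      unfolding z_def by linarith
  qed auto
  then show ?thesis
    by (intro borel_measurable_continuous_onI convex_on_continuous) auto
qed

text \<open>For p > 2 three gains are added: |a|^p from |s|^p, a multiple of max(|t|, |b|)^(q - 2)
  b^2 from |t|^q, and |t|^(2 - q) a^2 from the envelope. If |b| <= |t|, the last two have geometric
  mean |a| |b|; otherwise the second becomes |b|^q and Young's inequality with the first applies.
  For p = 2 squares suffice.\<close>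

lemma bellman_exists_ge2:
  fixes p q :: real
  assumes "2 \<le> p" and pq: "1 / p + 1 / q = 1"
  shows "\<exists>B C. 0 < C \<and> bellman p q C B"
proof (cases "p = 2")
  case True
  have half: "1 / q = 1 / 2" using pq unfolding True by linarith
  then have "q \<noteq> 0" by auto
  then have q: "q = 2" using half by (simp add: field_simps)
  have sq: "\<bar>z\<bar> powr 2 = z\<^sup>2" for z :: real by (cases "z = 0") (auto simp: powr_numeral)
  have ab: "\<bar>a\<bar> * \<bar>b\<bar> \<le> a\<^sup>2 + b\<^sup>2" for a b :: real
  proof -
    have "2 * (\<bar>a\<bar> * \<bar>b\<bar>) \<le> a\<^sup>2 + b\<^sup>2"
      using sum_squares_bound[of "\<bar>a\<bar>" "\<bar>b\<bar>"] by simp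
    moreover have "0 \<le> \<bar>a\<bar> * \<bar>b\<bar>" by simp
    ultimately show ?thesis by linarith
  qed
  have eq: "(s + a)\<^sup>2 + (t + b)\<^sup>2 = s\<^sup>2 + t\<^sup>2 + (2 * s) * a + (2 * t) * b + a\<^sup>2 + b\<^sup>2" for s t a b :: real
    by (simp add: power2_eq_square algebra_simps)
  have "bellman p q 1 (\<lambda>s t. s\<^sup>2 + t\<^sup>2)"
    unfolding bellman_def True q sq
  proof (intro conjI allI)
    fix s t :: real
    have "\<forall>a b. 0 \<le> a\<^sup>2 \<and> 0 \<le> b\<^sup>2 \<and> \<bar>a\<bar> * \<bar>b\<bar> \<le> a\<^sup>2 + b\<^sup>2 \<and>
        s\<^sup>2 + t\<^sup>2 + (2 * s) * a + (2 * t) * b + a\<^sup>2 + b\<^sup>2 \<le> (s + a)\<^sup>2 + (t + b)\<^sup>2"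
      unfolding eq using ab by simp
    then show "\<exists>l1 l2 X Y. \<forall>a b. 0 \<le> X a \<and> 0 \<le> Y b \<and> \<bar>a\<bar> * \<bar>b\<bar> \<le> X a + Y b \<and>
        s\<^sup>2 + t\<^sup>2 + l1 * a + l2 * b + X a + Y b \<le> (s + a)\<^sup>2 + (t + b)\<^sup>2"
      by (rule_tac x = "2 * s" in exI, rule_tac x = "2 * t" in exI,
          rule_tac x = "\<lambda>a. a\<^sup>2" in exI, rule_tac x = "\<lambda>b. b\<^sup>2" in exI)
  qed auto
  then show ?thesis by (intro exI[of _ "\<lambda>s t. s\<^sup>2 + t\<^sup>2"] exI[of _ 1]) auto
next
  case False
  then have p: "p > 2" using assms by simp
  have "q \<noteq> 0" using pq p by auto
  then have "q * (p - 1) = p" using p pq by (simp add: field_simps)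
  then have q_eq: "q = p / (p - 1)" using p by (simp add: field_simps)
  have q: "1 < q" "q < 2" unfolding q_eq using p by (auto simp: field_simps)
  obtain H C where C: "0 < C" and H: "\<And>s t. 0 \<le> H s t \<and> H s t \<le> C * (\<bar>s\<bar> powr p + \<bar>t\<bar> powr q)"
    and H_supp: "\<And>s t. \<exists>l1 l2. \<forall>a b. H (s + a) (t + b) \<ge> H s t + l1 * a + l2 * b + \<bar>t\<bar> powr (2 - q) * a\<^sup>2"
    using envelope_exists[OF q pq] by metis
  \<comment> \<open>\<open>kp\<close> is the constant of \<open>powr_gain_ge2\<close>, and
    \<open>kq\<close> that of \<open>powr_gain_le2\<close> for R = 3 max(|t|, |b|), which bounds
    both |t| and |t + b|. The factor \<open>k\<close> below lifts all three gains to a coefficient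
    of at least 1.\<close>
  define kp where "kp = 2 / 2 powr p"
  define kq where "kq = q * (q - 1) / 2 * 3 powr (q - 2)"
  have kp: "kp > 0" by (simp add: kp_def)
  have kq: "kq > 0" using q by (simp add: kq_def)
  define k where "k = 1 + 1 / kp + 1 / kq"
  have k: "k \<ge> 1" "k * kp \<ge> 1" "k * kq \<ge> 1"
  proof -
    show "k \<ge> 1" using kp kq by (simp add: k_def)
    have "k * kp = kp + 1 + kp / kq" "k * kq = kq + kq / kp + 1"
      using kp kq by (simp_all add: k_def distrib_right)
    then show "k * kp \<ge> 1" "k * kq \<ge> 1" using kp kq by simp_all
  qed
  define B where "B s t = k * (\<bar>s\<bar> powr p + \<bar>t\<bar> powr q + H s t)" for s t
  have "\<exists>l1 l2 X Y. \<forall>a b. 0 \<le> X a \<and> 0 \<le> Y b \<and> \<bar>a\<bar> * \<bar>b\<bar> \<le> X a + Y b \<and>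
        B (s + a) (t + b) \<ge> B s t + l1 * a + l2 * b + X a + Y b" for s t
  proof -
    obtain h1 h2 where h: "\<And>a b. H (s + a) (t + b) \<ge> H s t + h1 * a + h2 * b + \<bar>t\<bar> powr (2 - q) * a\<^sup>2"
      using H_supp by metis
    define l1 where "l1 = k * (h1 + p * \<bar>s\<bar> powr (p - 1) * sgn s)"
    define l2 where "l2 = k * (h2 + q * \<bar>t\<bar> powr (q - 1) * sgn t)"
    define X where "X a = \<bar>a\<bar> powr p + \<bar>t\<bar> powr (2 - q) * a\<^sup>2" for a
    define Y where "Y b = max \<bar>t\<bar> \<bar>b\<bar> powr (q - 2) * b\<^sup>2" for b
    have gt: "\<bar>t + b\<bar> powr q \<ge> \<bar>t\<bar> powr q + q * \<bar>t\<bar> powr (q - 1) * sgn t * b + kq * Y b" for b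
    proof (cases "max \<bar>t\<bar> \<bar>b\<bar> = 0")
      case False
      then have R: "max \<bar>t\<bar> \<bar>b\<bar> > 0" by linarith
      have "q * (q - 1) / 2 * (3 * max \<bar>t\<bar> \<bar>b\<bar>) powr (q - 2) * b\<^sup>2 = kq * Y b"
        by (simp add: powr_mult kq_def Y_def)
      moreover have "\<bar>t\<bar> \<le> 3 * max \<bar>t\<bar> \<bar>b\<bar>" "\<bar>t + b\<bar> \<le> 3 * max \<bar>t\<bar> \<bar>b\<bar>" by linarith+
      ultimately show ?thesis using powr_gain_le2[of q t "3 * max \<bar>t\<bar> \<bar>b\<bar>" b] q R by simp
    qed (auto simp: Y_def max_def split: if_splits)
    have gs: "\<bar>s + a\<bar> powr p \<ge> \<bar>s\<bar> powr p + p * \<bar>s\<bar> powr (p - 1) * sgn s * a + kp * \<bar>a\<bar> powr p" for a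
      using powr_gain_ge2[of p s a] p by (simp add: powr_divide kp_def)
    have main: "B (s + a) (t + b) \<ge> B s t + l1 * a + l2 * b + k * (kp * \<bar>a\<bar> powr p + kq * Y b + \<bar>t\<bar> powr (2 - q) * a\<^sup>2)" for a b
    proof -
      have "k * (\<bar>s\<bar> powr p + p * \<bar>s\<bar> powr (p - 1) * sgn s * a + kp * \<bar>a\<bar> powr p + (\<bar>t\<bar> powr q + q * \<bar>t\<bar> powr (q - 1) * sgn t * b + kq * Y b)
           + (H s t + h1 * a + h2 * b + \<bar>t\<bar> powr (2 - q) * a\<^sup>2)) \<le> B (s + a) (t + b)"
        unfolding B_def using k by (intro mult_left_mono add_mono gs gt h) auto
      then show ?thesis by (simp add: B_def l1_def l2_def algebra_simps)
    qed
    have Y0: "Y b \<ge> 0" for b by (simp add: Y_def)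
    have X0: "X a \<ge> 0" for a by (simp add: X_def)
    have XY: "X a + Y b \<le> k * (kp * \<bar>a\<bar> powr p + kq * Y b + \<bar>t\<bar> powr (2 - q) * a\<^sup>2)" for a b
    proof -
      have "1 * \<bar>a\<bar> powr p \<le> (k * kp) * \<bar>a\<bar> powr p" "1 * Y b \<le> (k * kq) * Y b"
        "1 * (\<bar>t\<bar> powr (2 - q) * a\<^sup>2) \<le> k * (\<bar>t\<bar> powr (2 - q) * a\<^sup>2)"
        using k Y0 by (intro mult_right_mono; simp)+
      then show ?thesis by (simp add: X_def algebra_simps)
    qed
    have ab: "\<bar>a\<bar> * \<bar>b\<bar> \<le> X a + Y b" for a b
    proof (cases "\<bar>b\<bar> \<le> \<bar>t\<bar>")
      case True
      show ?thesis
      proof (cases "t = 0")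
        case False
        define r where "r = \<bar>t\<bar> powr ((2 - q) / 2)"
        have r: "r > 0" "r\<^sup>2 = \<bar>t\<bar> powr (2 - q)" using False by (auto simp: r_def power2_eq_square simp flip: powr_add)
        have "\<bar>t\<bar> powr (q - 2) = 1 / r\<^sup>2" using False unfolding r by (simp add: powr_diff)
        then have "Y b = (\<bar>b\<bar> / r)\<^sup>2" using True by (simp add: Y_def power_divide)
        moreover have "(r * \<bar>a\<bar>)\<^sup>2 \<le> X a" using r by (simp add: X_def power_mult_distrib)
        moreover have "2 * ((r * \<bar>a\<bar>) * (\<bar>b\<bar> / r)) \<le> (r * \<bar>a\<bar>)\<^sup>2 + (\<bar>b\<bar> / r)\<^sup>2"
          using sum_squares_bound[of "r * \<bar>a\<bar>" "\<bar>b\<bar> / r"] by (simp only: mult.assoc)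
        moreover have "(r * \<bar>a\<bar>) * (\<bar>b\<bar> / r) = \<bar>a\<bar> * \<bar>b\<bar>" using r by simp
        moreover have "0 \<le> \<bar>a\<bar> * \<bar>b\<bar>" by simp
        ultimately show ?thesis by linarith
      qed (use True X0 Y0 in simp)
    next
      case False
      then have "b \<noteq> 0" by auto
      then have "Y b = \<bar>b\<bar> powr q" using False powr_add[of "\<bar>b\<bar>" "q - 2" 2] by (simp add: Y_def max_def powr_numeral)
      moreover have "\<bar>a\<bar> * \<bar>b\<bar> \<le> \<bar>a\<bar> powr p / p + \<bar>b\<bar> powr q / q"
        using Youngs_inequality[of p q "\<bar>a\<bar>" "\<bar>b\<bar>"] p q pq by simp
      moreover have "\<bar>a\<bar> powr p / p \<le> \<bar>a\<bar> powr p" "\<bar>b\<bar> powr q / q \<le> \<bar>b\<bar> powr q"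
        using p q by (auto simp: divide_le_eq mult_le_cancel_left1)
      moreover have "\<bar>a\<bar> powr p \<le> X a" by (simp add: X_def)
      ultimately show ?thesis by linarith
    qed
    show ?thesis
    proof (intro exI allI conjI)
      fix a b
      show "B (s + a) (t + b) \<ge> B s t + l1 * a + l2 * b + X a + Y b"
        using main[of a b] XY[of a b] by linarith
    qed (use X0 Y0 ab in auto)
  qed
  moreover have "0 \<le> B s t \<and> B s t \<le> (k * (1 + C)) * (\<bar>s\<bar> powr p + \<bar>t\<bar> powr q)" for s t
  proof -
    have "k * (\<bar>s\<bar> powr p + \<bar>t\<bar> powr q + H s t) \<le> k * (\<bar>s\<bar> powr p + \<bar>t\<bar> powr q + C * (\<bar>s\<bar> powr p + \<bar>t\<bar> powr q))"
      using H k by (intro mult_left_mono add_mono) auto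
    moreover have "0 \<le> B s t" unfolding B_def using H k by (intro mult_nonneg_nonneg add_nonneg_nonneg) auto
    ultimately show ?thesis by (simp add: B_def algebra_simps)
  qed
  ultimately have "bellman p q (k * (1 + C)) B" unfolding bellman_def by blast
  moreover have "k * (1 + C) > 0" using k C by (intro mult_pos_pos) auto
  ultimately show ?thesis by blast
qed

lemma bellman_exists:
  fixes p q :: real
  assumes "1 < p" "1 < q" "1 / p + 1 / q = 1"
  shows "\<exists>B C. 0 < C \<and> bellman p q C B"
proof (cases "2 \<le> p")
  case True
  then show ?thesis using bellman_exists_ge2 assms by blast
next
  case False
  have "2 \<le> q"
  proof (rule ccontr)
    assume "\<not> 2 \<le> q"
    then have "1 / 2 < 1 / p" "1 / 2 < 1 / q" using False assms by (auto simp: field_simps)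
    then show False using assms(3) by linarith
  qed
  then obtain B C where "0 < C" "bellman q p C B" using bellman_exists_ge2[of q p] assms by (auto simp: add.commute)
  then show ?thesis using bellman_swap by blast
qed

section \<open>Random walks on \<open>L\<^sup>p\<close>\<close>

lemma lborel_integrable_translate:
  fixes f :: "'a::euclidean_space \<Rightarrow> real"
  assumes "integrable lborel f"
  shows "integrable lborel (\<lambda>x. f (x + c))"
proof -
  have "integrable (distr lborel borel ((+) c)) f" using assms by (simp add: lborel_distr_plus)
  then show ?thesis using assms by (subst (asm) integrable_distr_eq) (auto simp: add.commute)
qed

lemma lborel_integral_translate:
  fixes f :: "'a::euclidean_space \<Rightarrow> real"
  assumes "f \<in> borel_measurable borel"
  shows "(LBINT x. f (x + c)) = (LBINT x. f x)"
proof -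
  have "(LBINT x. f x) = (\<integral>x. f x \<partial>distr lborel borel ((+) c))" by (simp add: lborel_distr_plus)
  also have "\<dots> = (LBINT x. f (x + c))" using assms by (subst integral_distr) (auto simp: add.commute)
  finally show ?thesis by simp
qed

text \<open>Borel functions with the Borel version of Lebesgue measure, so that translates and
  convolutions stay measurable. The transition from \<open>Lp\<close> is made once, in the final
  theorem.\<close>

definition lp :: "real \<Rightarrow> ('a::euclidean_space \<Rightarrow> real) set" where
  "lp p = {f \<in> borel_measurable borel. integrable lborel (\<lambda>x. \<bar>f x\<bar> powr p)}"

lemma lp_measurable [measurable_dest]: "f \<in> lp p \<Longrightarrow> f \<in> borel_measurable borel"
  by (simp add: lp_def)

lemma lp_integrable: "f \<in> lp p \<Longrightarrow> integrable lborel (\<lambda>x. \<bar>f x\<bar> powr p)"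
  by (simp add: lp_def)

lemma powr_add_le:
  fixes a b p :: real
  assumes "1 < p"
  shows "\<bar>a + b\<bar> powr p \<le> 2 powr p * (\<bar>a\<bar> powr p + \<bar>b\<bar> powr p)"
proof -
  define m where "m = max \<bar>a\<bar> \<bar>b\<bar>"
  have "\<bar>a + b\<bar> powr p \<le> (2 * m) powr p" using assms by (intro powr_mono2) (auto simp: m_def)
  also have "\<dots> = 2 powr p * m powr p" by (simp add: powr_mult m_def)
  also have "m powr p \<le> \<bar>a\<bar> powr p + \<bar>b\<bar> powr p" by (auto simp: m_def max_def)
  finally show ?thesis by simp
qed

lemma lp_add:
  assumes "1 < p" "f \<in> lp p" "g \<in> lp p"
  shows "(\<lambda>x. f x + g x) \<in> lp p"
proof -
  note [measurable] = lp_measurable[OF assms(2)] lp_measurable[OF assms(3)]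
  have "integrable lborel (\<lambda>x. \<bar>f x + g x\<bar> powr p)"
  proof (rule Bochner_Integration.integrable_bound)
    show "integrable lborel (\<lambda>x. 2 powr p * (\<bar>f x\<bar> powr p + \<bar>g x\<bar> powr p))"
      using assms(2,3) by (auto simp: lp_def)
    show "AE x in lborel. norm (\<bar>f x + g x\<bar> powr p) \<le> norm (2 powr p * (\<bar>f x\<bar> powr p + \<bar>g x\<bar> powr p))"
      using powr_add_le[OF assms(1)] by simp
  qed measurable
  then show ?thesis by (simp add: lp_def)
qed

lemma lp_cmult:
  assumes "f \<in> lp p"
  shows "(\<lambda>x. c * f x) \<in> lp p"
  using assms by (auto simp: lp_def abs_mult powr_mult)

lemma lp_diff:
  assumes "1 < p" "f \<in> lp p" "g \<in> lp p"
  shows "(\<lambda>x. f x - g x) \<in> lp p"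
  using lp_add[OF assms(1,2) lp_cmult[OF assms(3), of "-1"]] by simp

lemma lp_translate:
  assumes "f \<in> lp p"
  shows "(\<lambda>x. f (x + c)) \<in> lp p" "(\<lambda>x. f (x - c)) \<in> lp p"
proof -
  have *: "(\<lambda>x. f (x + c)) \<in> lp p" for c
    using assms lborel_integrable_translate[of "\<lambda>x. \<bar>f x\<bar> powr p" c] by (auto simp: lp_def)
  show "(\<lambda>x. f (x + c)) \<in> lp p" "(\<lambda>x. f (x - c)) \<in> lp p" using *[of c] *[of "-c"] by auto
qed

lemma lp_mult_integrable:
  assumes "1 < p" "1 < q" "1 / p + 1 / q = 1" "f \<in> lp p" "g \<in> lp q"
  shows "integrable lborel (\<lambda>x. f x * g x)"
proof (rule Bochner_Integration.integrable_bound)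
  note [measurable] = lp_measurable[OF assms(4)] lp_measurable[OF assms(5)]
  show "integrable lborel (\<lambda>x. \<bar>f x\<bar> powr p / p + \<bar>g x\<bar> powr q / q)" using assms by (auto simp: lp_def)
  show "AE x in lborel. norm (f x * g x) \<le> norm (\<bar>f x\<bar> powr p / p + \<bar>g x\<bar> powr q / q)"
    using Youngs_inequality[OF assms(1-3)] assms(1,2) by (simp add: abs_mult)
  show "(\<lambda>x. f x * g x) \<in> borel_measurable lborel" by measurable
qed

lemma lp_abs: "f \<in> lp p \<Longrightarrow> (\<lambda>x. \<bar>f x\<bar>) \<in> lp p"
  by (auto simp: lp_def)

text \<open>The weight 1/2 of the point itself matters: a nonnegative function is bounded by a
  multiple of its mean at \<open>x\<close> and not only at the neighbours, so one step controls the
  differences \<open>f (x + w k) - f x\<close>.\<close>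

definition walk :: "('k::finite \<Rightarrow> 'a::real_vector) \<Rightarrow> ('a \<Rightarrow> real) \<Rightarrow> 'a \<Rightarrow> real" where
  "walk w f x = f x / 2 + (\<Sum>k\<in>UNIV. f (x + w k) + f (x - w k)) / (4 * real CARD('k))"

lemma walk_const [simp]: "walk w (\<lambda>y. c) x = c"
  for w :: "'k::finite \<Rightarrow> 'a::real_vector"
  by (simp add: walk_def)

lemma walk_add: "walk w (\<lambda>y. f y + g y) x = walk w f x + walk w g x"
  by (simp add: walk_def sum.distrib add_divide_distrib algebra_simps)

lemma walk_cmult: "walk w (\<lambda>y. c * f y) x = c * walk w f x"
proof -
  have "(\<Sum>k\<in>UNIV. c * f (x + w k) + c * f (x - w k)) = c * (\<Sum>k\<in>UNIV. f (x + w k) + f (x - w k))"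
    by (simp add: sum_distrib_left distrib_left)
  then show ?thesis by (simp add: walk_def distrib_left)
qed

lemma walk_diff: "walk w (\<lambda>y. f y - g y) x = walk w f x - walk w g x"
  using walk_add[of w f "\<lambda>y. - 1 * g y" x] walk_cmult[of w "-1" g x] by simp

lemma walk_mono: "(\<And>y. f y \<le> g y) \<Longrightarrow> walk w f x \<le> walk w g x"
  unfolding walk_def by (intro add_mono divide_right_mono sum_mono) auto

lemma walk_translate: "walk w f (x + c) = walk w (\<lambda>y. f (y + c)) x"
  by (simp add: walk_def algebra_simps)

lemma walk_ge:
  fixes w :: "'k::finite \<Rightarrow> 'a::real_vector"
  assumes "\<And>y. 0 \<le> G y"
  shows "G x \<le> 4 * real CARD('k) * walk w G x" "G (x + w k) \<le> 4 * real CARD('k) * walk w G x"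
proof -
  define N where "N = real CARD('k)"
  have N: "N \<ge> 1" by (simp add: N_def Suc_leI)
  define S where "S = (\<Sum>k\<in>UNIV. G (x + w k) + G (x - w k))"
  have S: "G (x + w k) \<le> S"
  proof -
    have "G (x + w k) \<le> G (x + w k) + G (x - w k)" using assms by simp
    also have "\<dots> \<le> S" unfolding S_def by (rule member_le_sum) (auto intro: add_nonneg_nonneg assms)
    finally show ?thesis .
  qed
  have eq: "4 * N * walk w G x = 2 * N * G x + S"
    using N by (simp add: walk_def S_def N_def field_simps)
  have "1 * G x \<le> 2 * N * G x" using assms N by (intro mult_right_mono) auto
  then show "G x \<le> 4 * real CARD('k) * walk w G x" "G (x + w k) \<le> 4 * real CARD('k) * walk w G x"
    using S assms[of x] assms[of "x + w k"] eq unfolding N_def[symmetric] by linarith+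
qed

lemma walk_measurable [measurable]:
  fixes w :: "'k::finite \<Rightarrow> 'a::euclidean_space"
  assumes [measurable]: "f \<in> borel_measurable borel"
  shows "walk w f \<in> borel_measurable borel"
  unfolding walk_def by measurable

lemma walk_integrable:
  fixes w :: "'k::finite \<Rightarrow> 'a::euclidean_space"
  assumes "integrable lborel h"
  shows "integrable lborel (walk w h)" "(LBINT x. walk w h x) = (LBINT x. h x)"
proof -
  have t: "integrable lborel (\<lambda>x. h (x + c))" "integrable lborel (\<lambda>x. h (x - c))" for c
    using lborel_integrable_translate[OF assms, of c] lborel_integrable_translate[OF assms, of "-c"] by auto
  have m: "h \<in> borel_measurable borel" using assms by auto
  have i: "(LBINT x. h (x + c)) = (LBINT x. h x)" "(LBINT x. h (x - c)) = (LBINT x. h x)" for c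
    using lborel_integral_translate[OF m, of c] lborel_integral_translate[OF m, of "-c"] by auto
  show "integrable lborel (walk w h)" unfolding walk_def using assms t by auto
  show "(LBINT x. walk w h x) = (LBINT x. h x)"
    unfolding walk_def using assms t by (simp add: i)
qed

text \<open>Jensen's inequality: the tangent is taken at the mean, so averaging removes the linear
  term.\<close>

lemma walk_powr_le:
  assumes "1 < p"
  shows "\<bar>walk w f x\<bar> powr p \<le> walk w (\<lambda>y. \<bar>f y\<bar> powr p) x"
proof -
  define s where "s = walk w f x"
  define l where "l = p * \<bar>s\<bar> powr (p - 1) * sgn s"
  have "walk w (\<lambda>y. \<bar>s\<bar> powr p + l * (f y - s)) x \<le> walk w (\<lambda>y. \<bar>f y\<bar> powr p) x"
    using powr_tangent[OF assms] by (intro walk_mono) (simp add: l_def)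
  then show ?thesis by (simp add: walk_add walk_cmult walk_diff s_def)
qed

lemma lp_walk:
  fixes w :: "'k::finite \<Rightarrow> 'a::euclidean_space"
  assumes "1 < p" "f \<in> lp p"
  shows "walk w f \<in> lp p" "(LBINT x. \<bar>walk w f x\<bar> powr p) \<le> (LBINT x. \<bar>f x\<bar> powr p)"
proof -
  note [measurable] = lp_measurable[OF assms(2)]
  note i = walk_integrable[OF lp_integrable[OF assms(2)], of w]
  have "integrable lborel (\<lambda>x. \<bar>walk w f x\<bar> powr p)"
  proof (rule Bochner_Integration.integrable_bound[OF i(1)])
    have "\<bar>walk w f x\<bar> powr p \<le> \<bar>walk w (\<lambda>y. \<bar>f y\<bar> powr p) x\<bar>" for x
      using walk_powr_le[OF assms(1), of w f x] by linarith
    then show "AE x in lborel. norm (\<bar>walk w f x\<bar> powr p) \<le> norm (walk w (\<lambda>y. \<bar>f y\<bar> powr p) x)" by simp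
  qed measurable
  then show "walk w f \<in> lp p" by (simp add: lp_def)
  have "(LBINT x. \<bar>walk w f x\<bar> powr p) \<le> (LBINT x. walk w (\<lambda>y. \<bar>f y\<bar> powr p) x)"
    by (rule integral_mono) (use \<open>integrable lborel (\<lambda>x. \<bar>walk w f x\<bar> powr p)\<close> i walk_powr_le[OF assms(1)] in auto)
  then show "(LBINT x. \<bar>walk w f x\<bar> powr p) \<le> (LBINT x. \<bar>f x\<bar> powr p)" using i(2) by simp
qed

text \<open>Averaging the lower bound for \<open>B\<close> at the mean (s, t) cancels the linear
  terms and leaves the mean of the gains \<open>X + Y\<close>. Each evaluation point has weight at
  least 1/(4 N), so its own gain is at most 4 N times that mean. The product of differences expands
  into four products of deviations, each bounded by two gains; this gives 32 N.\<close>

lemma walk_gain: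
  fixes w :: "'k::finite \<Rightarrow> 'a::real_vector"
  assumes B: "bellman p q C B"
  shows "\<bar>f (x + w j) - f x\<bar> * \<bar>g (x + w k) - g x\<bar>
    \<le> 32 * real CARD('k) * (walk w (\<lambda>y. B (f y) (g y)) x - B (walk w f x) (walk w g x))"
proof -
  define N where "N = real CARD('k)"
  define s t where "s = walk w f x" and "t = walk w g x"
  obtain l1 l2 X Y where l: "\<And>a b. 0 \<le> X a \<and> 0 \<le> Y b \<and> \<bar>a\<bar> * \<bar>b\<bar> \<le> X a + Y b \<and>
        B (s + a) (t + b) \<ge> B s t + l1 * a + l2 * b + X a + Y b"
    using B unfolding bellman_def by meson
  define G where "G y = X (f y - s) + Y (g y - t)" for y
  define \<Gamma> where "\<Gamma> = walk w (\<lambda>y. B (f y) (g y)) x - B s t"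
  have G0: "0 \<le> G y" for y using l by (simp add: G_def)
  have "walk w (\<lambda>y. B s t + (l1 * (f y - s) + (l2 * (g y - t) + G y))) x \<le> walk w (\<lambda>y. B (f y) (g y)) x"
  proof (rule walk_mono)
    fix y show "B s t + (l1 * (f y - s) + (l2 * (g y - t) + G y)) \<le> B (f y) (g y)"
      using l[of "f y - s" "g y - t"] by (simp add: G_def)
  qed
  then have "walk w G x \<le> \<Gamma>"
    by (simp add: walk_add walk_cmult walk_diff s_def t_def \<Gamma>_def)
  then have "4 * N * walk w G x \<le> 4 * N * \<Gamma>" by (simp add: N_def)
  then have G_le: "G x \<le> 4 * N * \<Gamma>" "G (x + w m) \<le> 4 * N * \<Gamma>" for m
    using walk_ge[of G x w] walk_ge(2)[of G x w m] G0 unfolding N_def by (meson order_trans)+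
  \<comment> \<open>\<open>X\<close> is taken at \<open>y\<close> and \<open>Y\<close> at
    \<open>z\<close>. Here it matters that the gain splits: the differences of \<open>f\<close> and
    \<open>g\<close> go in the directions \<open>j\<close> and \<open>k\<close>, which may
    differ.\<close>
  have pair: "\<bar>f y - s\<bar> * \<bar>g z - t\<bar> \<le> 8 * N * \<Gamma>" if "G y \<le> 4 * N * \<Gamma>" "G z \<le> 4 * N * \<Gamma>" for y z
  proof -
    have "\<bar>f y - s\<bar> * \<bar>g z - t\<bar> \<le> X (f y - s) + Y (g z - t)" using l by blast
    moreover have "X (f y - s) \<le> G y" "Y (g z - t) \<le> G z" using l by (auto simp: G_def)
    ultimately show ?thesis using that by linarith
  qed
  have "\<bar>f (x + w j) - f x\<bar> * \<bar>g (x + w k) - g x\<bar> \<le> (\<bar>f (x + w j) - s\<bar> + \<bar>f x - s\<bar>) * (\<bar>g (x + w k) - t\<bar> + \<bar>g x - t\<bar>)"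
    by (intro mult_mono) auto
  also have "\<dots> = \<bar>f (x + w j) - s\<bar> * \<bar>g (x + w k) - t\<bar> + \<bar>f (x + w j) - s\<bar> * \<bar>g x - t\<bar>
     + \<bar>f x - s\<bar> * \<bar>g (x + w k) - t\<bar> + \<bar>f x - s\<bar> * \<bar>g x - t\<bar>" by (simp add: algebra_simps)
  also have "\<dots> \<le> 8 * N * \<Gamma> + 8 * N * \<Gamma> + 8 * N * \<Gamma> + 8 * N * \<Gamma>"
    by (intro add_mono pair G_le)
  finally show ?thesis by (simp add: N_def \<Gamma>_def s_def t_def)
qed

lemma lp_iter_walk:
  fixes w :: "'k::finite \<Rightarrow> 'a::euclidean_space"
  assumes "1 < p" "f \<in> lp p"
  shows "(walk w ^^ m) f \<in> lp p"
    "(LBINT x. \<bar>(walk w ^^ m) f x\<bar> powr p) \<le> (LBINT x. \<bar>f x\<bar> powr p)"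
proof (induction m)
  case (Suc m)
  { case 1 show ?case using lp_walk(1)[OF assms(1) Suc(1)] by simp }
  { case 2 show ?case using lp_walk(2)[OF assms(1) Suc(1), of w] Suc(2) by simp }
qed (use assms in auto)

lemma walk_gain_sum:
  fixes w :: "'k::finite \<Rightarrow> 'a::euclidean_space"
  assumes B: "bellman p q C B" and pq: "1 < p" "1 < q" "1 / p + 1 / q = 1"
    and f: "f \<in> lp p" and g: "g \<in> lp q"
  shows "(\<Sum>l<L. LBINT x. \<bar>(walk w ^^ l) f (x + w j) - (walk w ^^ l) f x\<bar> * \<bar>(walk w ^^ l) g (x + w k) - (walk w ^^ l) g x\<bar>)
    \<le> 32 * real CARD('k) * C * ((LBINT x. \<bar>f x\<bar> powr p) + (LBINT x. \<bar>g x\<bar> powr q))"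
proof -
  define N where "N = real CARD('k)"
  have N: "N > 0" by (simp add: N_def)
  define F where "F l = (walk w ^^ l) f" for l
  define H where "H l = (walk w ^^ l) g" for l
  have F: "F l \<in> lp p" and H: "H l \<in> lp q" for l
    using lp_iter_walk(1) pq f g by (auto simp: F_def H_def)
  have FS: "F (Suc l) = walk w (F l)" and HS: "H (Suc l) = walk w (H l)" for l by (auto simp: F_def H_def)
  have Bp: "0 \<le> B s t" "B s t \<le> C * (\<bar>s\<bar> powr p + \<bar>t\<bar> powr q)" for s t using B by (auto simp: bellman_def)
  have Bm: "(\<lambda>x. B (u x) (v x)) \<in> borel_measurable borel"
    if [measurable]: "u \<in> borel_measurable borel" "v \<in> borel_measurable borel" for u v :: "'a \<Rightarrow> real"
    using measurable_compose[OF _ bellman_borel[OF B], of "\<lambda>x. (u x, v x)" borel] by simp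
  have Bi: "integrable lborel (\<lambda>x. B (F l x) (H l x))" for l
  proof (rule Bochner_Integration.integrable_bound)
    show "integrable lborel (\<lambda>x. C * (\<bar>F l x\<bar> powr p + \<bar>H l x\<bar> powr q))"
      using F H by (auto simp: lp_def)
    show "(\<lambda>x. B (F l x) (H l x)) \<in> borel_measurable lborel" using Bm F H by (simp add: lp_measurable)
    have "\<bar>B s t\<bar> \<le> \<bar>C * (\<bar>s\<bar> powr p + \<bar>t\<bar> powr q)\<bar>" for s t using Bp[of s t] by linarith
    then show "AE x in lborel. norm (B (F l x) (H l x)) \<le> norm (C * (\<bar>F l x\<bar> powr p + \<bar>H l x\<bar> powr q))" by simp
  qed
  define b where "b l = (LBINT x. B (F l x) (H l x))" for l
  have b0: "b l \<ge> 0" for l unfolding b_def using Bp by (intro integral_nonneg_AE) auto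
  have "(LBINT x. \<bar>F l (x + w j) - F l x\<bar> * \<bar>H l (x + w k) - H l x\<bar>) \<le> 32 * N * (b l - b (Suc l))" for l
  proof -
    have "(LBINT x. \<bar>F l (x + w j) - F l x\<bar> * \<bar>H l (x + w k) - H l x\<bar>)
       \<le> (LBINT x. 32 * N * (walk w (\<lambda>y. B (F l y) (H l y)) x - B (F (Suc l) x) (H (Suc l) x)))"
    proof (rule integral_mono)
      show "integrable lborel (\<lambda>x. \<bar>F l (x + w j) - F l x\<bar> * \<bar>H l (x + w k) - H l x\<bar>)"
        by (intro lp_mult_integrable[OF pq] lp_abs lp_diff lp_translate pq F H)
      show "integrable lborel (\<lambda>x. 32 * N * (walk w (\<lambda>y. B (F l y) (H l y)) x - B (F (Suc l) x) (H (Suc l) x)))"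
        using Bi walk_integrable(1)[OF Bi] by (intro integrable_mult_right Bochner_Integration.integrable_diff)
      show "\<bar>F l (x + w j) - F l x\<bar> * \<bar>H l (x + w k) - H l x\<bar>
         \<le> 32 * N * (walk w (\<lambda>y. B (F l y) (H l y)) x - B (F (Suc l) x) (H (Suc l) x))" for x
        using walk_gain[OF B, of "F l" x w j "H l" k] by (simp add: FS HS N_def)
    qed
    \<comment> \<open>\<open>walk\<close> preserves the integral, so the gain integrates to the drop
      of \<open>b\<close> in one step.\<close>
    also have "\<dots> = 32 * N * (b l - b (Suc l))"
      using Bi walk_integrable[OF Bi, of w] by (simp add: b_def)
    finally show ?thesis .
  qed
  then have "(\<Sum>l<L. LBINT x. \<bar>F l (x + w j) - F l x\<bar> * \<bar>H l (x + w k) - H l x\<bar>) \<le> (\<Sum>l<L. 32 * N * (b l - b (Suc l)))"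
    by (intro sum_mono) auto
  also have "\<dots> = 32 * N * (b 0 - b L)"
    by (simp add: sum_distrib_left[symmetric] sum_lessThan_telescope')
  also have "\<dots> \<le> 32 * N * b 0" using b0 N by simp
  also have "b 0 \<le> (LBINT x. C * (\<bar>f x\<bar> powr p + \<bar>g x\<bar> powr q))"
    unfolding b_def using Bi[of 0] Bp f g by (intro integral_mono) (auto simp: F_def H_def lp_def)
  also have "\<dots> = C * ((LBINT x. \<bar>f x\<bar> powr p) + (LBINT x. \<bar>g x\<bar> powr q))"
    using f g by (simp add: lp_def)
  finally show ?thesis using N unfolding F_def H_def N_def by (simp add: mult.assoc)
qed

lemma walk_selfadjoint:
  fixes w :: "'k::finite \<Rightarrow> 'a::euclidean_space"
  assumes pq: "1 < p" "1 < q" "1 / p + 1 / q = 1" and f: "f \<in> lp p" and g: "g \<in> lp q"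
  shows "(LBINT x. walk w f x * g x) = (LBINT x. f x * walk w g x)"
proof -
  note [measurable] = lp_measurable[OF f] lp_measurable[OF g]
  note I = lp_mult_integrable[OF pq]
  have *: "(LBINT x. f (x + c) * g x) = (LBINT x. f x * g (x - c))" for c
    using lborel_integral_translate[of "\<lambda>x. f x * g (x - c)" c] by simp
  have **: "(LBINT x. f (x - c) * g x) = (LBINT x. f x * g (x + c))" for c
    using *[of "-c"] by simp
  have i1: "integrable lborel (\<lambda>x. f x * g x)" "integrable lborel (\<lambda>x. f (x + c) * g x)" "integrable lborel (\<lambda>x. f (x - c) * g x)"
     "integrable lborel (\<lambda>x. f x * g (x + c))" "integrable lborel (\<lambda>x. f x * g (x - c))" for c
    by (intro I lp_translate f g)+
  have "(LBINT x. walk w f x * g x) = (LBINT x. f x * g x / 2 + (\<Sum>k\<in>UNIV. f (x + w k) * g x + f (x - w k) * g x) / (4 * real CARD('k)))"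
    by (intro Bochner_Integration.integral_cong) (auto simp: walk_def distrib_right sum_distrib_right)
  also have "\<dots> = (LBINT x. f x * g x) / 2 + (\<Sum>k\<in>UNIV. (LBINT x. f (x + w k) * g x) + (LBINT x. f (x - w k) * g x)) / (4 * real CARD('k))"
    using i1 by simp
  also have "\<dots> = (LBINT x. f x * g x) / 2 + (\<Sum>k\<in>UNIV. (LBINT x. f x * g (x + w k)) + (LBINT x. f x * g (x - w k))) / (4 * real CARD('k))"
    unfolding * ** by (simp add: add.commute)
  also have "\<dots> = (LBINT x. f x * g x / 2 + (\<Sum>k\<in>UNIV. f x * g (x + w k) + f x * g (x - w k)) / (4 * real CARD('k)))"
    using i1 by simp
  also have "\<dots> = (LBINT x. f x * walk w g x)"
    by (intro Bochner_Integration.integral_cong) (auto simp: walk_def distrib_left sum_distrib_left)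
  finally show ?thesis .
qed

lemma iter_walk_selfadjoint:
  fixes w :: "'k::finite \<Rightarrow> 'a::euclidean_space"
  assumes pq: "1 < p" "1 < q" "1 / p + 1 / q = 1" and f: "f \<in> lp p" and g: "g \<in> lp q"
  shows "(LBINT x. (walk w ^^ m) f x * g x) = (LBINT x. f x * (walk w ^^ m) g x)"
  using g
proof (induction m arbitrary: g)
  case (Suc m)
  have "(LBINT x. (walk w ^^ Suc m) f x * g x) = (LBINT x. (walk w ^^ m) f x * walk w g x)"
    using walk_selfadjoint[OF pq lp_iter_walk(1)[OF pq(1) f] Suc.prems] by simp
  also have "\<dots> = (LBINT x. f x * (walk w ^^ m) (walk w g) x)"
    by (rule Suc.IH) (rule lp_walk(1)[OF pq(2) Suc.prems])
  finally show ?case by (simp add: funpow_swap1)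
qed simp

text \<open>Up to the factor 1/(4 N), \<open>f - walk w f\<close> is minus the sum of the second
  differences of \<open>f\<close>, each a backward difference of \<open>d k\<close>. Translating the
  shifted term by \<open>w k\<close> moves that difference onto \<open>g\<close>.\<close>

lemma walk_by_parts:
  fixes w :: "'k::finite \<Rightarrow> 'a::euclidean_space"
  assumes pq: "1 < p" "1 < q" "1 / p + 1 / q = 1" and f: "f \<in> lp p" and g: "g \<in> lp q"
  shows "(LBINT x. (f x - walk w f x) * g x)
    = (\<Sum>k\<in>UNIV. LBINT x. (f (x + w k) - f x) * (g (x + w k) - g x)) / (4 * real CARD('k))"
proof -
  note [measurable] = lp_measurable[OF f] lp_measurable[OF g]
  define d where "d k x = f (x + w k) - f x" for k x
  have d: "d k \<in> lp p" for k unfolding d_def by (intro lp_diff lp_translate f pq)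
  note [measurable] = lp_measurable[OF d]
  note I = lp_mult_integrable[OF pq]
  have i: "integrable lborel (\<lambda>x. d k x * g x)" "integrable lborel (\<lambda>x. d k (x - w k) * g x)" "integrable lborel (\<lambda>x. d k x * g (x + w k))" for k
    by (intro I lp_translate d g)+
  have eq: "f x - walk w f x = (\<Sum>k\<in>UNIV. d k (x - w k) - d k x) / (4 * real CARD('k))" for x
  proof -
    have "(\<Sum>k\<in>UNIV. d k (x - w k) - d k x) = 2 * real CARD('k) * f x - (\<Sum>k\<in>UNIV. f (x + w k) + f (x - w k))"
      by (simp add: d_def sum_subtractf sum.distrib sum_negf)
    then show ?thesis by (simp add: walk_def field_simps)
  qed
  have shift: "(LBINT x. d k (x - w k) * g x) = (LBINT x. d k x * g (x + w k))" for k
    using lborel_integral_translate[of "\<lambda>x. d k (x - w k) * g x" "w k"] by simp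
  have "(LBINT x. (f x - walk w f x) * g x) = (LBINT x. (\<Sum>k\<in>UNIV. d k (x - w k) * g x - d k x * g x) / (4 * real CARD('k)))"
    by (simp add: eq sum_distrib_right left_diff_distrib)
  also have "\<dots> = (\<Sum>k\<in>UNIV. (LBINT x. d k (x - w k) * g x) - (LBINT x. d k x * g x)) / (4 * real CARD('k))"
    using i by simp
  also have "(\<Sum>k\<in>UNIV. (LBINT x. d k (x - w k) * g x) - (LBINT x. d k x * g x))
     = (\<Sum>k\<in>UNIV. LBINT x. d k x * (g (x + w k) - g x))"
    unfolding shift using i by (simp add: right_diff_distrib)
  finally show ?thesis by (simp add: d_def)
qed

section \<open>Decay of the iterates of the walk\<close>

lemma powr_two_abs [simp]: "\<bar>z\<bar> powr 2 = z\<^sup>2" for z :: real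
  by (cases "z = 0") (auto simp: powr_numeral)

lemma telescope_square:
  fixes a :: "nat \<Rightarrow> real"
  shows "(a n - a 0)\<^sup>2 \<le> real n * (\<Sum>i<n. (a (Suc i) - a i)\<^sup>2)"
proof -
  have "(a n - a 0)\<^sup>2 = (\<Sum>i<n. 1 * (a (Suc i) - a i))\<^sup>2" by (simp add: sum_lessThan_telescope)
  also have "\<dots> \<le> (\<Sum>i<n. 1\<^sup>2) * (\<Sum>i<n. (a (Suc i) - a i)\<^sup>2)" by (rule Cauchy_Schwarz_ineq_sum)
  finally show ?thesis by simp
qed

text \<open>A telescope of \<open>j\<close> steps of length \<open>v\<close>, all with the same
  norm: Cauchy-Schwarz costs one factor \<open>j\<close>, the sum the other.\<close>

lemma translate_multiple_diff:
  fixes F :: "'a::euclidean_space \<Rightarrow> real"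
  assumes F: "F \<in> lp 2"
  shows "(LBINT x. (F (x + real j *\<^sub>R v) - F x)\<^sup>2) \<le> (real j)\<^sup>2 * (LBINT x. (F (x + v) - F x)\<^sup>2)"
proof -
  note [measurable] = lp_measurable[OF F]
  have d: "integrable lborel (\<lambda>x. (F (x + a) - F (x + b))\<^sup>2)" for a b
    using lp_diff[of 2, OF _ lp_translate(1)[OF F, of a] lp_translate(1)[OF F, of b]] by (simp add: lp_def)
  have shift: "(LBINT x. (F (x + real (Suc i) *\<^sub>R v) - F (x + real i *\<^sub>R v))\<^sup>2) = (LBINT x. (F (x + v) - F x)\<^sup>2)" for i
    using lborel_integral_translate[of "\<lambda>x. (F (x + v) - F x)\<^sup>2" "real i *\<^sub>R v"]
    by (simp add: algebra_simps)
  have "(LBINT x. (F (x + real j *\<^sub>R v) - F x)\<^sup>2)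
     \<le> (LBINT x. real j * (\<Sum>i<j. (F (x + real (Suc i) *\<^sub>R v) - F (x + real i *\<^sub>R v))\<^sup>2))"
  proof (rule integral_mono)
    show "integrable lborel (\<lambda>x. (F (x + real j *\<^sub>R v) - F x)\<^sup>2)" using d[of _ 0] by simp
    show "(F (x + real j *\<^sub>R v) - F x)\<^sup>2 \<le> real j * (\<Sum>i<j. (F (x + real (Suc i) *\<^sub>R v) - F (x + real i *\<^sub>R v))\<^sup>2)" for x
      using telescope_square[of "\<lambda>i. F (x + real i *\<^sub>R v)" j] by simp
  qed (intro integrable_mult_right Bochner_Integration.integrable_sum d)
  also have "\<dots> = real j * (\<Sum>i<j. (LBINT x. (F (x + real (Suc i) *\<^sub>R v) - F (x + real i *\<^sub>R v))\<^sup>2))"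
    using d by (simp del: of_nat_Suc)
  also have "\<dots> = (real j)\<^sup>2 * (LBINT x. (F (x + v) - F x)\<^sup>2)"
    unfolding shift by (simp add: power2_eq_square)
  finally show ?thesis .
qed

text \<open>If \<open>F\<close> is almost invariant under translation by \<open>v\<close>, then its mass on a ball is repeated on the
  disjoint translates by multiples of \<open>v\<close>, so it is a small part of the total mass.\<close>

lemma local_mass_bound:
  fixes F :: "'a::euclidean_space \<Rightarrow> real"
  assumes F: "F \<in> lp 2" and v: "norm v > 2 * R" "R \<ge> 0" and J: "J > 0"
  shows "(LBINT x. indicator (cball 0 R) x * (F x)\<^sup>2)
     \<le> 2 / real J * (LBINT x. (F x)\<^sup>2) + 2 * (real J)\<^sup>2 * (LBINT x. (F (x + v) - F x)\<^sup>2)"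
proof -
  note [measurable] = lp_measurable[OF F]
  have F2: "integrable lborel (\<lambda>x. (F x)\<^sup>2)" using F by (simp add: lp_def)
  define D where "D = (LBINT x. (F (x + v) - F x)\<^sup>2)"
  have d: "integrable lborel (\<lambda>x. (F (x + a) - F (x + b))\<^sup>2)" for a b
    using lp_diff[of 2, OF _ lp_translate(1)[OF F, of a] lp_translate(1)[OF F, of b]] by (simp add: lp_def)
  have D0: "D \<ge> 0" by (simp add: D_def)
  note Dj = translate_multiple_diff[OF F, of _ v, folded D_def]
  define I where "I x = (indicator (cball 0 R) x :: real)" for x :: 'a
  have [measurable]: "I \<in> borel_measurable borel" unfolding I_def by (intro borel_measurable_indicator) auto
  have I01: "0 \<le> I x" "I x \<le> 1" for x by (auto simp: I_def indicator_def)
  have iI: "integrable lborel (\<lambda>x. I x * (F (x + a))\<^sup>2)" for a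
  proof (rule Bochner_Integration.integrable_bound)
    show "integrable lborel (\<lambda>x. (F (x + a))\<^sup>2)" using lborel_integrable_translate[OF F2] by simp
    show "AE x in lborel. norm (I x * (F (x + a))\<^sup>2) \<le> norm ((F (x + a))\<^sup>2)"
      using I01 by (intro AE_I2) (simp add: abs_mult mult_left_le_one_le)
  qed measurable
  have iI0: "integrable lborel (\<lambda>x. I x * (F x)\<^sup>2)" using iI[of 0] by simp
  have iI': "integrable lborel (\<lambda>x. I (x - a) * (F x)\<^sup>2)" for a
    using lborel_integrable_translate[OF iI[of a], of "-a"] by simp
  \<comment> \<open>On the ball, F(x)^2 is compared with the square at x + j v, up to the
    translation error. That square integrates to the mass on the j-th translate of the ball.\<close>
  have step: "(LBINT x. I x * (F x)\<^sup>2) \<le> 2 * (LBINT x. I (x - real j *\<^sub>R v) * (F x)\<^sup>2) + 2 * (real J)\<^sup>2 * D" if "j < J" for j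
  proof -
    let ?a = "real j *\<^sub>R v"
    have "(LBINT x. I x * (F x)\<^sup>2) \<le> (LBINT x. 2 * (I x * (F (x + ?a))\<^sup>2) + 2 * (F (x + ?a) - F x)\<^sup>2)"
    proof (rule integral_mono[OF iI0])
      show "integrable lborel (\<lambda>x. 2 * (I x * (F (x + ?a))\<^sup>2) + 2 * (F (x + ?a) - F x)\<^sup>2)"
        using iI d[of ?a 0] by simp
      fix x
      have "(F x)\<^sup>2 \<le> 2 * (F (x + ?a))\<^sup>2 + 2 * (F (x + ?a) - F x)\<^sup>2"
      proof -
        have "0 \<le> (2 * F (x + ?a) - F x)\<^sup>2" by simp
        then show ?thesis by (simp add: power2_eq_square algebra_simps)
      qed
      then have "I x * (F x)\<^sup>2 \<le> I x * (2 * (F (x + ?a))\<^sup>2 + 2 * (F (x + ?a) - F x)\<^sup>2)"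
        using I01 by (intro mult_left_mono)
      also have "\<dots> = 2 * (I x * (F (x + ?a))\<^sup>2) + I x * (2 * (F (x + ?a) - F x)\<^sup>2)"
        by (simp add: algebra_simps)
      also have "I x * (2 * (F (x + ?a) - F x)\<^sup>2) \<le> 1 * (2 * (F (x + ?a) - F x)\<^sup>2)"
        using I01 by (intro mult_right_mono) auto
      finally show "I x * (F x)\<^sup>2 \<le> 2 * (I x * (F (x + ?a))\<^sup>2) + 2 * (F (x + ?a) - F x)\<^sup>2" by simp
    qed
    also have "\<dots> = 2 * (LBINT x. I x * (F (x + ?a))\<^sup>2) + 2 * (LBINT x. (F (x + ?a) - F x)\<^sup>2)"
      using iI d[of ?a 0] by simp
    also have "(LBINT x. I x * (F (x + ?a))\<^sup>2) = (LBINT x. I (x - ?a) * (F x)\<^sup>2)"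
      using lborel_integral_translate[of "\<lambda>x. I (x - ?a) * (F x)\<^sup>2" ?a] by simp
    also have "(LBINT x. (F (x + ?a) - F x)\<^sup>2) \<le> (real J)\<^sup>2 * D"
    proof -
      have "(real j)\<^sup>2 * D \<le> (real J)\<^sup>2 * D" using that D0 by (intro mult_right_mono power_mono) auto
      then show ?thesis using Dj[of j] by linarith
    qed
    finally show ?thesis by simp
  qed
  have "(\<Sum>j<J. (LBINT x. I x * (F x)\<^sup>2)) \<le> (\<Sum>j<J. 2 * (LBINT x. I (x - real j *\<^sub>R v) * (F x)\<^sup>2) + 2 * (real J)\<^sup>2 * D)"
    using step by (intro sum_mono) auto
  then have "real J * (LBINT x. I x * (F x)\<^sup>2) \<le> 2 * (\<Sum>j<J. (LBINT x. I (x - real j *\<^sub>R v) * (F x)\<^sup>2)) + real J * (2 * (real J)\<^sup>2 * D)"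
    by (simp add: sum.distrib sum_distrib_left)
  also have "(\<Sum>j<J. (LBINT x. I (x - real j *\<^sub>R v) * (F x)\<^sup>2)) = (LBINT x. (\<Sum>j<J. I (x - real j *\<^sub>R v)) * (F x)\<^sup>2)"
    using iI' by (simp add: sum_distrib_right)
  also have "\<dots> \<le> (LBINT x. (F x)\<^sup>2)"
  proof (rule integral_mono[OF _ F2])
    show "integrable lborel (\<lambda>x. (\<Sum>j<J. I (x - real j *\<^sub>R v)) * (F x)\<^sup>2)"
      using iI' by (simp add: sum_distrib_right)
    fix x
    \<comment> \<open>Since |v| > 2 R, the translates of the ball are disjoint, and \<open>x\<close>
      lies in at most one of them.\<close>
    have "(\<Sum>j<J. I (x - real j *\<^sub>R v)) \<le> 1"
    proof (cases "\<exists>i<J. x - real i *\<^sub>R v \<in> cball 0 R")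
      case True
      then obtain i where i: "i < J" "norm (x - real i *\<^sub>R v) \<le> R" by auto
      have "I (x - real j *\<^sub>R v) = 0" if "j \<noteq> i" for j
      proof (rule ccontr)
        assume "I (x - real j *\<^sub>R v) \<noteq> 0"
        then have "norm (x - real j *\<^sub>R v) \<le> R" by (auto simp: I_def indicator_def split: if_splits)
        then have "norm ((x - real j *\<^sub>R v) - (x - real i *\<^sub>R v)) \<le> 2 * R"
          using i norm_triangle_ineq4[of "x - real j *\<^sub>R v" "x - real i *\<^sub>R v"] by linarith
        moreover have "(x - real j *\<^sub>R v) - (x - real i *\<^sub>R v) = (real i - real j) *\<^sub>R v"
          by (simp add: algebra_simps)
        moreover have "1 * norm v \<le> \<bar>real i - real j\<bar> * norm v"
          using that by (intro mult_right_mono) (auto simp: abs_if)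
        ultimately show False using v by simp
      qed
      then have "(\<Sum>j<J. I (x - real j *\<^sub>R v)) = (\<Sum>j\<in>{i}. I (x - real j *\<^sub>R v))"
        using i by (intro sum.mono_neutral_right) auto
      then show ?thesis using I01 by simp
    next
      case False
      then have "I (x - real j *\<^sub>R v) = 0" if "j < J" for j using that by (auto simp: I_def indicator_def)
      then show ?thesis by simp
    qed
    then have "(\<Sum>j<J. I (x - real j *\<^sub>R v)) * (F x)\<^sup>2 \<le> 1 * (F x)\<^sup>2" by (intro mult_right_mono) auto
    then show "(\<Sum>j<J. I (x - real j *\<^sub>R v)) * (F x)\<^sup>2 \<le> (F x)\<^sup>2" by simp
  qed
  finally have "real J * (LBINT x. I x * (F x)\<^sup>2) \<le> real J * (2 / real J * (LBINT x. (F x)\<^sup>2) + 2 * (real J)\<^sup>2 * D)"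
    using J by (simp add: distrib_left)
  then show ?thesis using J by (simp add: I_def D_def)
qed

text \<open>With g = f and p = q = 2, \<open>walk_gain_sum\<close> makes the squared differences of
  the iterates summable, so the iterates become invariant under \<open>w k\<close> in the limit. A
  multiple \<open>v\<close> of \<open>w k\<close> longer than the diameter of the ball enters
  \<open>local_mass_bound\<close>; \<open>J\<close> is chosen first, to make the share of the total
  mass small, and then \<open>m\<close>.\<close>

lemma walk_decay_local:
  fixes w :: "'k::finite \<Rightarrow> 'a::euclidean_space"
  assumes f: "f \<in> lp 2" and w: "w k \<noteq> 0" and R: "R \<ge> 0"
  shows "(\<lambda>m. LBINT x. indicator (cball 0 R) x * ((walk w ^^ m) f x)\<^sup>2) \<longlonglongrightarrow> 0"
proof -
  define F where "F m = (walk w ^^ m) f" for m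
  have F: "F m \<in> lp 2" for m unfolding F_def by (rule lp_iter_walk) (use f in auto)
  have F_le: "(LBINT x. (F m x)\<^sup>2) \<le> (LBINT x. (f x)\<^sup>2)" for m
    using lp_iter_walk(2)[of 2 f m w] f by (simp add: F_def)
  define D where "D m = (LBINT x. (F m (x + w k) - F m x)\<^sup>2)" for m
  obtain B C where "C > 0" and B: "bellman 2 2 C B" using bellman_exists[of 2 2] by auto
  have "summable D"
  proof (rule summableI_nonneg_bounded)
    show "D m \<ge> 0" for m by (simp add: D_def)
    show "sum D {..<L} \<le> 32 * real CARD('k) * C * ((LBINT x. \<bar>f x\<bar> powr 2) + (LBINT x. \<bar>f x\<bar> powr 2))" for L
      using walk_gain_sum[OF B _ _ _ f f, of w k k L] by (simp add: D_def F_def abs_mult_self_eq power2_eq_square)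
  qed
  then have D_lim: "D \<longlonglongrightarrow> 0" by (rule summable_LIMSEQ_zero)
  obtain n0 :: nat where n0: "real n0 * norm (w k) > 2 * R" using ex_less_of_nat_mult[of "norm (w k)" "2 * R"] w by auto
  define v where "v = real n0 *\<^sub>R w k"
  have v: "norm v > 2 * R" using n0 by (simp add: v_def)
  have Dv: "(LBINT x. (F m (x + v) - F m x)\<^sup>2) \<le> (real n0)\<^sup>2 * D m" for m
    unfolding v_def D_def by (rule translate_multiple_diff[OF F])
  define A where "A = (LBINT x. (f x)\<^sup>2)"
  have A: "A \<ge> 0" by (simp add: A_def)
  have bound: "(LBINT x. indicator (cball 0 R) x * (F m x)\<^sup>2) \<le> 2 / real J * A + 2 * (real J)\<^sup>2 * (real n0)\<^sup>2 * D m" if "J > 0" for J m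
  proof -
    have "2 / real J * (LBINT x. (F m x)\<^sup>2) \<le> 2 / real J * A"
      using F_le unfolding A_def by (intro mult_left_mono) auto
    moreover have "2 * (real J)\<^sup>2 * (LBINT x. (F m (x + v) - F m x)\<^sup>2) \<le> 2 * (real J)\<^sup>2 * ((real n0)\<^sup>2 * D m)"
      using Dv by (intro mult_left_mono) auto
    ultimately show ?thesis using local_mass_bound[OF F v R that, of m] by (simp add: mult.assoc)
  qed
  show ?thesis
  proof (rule LIMSEQ_I)
    fix e :: real assume e: "e > 0"
    obtain J :: nat where J: "J > 0" "2 * A / real J < e / 2"
    proof -
      obtain J :: nat where "real J > 4 * A / e" using reals_Archimedean2 by blast
      then have "2 * A / real (Suc J) < e / 2" using e A by (simp add: field_simps)
      then show ?thesis using that[of "Suc J"] by simp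
    qed
    have "(\<lambda>m. 2 * (real J)\<^sup>2 * (real n0)\<^sup>2 * D m) \<longlonglongrightarrow> 2 * (real J)\<^sup>2 * (real n0)\<^sup>2 * 0"
      by (intro tendsto_intros D_lim)
    then have "eventually (\<lambda>m. 2 * (real J)\<^sup>2 * (real n0)\<^sup>2 * D m < e / 2) sequentially"
      using e by (intro order_tendstoD) auto
    then obtain m0 where m0: "\<And>m. m \<ge> m0 \<Longrightarrow> 2 * (real J)\<^sup>2 * (real n0)\<^sup>2 * D m < e / 2"
      by (auto simp: eventually_sequentially)
    show "\<exists>m0. \<forall>m\<ge>m0. norm ((LBINT x. indicator (cball 0 R) x * ((walk w ^^ m) f x)\<^sup>2) - 0) < e"
    proof (intro exI allI impI)
      fix m assume "m \<ge> m0"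
      then have "(LBINT x. indicator (cball 0 R) x * (F m x)\<^sup>2) < e"
        using bound[OF J(1), of m] m0[of m] J(2) by simp
      moreover have "(LBINT x. indicator (cball 0 R) x * (F m x)\<^sup>2) \<ge> 0" by simp
      ultimately show "norm ((LBINT x. indicator (cball 0 R) x * ((walk w ^^ m) f x)\<^sup>2) - 0) < e"
        by (simp add: F_def)
    qed
  qed
qed

lemma integrable_tail_small:
  fixes h :: "'a::euclidean_space \<Rightarrow> real"
  assumes h: "integrable lborel h" and "0 < e"
  shows "\<exists>R\<ge>0. (LBINT x. (1 - indicator (cball 0 R) x) * \<bar>h x\<bar>) < e"
proof -
  have "(\<lambda>n. LBINT x. (1 - indicator (cball 0 (real n)) x) * \<bar>h x\<bar>) \<longlonglongrightarrow> (\<integral>x. 0 \<partial>(lborel :: 'a measure))"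
  proof (rule integral_dominated_convergence[where w = "\<lambda>x. \<bar>h x\<bar>"])
    show "AE x in lborel. (\<lambda>n. (1 - indicator (cball 0 (real n)) x) * \<bar>h x\<bar>) \<longlonglongrightarrow> 0"
    proof (intro AE_I2)
      fix x :: 'a
      obtain n0 where "norm x < real n0" using reals_Archimedean2 by blast
      then have "eventually (\<lambda>n. (1 - indicator (cball 0 (real n)) x) * \<bar>h x\<bar> = 0) sequentially"
        by (intro eventually_sequentiallyI[of n0]) (auto simp: indicator_def)
      then show "(\<lambda>n. (1 - indicator (cball 0 (real n)) x) * \<bar>h x\<bar>) \<longlonglongrightarrow> 0"
        by (rule tendsto_eventually)
    qed
    show "AE x in lborel. norm ((1 - indicator (cball 0 (real n)) x) * \<bar>h x\<bar>) \<le> \<bar>h x\<bar>" for n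
      by (intro AE_I2) (auto simp: indicator_def)
    have [measurable]: "h \<in> borel_measurable borel" using h by auto
    show "(\<lambda>x. (1 - indicator (cball 0 (real n)) x) * \<bar>h x\<bar>) \<in> borel_measurable lborel" for n
      by (intro borel_measurable_times borel_measurable_diff borel_measurable_indicator) auto
  qed (use h in auto)
  then have "eventually (\<lambda>n. (LBINT x. (1 - indicator (cball 0 (real n)) x) * \<bar>h x\<bar>) < e) sequentially"
    using assms(2) by (intro order_tendstoD) auto
  then obtain n where "(LBINT x. (1 - indicator (cball 0 (real n)) x) * \<bar>h x\<bar>) < e"
    by (auto simp: eventually_sequentially)
  then show ?thesis by (intro exI[of _ "real n"]) auto
qed

text \<open>Decay is known only for squares on balls. On a large ball the product is split into
  (1/c) F^2 and c g^2, where the bound \<open>K\<close> for \<open>g\<close> enters. Outside,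
  Young's inequality leaves a small multiple of |F|^p, whose integral never grows along the walk,
  and the tail of |g|^q.\<close>

lemma walk_decay:
  fixes w :: "'k::finite \<Rightarrow> 'a::euclidean_space"
  assumes pq: "1 < p" "1 < q" "1 / p + 1 / q = 1"
    and f2: "f \<in> lp 2" and f: "f \<in> lp p" and g: "g \<in> lp q" and gK: "\<And>x. \<bar>g x\<bar> \<le> K" and w: "w k \<noteq> 0"
  shows "(\<lambda>m. LBINT x. (walk w ^^ m) f x * g x) \<longlonglongrightarrow> 0"
proof (rule LIMSEQ_I)
  fix e :: real assume e: "e > 0"
  note [measurable] = lp_measurable[OF g]
  define A where "A = (LBINT x. \<bar>f x\<bar> powr p)"
  have A: "A \<ge> 0" by (simp add: A_def)
  \<comment> \<open>The order of the choices is \<open>\<eta>\<close>, then \<open>R\<close> for the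
    tail of \<open>g\<close>, then \<open>c\<close> for the volume \<open>V\<close> of the ball, and
    \<open>m0\<close> last. The errors are \<open>\<eta> * A\<close>, the tail with its factor
    \<open>C\<close>, and the part on the ball, each below e/3.\<close>
  define \<eta> where "\<eta> = e / (4 * (A + 1))"
  have \<eta>: "\<eta> > 0" "\<eta> * A < e / 3"
  proof -
    have "A * e \<ge> 0" using A e by simp
    then have "0 < A * e + e * 4" using e by linarith
    then show "\<eta> > 0" "\<eta> * A < e / 3" using e A by (auto simp: \<eta>_def field_simps add_pos_nonneg)
  qed
  obtain C where C: "C > 0" "\<And>a b. 0 \<le> a \<Longrightarrow> 0 \<le> b \<Longrightarrow> a * b \<le> \<eta> * a powr p + C * b powr q"
    using Young_eps[OF pq(1,3) \<eta>(1)] by blast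
  obtain R where R: "R \<ge> 0" "(LBINT x. (1 - indicator (cball 0 R) x) * \<bar>\<bar>g x\<bar> powr q\<bar>) < e / (3 * C)"
    using integrable_tail_small[OF lp_integrable[OF g], of "e / (3 * C)"] e C by auto
  define I where "I x = (indicator (cball 0 R) x :: real)" for x :: 'a
  have Im [measurable]: "I \<in> borel_measurable borel" unfolding I_def by (intro borel_measurable_indicator) auto
  have I01: "0 \<le> I x" "I x \<le> 1" for x by (auto simp: I_def indicator_def)
  have I_int: "integrable lborel I"
    unfolding I_def using emeasure_compact_finite[OF compact_cball, of "0::'a" R]
    by (intro integrable_real_indicator) auto
  define V where "V = (LBINT x. I x)"
  have V: "V \<ge> 0" unfolding V_def using I01 by simp
  define c where "c = (e / 6) / (K\<^sup>2 * V + 1)"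
  have c: "c > 0" "c * (K\<^sup>2 * V) < e / 3"
  proof -
    have "K\<^sup>2 * V \<ge> 0" using V by simp
    moreover from this have "e * (K\<^sup>2 * V) \<ge> 0" using e by simp
    ultimately show "c > 0" "c * (K\<^sup>2 * V) < e / 3" using e by (auto simp: c_def field_simps add_pos_nonneg)
  qed
  define F where "F m = (walk w ^^ m) f" for m
  have F: "F m \<in> lp p" and F2: "F m \<in> lp 2" for m
    using lp_iter_walk(1)[OF pq(1) f] lp_iter_walk(1)[of 2 f] f2 by (auto simp: F_def)
  note [measurable] = lp_measurable[OF F]
  have F_le: "(LBINT x. \<bar>F m x\<bar> powr p) \<le> A" for m
    using lp_iter_walk(2)[OF pq(1) f] by (simp add: F_def A_def)
  have lim: "(\<lambda>m. (1 / c) * (LBINT x. I x * (F m x)\<^sup>2)) \<longlonglongrightarrow> (1 / c) * 0"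
    unfolding F_def I_def by (intro tendsto_intros walk_decay_local[where k = k and w = w, OF f2 w R(1)])
  have "eventually (\<lambda>m. (1 / c) * (LBINT x. I x * (F m x)\<^sup>2) < e / 3 - c * (K\<^sup>2 * V)) sequentially"
    by (rule order_tendstoD(2)[OF lim]) (use c in simp)
  then obtain m0 where m0: "\<And>m. m \<ge> m0 \<Longrightarrow> (1 / c) * (LBINT x. I x * (F m x)\<^sup>2) < e / 3 - c * (K\<^sup>2 * V)"
    by (auto simp: eventually_sequentially)
  have bound: "\<bar>LBINT x. F m x * g x\<bar> \<le> (1 / c) * (LBINT x. I x * (F m x)\<^sup>2) + c * K\<^sup>2 * V + \<eta> * A
      + C * (LBINT x. (1 - I x) * \<bar>g x\<bar> powr q)" for m
  proof -
    have F2i: "integrable lborel (\<lambda>x. (F m x)\<^sup>2)" using F2 by (simp add: lp_def)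
    have i1: "integrable lborel (\<lambda>x. I x * (F m x)\<^sup>2)"
      by (rule Bochner_Integration.integrable_bound[OF F2i]) (use I01 in \<open>auto simp: abs_mult mult_left_le_one_le\<close>)
    have i2: "integrable lborel (\<lambda>x. \<bar>F m x\<bar> powr p)" using F by (simp add: lp_def)
    have gi: "integrable lborel (\<lambda>x. \<bar>g x\<bar> powr q)" using g by (simp add: lp_def)
    have i3: "integrable lborel (\<lambda>x. (1 - I x) * \<bar>g x\<bar> powr q)"
      by (rule Bochner_Integration.integrable_bound[OF gi]) (use I01 in \<open>auto simp: abs_mult mult_left_le_one_le\<close>)
    have "\<bar>LBINT x. F m x * g x\<bar> \<le> (LBINT x. \<bar>F m x * g x\<bar>)"
      by (rule integral_abs_bound)
    also have "\<dots> \<le> (LBINT x. (1 / c) * (I x * (F m x)\<^sup>2) + c * K\<^sup>2 * I x + \<eta> * \<bar>F m x\<bar> powr p + C * ((1 - I x) * \<bar>g x\<bar> powr q))"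
    proof (rule integral_mono)
      show "integrable lborel (\<lambda>x. \<bar>F m x * g x\<bar>)" using lp_mult_integrable[OF pq F g] by (rule integrable_abs)
      show "integrable lborel (\<lambda>x. (1 / c) * (I x * (F m x)\<^sup>2) + c * K\<^sup>2 * I x + \<eta> * \<bar>F m x\<bar> powr p + C * ((1 - I x) * \<bar>g x\<bar> powr q))"
        by (intro Bochner_Integration.integrable_add integrable_mult_right i1 i2 i3 I_int)
      fix x
      show "\<bar>F m x * g x\<bar> \<le> (1 / c) * (I x * (F m x)\<^sup>2) + c * K\<^sup>2 * I x + \<eta> * \<bar>F m x\<bar> powr p + C * ((1 - I x) * \<bar>g x\<bar> powr q)"
      proof (cases "x \<in> cball 0 R")
        case True
        then have Ix: "I x = 1" by (simp add: I_def)
        have "2 * (\<bar>F m x\<bar> / sqrt c) * (sqrt c * \<bar>g x\<bar>) \<le> (\<bar>F m x\<bar> / sqrt c)\<^sup>2 + (sqrt c * \<bar>g x\<bar>)\<^sup>2"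
          by (rule sum_squares_bound)
        moreover have "2 * (\<bar>F m x\<bar> / sqrt c) * (sqrt c * \<bar>g x\<bar>) = 2 * \<bar>F m x * g x\<bar>" using c by (simp add: abs_mult)
        moreover have "(\<bar>F m x\<bar> / sqrt c)\<^sup>2 = (1 / c) * (F m x)\<^sup>2" "(sqrt c * \<bar>g x\<bar>)\<^sup>2 = c * (g x)\<^sup>2"
          using c by (auto simp: power_divide power_mult_distrib)
        moreover have "c * (g x)\<^sup>2 \<le> c * K\<^sup>2" using c gK[of x] by (intro mult_left_mono) (auto intro: abs_le_square_iff[THEN iffD1] order_trans[OF _ abs_ge_self])
        moreover have "\<eta> * \<bar>F m x\<bar> powr p \<ge> 0" using \<eta> by simp
        moreover have "\<bar>F m x * g x\<bar> \<ge> 0" by simp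
        ultimately show ?thesis unfolding Ix by simp
      next
        case False
        then have Ix: "I x = 0" by (simp add: I_def)
        show ?thesis using C(2)[of "\<bar>F m x\<bar>" "\<bar>g x\<bar>"] unfolding Ix by (simp add: abs_mult)
      qed
    qed
    also have "\<dots> = (1 / c) * (LBINT x. I x * (F m x)\<^sup>2) + c * K\<^sup>2 * V + \<eta> * (LBINT x. \<bar>F m x\<bar> powr p)
      + C * (LBINT x. (1 - I x) * \<bar>g x\<bar> powr q)"
      using i1 i2 i3 I_int by (simp add: V_def)
    also have "\<eta> * (LBINT x. \<bar>F m x\<bar> powr p) \<le> \<eta> * A" using F_le \<eta> by (intro mult_left_mono) auto
    finally show ?thesis by simp
  qed
  have "C * (LBINT x. (1 - I x) * \<bar>g x\<bar> powr q) < e / 3"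
    using R(2) C by (simp add: I_def field_simps)
  then have "\<bar>LBINT x. F m x * g x\<bar> < e" if "m \<ge> m0" for m
    using bound[of m] m0[OF that] \<eta> by (simp add: mult.assoc)
  then show "\<exists>m0. \<forall>m\<ge>m0. norm ((LBINT x. (walk w ^^ m) f x * g x) - 0) < e"
    unfolding F_def by (intro exI[of _ m0]) auto
qed

section \<open>Korn's inequality for finite differences\<close>

lemma lp_bounded_mono:
  assumes "f \<in> lp p" "p \<le> r" "\<And>x. \<bar>f x\<bar> \<le> M"
  shows "f \<in> lp r"
proof -
  note [measurable] = lp_measurable[OF assms(1)]
  have "integrable lborel (\<lambda>x. \<bar>f x\<bar> powr r)"
  proof (rule Bochner_Integration.integrable_bound)
    show "integrable lborel (\<lambda>x. M powr (r - p) * \<bar>f x\<bar> powr p)" using assms(1) by (simp add: lp_def)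
    have "\<bar>f x\<bar> powr r \<le> M powr (r - p) * \<bar>f x\<bar> powr p" for x
    proof -
      have "\<bar>f x\<bar> powr r = \<bar>f x\<bar> powr (r - p) * \<bar>f x\<bar> powr p" by (simp flip: powr_add)
      also have "\<dots> \<le> M powr (r - p) * \<bar>f x\<bar> powr p"
        using assms by (intro mult_right_mono powr_mono2) auto
      finally show ?thesis .
    qed
    then show "AE x in lborel. norm (\<bar>f x\<bar> powr r) \<le> norm (M powr (r - p) * \<bar>f x\<bar> powr p)" by simp
  qed measurable
  then show ?thesis using assms(1) by (simp add: lp_def)
qed

lemma iter_walk_add: "(walk w ^^ m) (\<lambda>y. f y + g y) = (\<lambda>x. (walk w ^^ m) f x + (walk w ^^ m) g x)"
  by (induction m) (auto simp: ext[OF walk_add])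

lemma iter_walk_cmult: "(walk w ^^ m) (\<lambda>y. c * f y) = (\<lambda>x. c * (walk w ^^ m) f x)"
  by (induction m) (auto simp: ext[OF walk_cmult])

lemma iter_walk_diff_relation:
  assumes "\<And>x. f (x + a) - f x = (e1 (x + a) - e1 x) + (e2 (x + b) - e2 x) - (e3 (x + c) - e3 x)"
  shows "(walk w ^^ m) f (x + a) - (walk w ^^ m) f x = ((walk w ^^ m) e1 (x + a) - (walk w ^^ m) e1 x)
    + ((walk w ^^ m) e2 (x + b) - (walk w ^^ m) e2 x) - ((walk w ^^ m) e3 (x + c) - (walk w ^^ m) e3 x)"
proof (induction m arbitrary: x)
  case (Suc m)
  have d: "walk w h (x + a) - walk w h x = walk w (\<lambda>y. h (y + a) - h y) x" for h a x
    by (simp add: walk_translate walk_diff)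
  show ?case by (simp add: d Suc.IH) (simp add: walk_add walk_diff)
qed (use assms in simp)

text \<open>\<open>K\<close> depends on \<open>p\<close>, \<open>q\<close> and the number of
  directions, but not on the steps \<open>w\<close>, which is what lets the step tend to 0 later.
  The bounds on \<open>G\<close> make the field or its dual square integrable, as the decay of the
  iterates demands; their size does not enter \<open>K\<close>.\<close>

lemma discrete_korn:
  fixes p q :: real
  assumes pq: "1 < p" "1 < q" "1 / p + 1 / q = 1"
  shows "\<exists>K>0. \<forall>(w :: 'n::finite \<Rightarrow> 'a::euclidean_space) (G :: 'n \<Rightarrow> 'n \<Rightarrow> 'a \<Rightarrow> real).
    (\<forall>k. w k \<noteq> 0) \<longrightarrow> (\<forall>i j. G i j \<in> lp p) \<longrightarrow> (\<forall>i j. \<exists>M. \<forall>x. \<bar>G i j x\<bar> \<le> M) \<longrightarrow>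
    (\<forall>i j k x. G i j (x + w k) - G i j x = G i k (x + w j) - G i k x) \<longrightarrow>
    (\<forall>i j. (LBINT x. \<bar>G i j x\<bar> powr p)
       \<le> K * (\<Sum>a\<in>UNIV. \<Sum>b\<in>UNIV. LBINT x. \<bar>(G a b x + G b a x) / 2\<bar> powr p))"
proof -
  obtain B C where C: "C > 0" and B: "bellman p q C B" using bellman_exists[OF pq] by blast
  define N where "N = real CARD('n)"
  have N: "N > 0" by (simp add: N_def)
  \<comment> \<open>\<open>c1\<close> is 3/4 of the constant 32 N C of \<open>walk_gain_sum\<close>:
    one step of the telescope has three terms in each of N directions, divided by 4 N.
    \<open>Q\<close> relates the dual side to \<open>T\<close>, by convexity bounds for
    \<open>g = g' + walk w g'\<close>.\<close>
  define c1 where "c1 = 24 * N * C"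
  define Q where "Q = 2 * 2 powr q"
  have c1Q: "c1 > 0" "Q > 0" using C N by (auto simp: c1_def Q_def)
  \<comment> \<open>Replacing \<open>E\<close> by \<open>\<kappa>\<close> times \<open>E\<close> and
    \<open>g\<close> by \<open>g\<close> over \<open>\<kappa>\<close> keeps their products but
    shifts weight between the p-part and the q-part. With this value the q-part becomes T / 2 and is
    absorbed on the left.\<close>
  define \<kappa> where "\<kappa> = (2 * c1 * Q) powr (1 / q)"
  have \<kappa>: "\<kappa> > 0" using c1Q by (simp add: \<kappa>_def)
  have \<kappa>q: "c1 * ((1 / \<kappa>) powr q * Q) = 1 / 2"
    using c1Q pq by (simp add: \<kappa>_def powr_divide powr_powr)
  define K where "K = 2 * c1 * \<kappa> powr p"
  have "K > 0" using c1Q \<kappa> by (simp add: K_def)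
  have main: "(LBINT x. \<bar>G i j x\<bar> powr p) \<le> K * (\<Sum>a\<in>UNIV. \<Sum>b\<in>UNIV. LBINT x. \<bar>(G a b x + G b a x) / 2\<bar> powr p)"
    if w: "\<And>k. w k \<noteq> 0" and G: "\<And>i j. G i j \<in> lp p" and Gb: "\<And>i j. \<exists>M. \<forall>x. \<bar>G i j x\<bar> \<le> M"
      and curl: "\<And>i j k x. G i j (x + w k) - G i j x = G i k (x + w j) - G i k x"
    for w :: "'n \<Rightarrow> 'a" and G :: "'n \<Rightarrow> 'n \<Rightarrow> 'a \<Rightarrow> real" and i j
  proof -
    note [measurable] = lp_measurable[OF G]
    define W where "W m = walk w ^^ m" for m
    define E where "E a b x = (G a b x + G b a x) / 2" for a b x
    define S where "S = (\<Sum>a\<in>UNIV. \<Sum>b\<in>UNIV. LBINT x. \<bar>E a b x\<bar> powr p)"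
    define T where "T = (LBINT x. \<bar>G i j x\<bar> powr p)"
    have E: "E a b \<in> lp p" for a b
      using lp_cmult[OF lp_add[OF pq(1) G G], of "1/2" a b b a] unfolding E_def[abs_def] by simp
    have E_le: "(LBINT x. \<bar>E a b x\<bar> powr p) \<le> S" for a b
    proof -
      have "(LBINT x. \<bar>E a b x\<bar> powr p) \<le> (\<Sum>b\<in>UNIV. LBINT x. \<bar>E a b x\<bar> powr p)"
        by (rule member_le_sum) auto
      also have "\<dots> \<le> S" unfolding S_def by (rule member_le_sum) (auto intro: sum_nonneg)
      finally show ?thesis .
    qed
    obtain M where M: "\<And>x. \<bar>G i j x\<bar> \<le> M" using Gb by blast
    define g' where "g' x = sgn (G i j x) * \<bar>G i j x\<bar> powr (p - 1)" for x
    have [measurable]: "g' \<in> borel_measurable borel" unfolding g'_def[abs_def] by measurable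
    have "p \<noteq> 0" "q \<noteq> 0" using pq by auto
    then have "p + q = p * q" using pq(3) by (simp add: field_simps)
    then have pq1: "(p - 1) * q = p" by (simp add: algebra_simps)
    have abs_g': "\<bar>g' x\<bar> = \<bar>G i j x\<bar> powr (p - 1)" for x
      by (cases "G i j x = 0") (auto simp: g'_def abs_mult)
    have g'q: "\<bar>g' x\<bar> powr q = \<bar>G i j x\<bar> powr p" for x
      by (simp add: abs_g' powr_powr pq1)
    have Gg': "G i j x * g' x = \<bar>G i j x\<bar> powr p" for x
    proof (cases "G i j x = 0")
      case False
      have "G i j x * g' x = \<bar>G i j x\<bar> * \<bar>G i j x\<bar> powr (p - 1)" by (simp add: g'_def sgn_if)
      then show ?thesis using False powr_add[of "\<bar>G i j x\<bar>" 1 "p - 1"] by simp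
    qed simp
    have g': "g' \<in> lp q" using G[of i j] by (simp add: lp_def g'q)
    have g'M: "\<bar>g' x\<bar> \<le> M powr (p - 1)" for x
      unfolding abs_g' using M pq by (intro powr_mono2) auto
    define g where "g x = g' x + walk w g' x" for x
    have g: "g \<in> lp q" unfolding g_def[abs_def] using g' lp_walk(1)[OF pq(2) g'] by (intro lp_add pq)
    have g_le: "(LBINT x. \<bar>g x\<bar> powr q) \<le> Q * T"
    proof -
      have "(LBINT x. \<bar>g x\<bar> powr q) \<le> (LBINT x. 2 powr q * (\<bar>g' x\<bar> powr q + \<bar>walk w g' x\<bar> powr q))"
        using g g' lp_walk(1)[OF pq(2) g', of w] powr_add_le[OF pq(2)]
        by (intro integral_mono) (auto simp: lp_def g_def)
      also have "\<dots> = 2 powr q * ((LBINT x. \<bar>g' x\<bar> powr q) + (LBINT x. \<bar>walk w g' x\<bar> powr q))"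
        using g' lp_walk(1)[OF pq(2) g', of w] by (simp add: lp_def)
      also have "\<dots> \<le> 2 powr q * ((LBINT x. \<bar>g' x\<bar> powr q) + (LBINT x. \<bar>g' x\<bar> powr q))"
        using lp_walk(2)[OF pq(2) g', of w] by (intro mult_left_mono add_left_mono) auto
      finally show ?thesis by (simp add: g'q T_def Q_def)
    qed
    have WG: "W l f \<in> lp p" if "f \<in> lp p" for l f using lp_iter_walk(1)[OF pq(1) that] by (simp add: W_def)
    have Wg: "W l f \<in> lp q" if "f \<in> lp q" for l f using lp_iter_walk(1)[OF pq(2) that] by (simp add: W_def)
    note I = lp_mult_integrable[OF pq]
    define P where "P a b c k l = (LBINT x. \<bar>W l (E a b) (x + w c) - W l (E a b) x\<bar> * \<bar>W l g (x + w k) - W l g x\<bar>)" for a b c k l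
    define Z where "Z = 32 * N * C * (\<kappa> powr p * S + (1 / \<kappa>) powr q * (Q * T))"
    have P_sum: "(\<Sum>l<L. P a b c k l) \<le> Z" for a b c k L
    proof -
      have eq: "P a b c k l = (LBINT x. \<bar>(walk w ^^ l) (\<lambda>y. \<kappa> * E a b y) (x + w c) - (walk w ^^ l) (\<lambda>y. \<kappa> * E a b y) x\<bar>
           * \<bar>(walk w ^^ l) (\<lambda>y. 1 / \<kappa> * g y) (x + w k) - (walk w ^^ l) (\<lambda>y. 1 / \<kappa> * g y) x\<bar>)" for l
      proof -
        have "\<bar>\<kappa> * u - \<kappa> * v\<bar> * \<bar>1 / \<kappa> * r - 1 / \<kappa> * s\<bar> = \<bar>u - v\<bar> * \<bar>r - s\<bar>" for u v r s :: real
        proof -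
          have "\<kappa> * u - \<kappa> * v = \<kappa> * (u - v)" "1 / \<kappa> * r - 1 / \<kappa> * s = (r - s) / \<kappa>"
            by (simp_all add: right_diff_distrib diff_divide_distrib)
          then show ?thesis using \<kappa> by (simp add: abs_mult)
        qed
        then show ?thesis unfolding P_def W_def iter_walk_cmult by simp
      qed
      have "(\<Sum>l<L. P a b c k l) \<le> 32 * N * C * ((LBINT x. \<bar>\<kappa> * E a b x\<bar> powr p) + (LBINT x. \<bar>1 / \<kappa> * g x\<bar> powr q))"
        unfolding eq N_def by (rule walk_gain_sum[OF B pq]) (intro lp_cmult E g)+
      also have "(LBINT x. \<bar>\<kappa> * E a b x\<bar> powr p) = \<kappa> powr p * (LBINT x. \<bar>E a b x\<bar> powr p)"
        using \<kappa> by (simp add: abs_mult powr_mult)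
      also have "(LBINT x. \<bar>1 / \<kappa> * g x\<bar> powr q) = (1 / \<kappa>) powr q * (LBINT x. \<bar>g x\<bar> powr q)"
      proof -
        have "\<bar>1 / \<kappa> * g x\<bar> powr q = (1 / \<kappa>) powr q * \<bar>g x\<bar> powr q" for x
          using \<kappa> by (simp only: abs_mult powr_mult) simp
        then show ?thesis by simp
      qed
      also have "32 * N * C * (\<kappa> powr p * (LBINT x. \<bar>E a b x\<bar> powr p) + (1 / \<kappa>) powr q * (LBINT x. \<bar>g x\<bar> powr q)) \<le> Z"
        unfolding Z_def using N C g_le E_le by (intro mult_left_mono add_mono) auto
      finally show ?thesis .
    qed
    \<comment> \<open>In the half sums that make up \<open>E\<close>, the first instance of
      \<open>curl\<close> identifies the difference of \<open>G i k\<close> along \<open>w j\<close>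
      with that of \<open>G i j\<close> along \<open>w k\<close>; the other two cancel the remaining
      terms. The relation passes to the iterates because the walk commutes with
      translations.\<close>
    have dG: "W l (G i j) (x + w k) - W l (G i j) x = (W l (E i j) (x + w k) - W l (E i j) x)
       + (W l (E i k) (x + w j) - W l (E i k) x) - (W l (E j k) (x + w i) - W l (E j k) x)" for l k x
      unfolding W_def
    proof (rule iter_walk_diff_relation)
      fix x
      show "G i j (x + w k) - G i j x = (E i j (x + w k) - E i j x) + (E i k (x + w j) - E i k x) - (E j k (x + w i) - E j k x)"
        using curl[of i j x k] curl[of j i x k] curl[of k i x j]
        by (simp add: E_def field_simps)
    qed
    \<comment> \<open>With u = M^l G and h = M^l g', self-adjointness rewrites the left side as the
      pairing of u - M u with h + M h, and the latter is M^l g. Both factors carry \<open>l\<close>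
      steps, as in \<open>P\<close>.\<close>
    have step: "(LBINT x. W (2 * l) (G i j) x * g' x) - (LBINT x. W (2 * Suc l) (G i j) x * g' x)
        \<le> (\<Sum>k\<in>UNIV. P i j k k l + P i k j k l + P j k i k l) / (4 * N)" for l
    proof -
      define u h where "u = W l (G i j)" and "h = W l g'"
      have u: "u \<in> lp p" and h: "h \<in> lp q" using WG Wg G g' by (auto simp: u_def h_def)
      have wu: "walk w u \<in> lp p" "walk w (walk w u) \<in> lp p" and wh: "walk w h \<in> lp q"
        using lp_walk(1) u h pq by blast+
      have "W (2 * l) (G i j) = W l u" by (simp add: W_def u_def mult_2 funpow_add)
      then have 1: "(LBINT x. W (2 * l) (G i j) x * g' x) = (LBINT x. u x * h x)"
        using iter_walk_selfadjoint[OF pq u g', of l w] by (simp add: W_def h_def)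
      have "W (2 * Suc l) (G i j) = W l (walk w (walk w u))"
        by (simp add: W_def u_def mult_2 funpow_add funpow_swap1)
      then have 2: "(LBINT x. W (2 * Suc l) (G i j) x * g' x) = (LBINT x. walk w (walk w u) x * h x)"
        using iter_walk_selfadjoint[OF pq wu(2) g', of l w] by (simp add: W_def h_def)
      have gl: "W l g = (\<lambda>x. h x + walk w h x)"
        unfolding W_def g_def[abs_def] iter_walk_add by (simp add: h_def W_def funpow_swap1)
      have "(LBINT x. (u x - walk w u x) * W l g x) = (LBINT x. u x * h x + u x * walk w h x - walk w u x * h x - walk w u x * walk w h x)"
        unfolding gl by (simp add: algebra_simps)
      also have "\<dots> = (LBINT x. u x * h x) + (LBINT x. u x * walk w h x) - (LBINT x. walk w u x * h x) - (LBINT x. walk w u x * walk w h x)"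
        using I[OF u h] I[OF u wh] I[OF wu(1) h] I[OF wu(1) wh] by simp
      also have "\<dots> = (LBINT x. u x * h x) - (LBINT x. walk w (walk w u) x * h x)"
        using walk_selfadjoint[OF pq u h, of w] walk_selfadjoint[OF pq wu(1) h, of w] by simp
      finally have "(LBINT x. W (2 * l) (G i j) x * g' x) - (LBINT x. W (2 * Suc l) (G i j) x * g' x)
         = (LBINT x. (u x - walk w u x) * W l g x)" using 1 2 by simp
      also have "\<dots> = (\<Sum>k\<in>UNIV. LBINT x. (u (x + w k) - u x) * (W l g (x + w k) - W l g x)) / (4 * N)"
        using walk_by_parts[OF pq u Wg[OF g], of w] by (simp add: N_def)
      also have "\<dots> \<le> (\<Sum>k\<in>UNIV. P i j k k l + P i k j k l + P j k i k l) / (4 * N)"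
      proof (intro divide_right_mono sum_mono)
        fix k
        have d: "(\<lambda>x. \<bar>W l (E a b) (x + w c) - W l (E a b) x\<bar>) \<in> lp p" for a b c
          by (intro lp_abs lp_diff lp_translate WG E pq)
        have e: "(\<lambda>x. \<bar>W l g (x + w k) - W l g x\<bar>) \<in> lp q"
          by (intro lp_abs lp_diff lp_translate Wg g pq)
        have "(LBINT x. (u (x + w k) - u x) * (W l g (x + w k) - W l g x))
          \<le> (LBINT x. \<bar>W l (E i j) (x + w k) - W l (E i j) x\<bar> * \<bar>W l g (x + w k) - W l g x\<bar>
             + \<bar>W l (E i k) (x + w j) - W l (E i k) x\<bar> * \<bar>W l g (x + w k) - W l g x\<bar>
             + \<bar>W l (E j k) (x + w i) - W l (E j k) x\<bar> * \<bar>W l g (x + w k) - W l g x\<bar>)"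
        proof (rule integral_mono)
          show "integrable lborel (\<lambda>x. (u (x + w k) - u x) * (W l g (x + w k) - W l g x))"
            by (intro I lp_diff lp_translate u Wg g pq)
          show "integrable lborel (\<lambda>x. \<bar>W l (E i j) (x + w k) - W l (E i j) x\<bar> * \<bar>W l g (x + w k) - W l g x\<bar>
             + \<bar>W l (E i k) (x + w j) - W l (E i k) x\<bar> * \<bar>W l g (x + w k) - W l g x\<bar>
             + \<bar>W l (E j k) (x + w i) - W l (E j k) x\<bar> * \<bar>W l g (x + w k) - W l g x\<bar>)"
            by (intro Bochner_Integration.integrable_add I d e)
          fix x
          have "(a + b - c) * y \<le> \<bar>a\<bar> * \<bar>y\<bar> + \<bar>b\<bar> * \<bar>y\<bar> + \<bar>c\<bar> * \<bar>y\<bar>" for a b c y :: real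
          proof -
            have "(a + b - c) * y \<le> \<bar>a + b - c\<bar> * \<bar>y\<bar>" by (metis abs_ge_self abs_mult)
            also have "\<dots> \<le> (\<bar>a\<bar> + \<bar>b\<bar> + \<bar>c\<bar>) * \<bar>y\<bar>" by (intro mult_right_mono) auto
            finally show ?thesis by (simp add: distrib_right)
          qed
          then show "(u (x + w k) - u x) * (W l g (x + w k) - W l g x) \<le> \<bar>W l (E i j) (x + w k) - W l (E i j) x\<bar> * \<bar>W l g (x + w k) - W l g x\<bar>
             + \<bar>W l (E i k) (x + w j) - W l (E i k) x\<bar> * \<bar>W l g (x + w k) - W l g x\<bar>
             + \<bar>W l (E j k) (x + w i) - W l (E j k) x\<bar> * \<bar>W l g (x + w k) - W l g x\<bar>"
            unfolding u_def dG .
        qed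
        also have "\<dots> = P i j k k l + P i k j k l + P j k i k l"
          using I[OF d e] by (simp add: P_def)
        finally show "(LBINT x. (u (x + w k) - u x) * (W l g (x + w k) - W l g x)) \<le> P i j k k l + P i k j k l + P j k i k l" .
      qed (use N in auto)
      finally show ?thesis .
    qed
    have bound: "T - (LBINT x. W (2 * L) (G i j) x * g' x) \<le> 3 * Z / 4" for L
    proof -
      have "T - (LBINT x. W (2 * L) (G i j) x * g' x)
        = (\<Sum>l<L. (LBINT x. W (2 * l) (G i j) x * g' x) - (LBINT x. W (2 * Suc l) (G i j) x * g' x))"
        using sum_lessThan_telescope'[of "\<lambda>l. LBINT x. W (2 * l) (G i j) x * g' x" L]
        by (simp add: T_def W_def Gg')
      also have "\<dots> \<le> (\<Sum>l<L. (\<Sum>k\<in>UNIV. P i j k k l + P i k j k l + P j k i k l) / (4 * N))"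
        by (intro sum_mono step)
      also have "\<dots> = (\<Sum>k\<in>UNIV. (\<Sum>l<L. P i j k k l) + (\<Sum>l<L. P i k j k l) + (\<Sum>l<L. P j k i k l)) / (4 * N)"
        unfolding sum_divide_distrib[symmetric] by (subst sum.swap) (simp add: sum.distrib)
      also have "\<dots> \<le> (\<Sum>k\<in>(UNIV :: 'n set). Z + Z + Z) / (4 * N)"
        using N by (intro divide_right_mono sum_mono add_mono P_sum) auto
      also have "\<dots> = 3 * Z / 4" using N by (simp add: N_def)
      finally show ?thesis .
    qed
    \<comment> \<open>\<open>walk_decay\<close> iterates a square integrable function. A bounded
      function in L^p with p <= 2 is one; for p > 2 the dual \<open>g'\<close> is bounded and in L^q
      with q < 2, and the iterates are moved onto it.\<close>
    have lim: "(\<lambda>m. LBINT x. W m (G i j) x * g' x) \<longlonglongrightarrow> 0"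
    proof (cases "p \<le> 2")
      case True
      have "G i j \<in> lp 2" using lp_bounded_mono[OF G True M] .
      then show ?thesis unfolding W_def by (rule walk_decay[where k = i and w = w, OF pq _ G g' g'M w])
    next
      case False
      have "q \<le> 2"
      proof (rule ccontr)
        assume "\<not> q \<le> 2"
        then have "1 / p < 1 / 2" "1 / q < 1 / 2" using False by (auto simp: field_simps)
        then show False using pq by linarith
      qed
      then have g2: "g' \<in> lp 2" using lp_bounded_mono[OF g' _ g'M] by blast
      have "(LBINT x. W m (G i j) x * g' x) = (LBINT x. W m g' x * G i j x)" for m
        using iter_walk_selfadjoint[OF pq G g', of m w] by (simp add: W_def mult.commute)
      moreover have "(\<lambda>m. LBINT x. W m g' x * G i j x) \<longlonglongrightarrow> 0"
        unfolding W_def by (rule walk_decay[where k = i and w = w, OF pq(2,1) _ g2 g' G M w]) (use pq in simp)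
      ultimately show ?thesis by simp
    qed
    have "(\<lambda>L. LBINT x. W (2 * L) (G i j) x * g' x) \<longlonglongrightarrow> 0"
      using LIMSEQ_subseq_LIMSEQ[OF lim, of "\<lambda>L. 2 * L"] by (simp add: strict_mono_def o_def)
    then have "(\<lambda>L. T - (LBINT x. W (2 * L) (G i j) x * g' x)) \<longlonglongrightarrow> T - 0" by (intro tendsto_intros)
    then have "T - 0 \<le> 3 * Z / 4" by (rule LIMSEQ_le_const2) (use bound in auto)
    also have "3 * Z / 4 = c1 * \<kappa> powr p * S + c1 * ((1 / \<kappa>) powr q * Q) * T"
      by (simp add: Z_def c1_def algebra_simps)
    also have "c1 * ((1 / \<kappa>) powr q * Q) * T = T / 2" unfolding \<kappa>q by simp
    finally have "T \<le> K * S" by (simp add: K_def)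
    then show ?thesis by (simp add: T_def S_def E_def)
  qed
  then show ?thesis using \<open>K > 0\<close> by blast
qed

section \<open>Radial kernels and curl free fields\<close>

lemma nn_integral_translate:
  fixes f :: "'a::euclidean_space \<Rightarrow> ennreal"
  assumes "f \<in> borel_measurable borel"
  shows "(\<integral>\<^sup>+x. f (x + c) \<partial>lborel) = (\<integral>\<^sup>+x. f x \<partial>lborel)"
proof -
  have "(\<integral>\<^sup>+x. f x \<partial>lborel) = (\<integral>\<^sup>+x. f x \<partial>distr lborel borel ((+) c))" by (simp add: lborel_distr_plus)
  also have "\<dots> = (\<integral>\<^sup>+x. f (x + c) \<partial>lborel)" using assms by (subst nn_integral_distr) (auto simp: add.commute)
  finally show ?thesis by simp
qed

text \<open>The argument for the uniqueness of Haar measure. For the unit ball \<open>U\<close>, the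
  integral of 1_A(R x) 1_U(y - R x) over \<open>y\<close> first gives |U| times the measure of the
  preimage of \<open>A\<close>. After a translation in \<open>x\<close> the other order gives |A|
  times the measure of {x. - R x in U}, which is \<open>U\<close> itself. Finally |U|, positive and
  finite, is cancelled.\<close>

lemma lborel_distr_isometry:
  fixes R :: "'a::euclidean_space \<Rightarrow> 'a"
  assumes lin: "linear R" and iso: "\<And>x. norm (R x) = norm x"
  shows "distr lborel borel R = lborel"
proof -
  have cont: "continuous_on UNIV R" using lin by (rule linear_continuous_on[OF linear_conv_bounded_linear[THEN iffD1]])
  then have [measurable]: "R \<in> borel_measurable borel" by (rule borel_measurable_continuous_onI)
  have "inj R" unfolding linear_injective_0[OF lin] using iso by (metis norm_eq_zero)
  then have "surj R" using linear_injective_imp_surjective[OF lin] by blast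
  then obtain R' where R': "\<And>y. R (R' y) = y" by (metis surjD)
  define U where "U = cball (0::'a) 1"
  have [measurable]: "U \<in> sets borel" by (simp add: U_def)
  define u where "u = emeasure lborel U"
  have u: "u \<noteq> 0" "u \<noteq> \<infinity>"
  proof -
    have "measure lborel U > 0" unfolding U_def by (rule content_cball_pos) simp
    then show "u \<noteq> 0" by (auto simp: u_def measure_def)
    show "u \<noteq> \<infinity>" using emeasure_compact_finite[of U] by (auto simp: u_def U_def)
  qed
  have "emeasure (distr lborel borel R) A = emeasure lborel A" if [measurable]: "A \<in> sets borel" for A
  proof -
    have uA: "u * (\<integral>\<^sup>+x. indicator A (R x) \<partial>lborel) = (\<integral>\<^sup>+x. (\<integral>\<^sup>+y. indicator A (R x) * indicator U (y - R x) \<partial>lborel) \<partial>lborel)"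
    proof -
      have "(\<integral>\<^sup>+y. indicator A (R x) * indicator U (y - R x) \<partial>lborel) = indicator A (R x) * u" for x
        using nn_integral_translate[of "indicator U" "- R x"] by (simp add: nn_integral_cmult u_def)
      moreover have "(\<lambda>x. indicator A (R x) :: ennreal) \<in> borel_measurable lborel" by measurable
      ultimately show ?thesis by (simp add: nn_integral_cmult mult.commute[of _ u])
    qed
    also have "\<dots> = (\<integral>\<^sup>+y. (\<integral>\<^sup>+x. indicator A (R x) * indicator U (y - R x) \<partial>lborel) \<partial>lborel)"
      by (rule lborel_pair.Fubini'[symmetric]) measurable
    \<comment> \<open>For fixed \<open>y\<close>, \<open>x\<close> is translated by a preimage of
      \<open>y\<close> under \<open>R\<close>, so that \<open>R x\<close> becomes
      \<open>R x + y\<close>.\<close>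
    also have "\<dots> = (\<integral>\<^sup>+y. (\<integral>\<^sup>+x. indicator A (R x + y) * indicator U (- R x) \<partial>lborel) \<partial>lborel)"
    proof (rule nn_integral_cong)
      fix y
      show "(\<integral>\<^sup>+x. indicator A (R x) * indicator U (y - R x) \<partial>lborel) = (\<integral>\<^sup>+x. indicator A (R x + y) * (indicator U (- R x) :: ennreal) \<partial>lborel)"
        using nn_integral_translate[of "\<lambda>x. indicator A (R x) * indicator U (y - R x)" "R' y"]
        by (simp add: linear_add[OF lin] R')
    qed
    also have "\<dots> = (\<integral>\<^sup>+x. (\<integral>\<^sup>+y. indicator A (R x + y) * indicator U (- R x) \<partial>lborel) \<partial>lborel)"
      by (rule lborel_pair.Fubini') measurable
    also have "\<dots> = (\<integral>\<^sup>+x. emeasure lborel A * indicator U x \<partial>lborel)"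
    proof (rule nn_integral_cong)
      fix x
      have "indicator U (- R x) = (indicator U x :: ennreal)" by (simp add: U_def indicator_def iso)
      then show "(\<integral>\<^sup>+y. indicator A (R x + y) * indicator U (- R x) \<partial>lborel) = emeasure lborel A * (indicator U x :: ennreal)"
        using nn_integral_translate[of "indicator A" "R x"] by (simp add: nn_integral_multc add.commute)
    qed
    also have "\<dots> = u * emeasure lborel A" by (subst nn_integral_cmult) (auto simp: u_def mult.commute)
    finally have "u * (\<integral>\<^sup>+x. indicator A (R x) \<partial>lborel) = u * emeasure lborel A" .
    then have "(\<integral>\<^sup>+x. indicator A (R x) \<partial>lborel) = emeasure lborel A" using u by (simp add: ennreal_mult_cancel_left)
    moreover have "(\<integral>\<^sup>+x. indicator A x \<partial>distr lborel borel R) = (\<integral>\<^sup>+x. indicator A (R x) \<partial>lborel)"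
      by (rule nn_integral_distr) measurable
    ultimately show ?thesis by simp
  qed
  then show ?thesis by (intro measure_eqI) auto
qed

lemma borel_measurable_lebesgue_AE:
  fixes f f' :: "'a::euclidean_space \<Rightarrow> real"
  assumes f': "f' \<in> borel_measurable borel" and ae: "AE x in lborel. f x = f' x"
  shows "f \<in> borel_measurable lebesgue"
proof (rule measurableI)
  fix A :: "real set" assume A: "A \<in> sets borel"
  have "f' -` A \<in> sets lebesgue" using measurable_sets[OF f' A] by simp
  moreover have "AE x in lebesgue. x \<in> f' -` A \<longleftrightarrow> x \<in> f -` A"
    using AE_completion[OF ae] by eventually_elim auto
  ultimately have "f -` A \<in> sets lebesgue"
    using completion.in_sets_AE[where A = "f' -` A" and B = "f -` A"] by auto
  then show "f -` A \<inter> space lebesgue \<in> sets lebesgue" by simp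
qed simp

text \<open>Composition with a Borel map need not preserve Lebesgue measurability. Here
  \<open>f\<close> agrees with a Borel function off a null set, and the preimage of that set is null
  because \<open>T\<close> preserves the measure.\<close>

lemma lebesgue_measure_preserving:
  fixes f :: "'a::euclidean_space \<Rightarrow> real"
  assumes T: "distr lborel borel T = lborel" "T \<in> borel_measurable borel"
    and f: "f \<in> borel_measurable lebesgue"
  shows "(\<lambda>x. f (T x)) \<in> borel_measurable lebesgue"
    and "(\<integral>x. f (T x) \<partial>lebesgue) = (\<integral>x. f x \<partial>lebesgue)"
proof -
  note [measurable] = T(2)
  obtain f' where [measurable]: "f' \<in> borel_measurable lborel" and ae: "AE x in lborel. f x = f' x"
    using completion_ex_borel_measurable_real[OF f] by blast
  have "AE x in distr lborel borel T. f x = f' x" using ae unfolding T(1) .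
  then have aeT: "AE x in lborel. f (T x) = f' (T x)" by (rule AE_distrD[rotated]) simp
  have fT': "(\<lambda>x. f' (T x)) \<in> borel_measurable borel" by measurable
  show fT: "(\<lambda>x. f (T x)) \<in> borel_measurable lebesgue"
    by (rule borel_measurable_lebesgue_AE[OF fT' aeT])
  have "(\<integral>x. f (T x) \<partial>lebesgue) = (\<integral>x. f' (T x) \<partial>lebesgue)"
    using fT AE_completion[OF aeT] measurable_completion[of "\<lambda>x. f' (T x)" lborel borel] by (intro integral_cong_AE) auto
  also have "\<dots> = (LBINT x. f' (T x))" by (rule integral_completion) measurable
  also have "\<dots> = (\<integral>x. f' x \<partial>distr lborel borel T)" by (subst integral_distr) auto
  also have "\<dots> = (LBINT x. f' x)" unfolding T(1) ..
  also have "\<dots> = (\<integral>x. f' x \<partial>lebesgue)" by (rule integral_completion[symmetric]) measurable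
  also have "\<dots> = (\<integral>x. f x \<partial>lebesgue)"
    using f AE_completion[OF ae] measurable_completion[of f' lborel borel] by (intro integral_cong_AE) auto
  finally show "(\<integral>x. f (T x) \<partial>lebesgue) = (\<integral>x. f x \<partial>lebesgue)" .
qed

lemma lborel_distr_reflect:
  fixes x :: "'a::euclidean_space"
  shows "distr lborel borel (\<lambda>y. x - y) = lborel"
proof -
  have "distr lborel borel (\<lambda>y. x - y) = distr (distr lborel borel uminus) borel ((+) x)"
    by (subst distr_distr) (auto simp: o_def)
  also have "distr lborel borel uminus = (lborel :: 'a measure)"
    by (rule lborel_distr_isometry) (auto simp: linear_iff)
  finally show ?thesis by (simp add: lborel_distr_plus)
qed

section \<open>Derivatives and bounds of test functions\<close>

lemma test_function_has_derivative:
  assumes "test_function f"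
  shows "(f has_derivative frechet_derivative f (at x)) (at x)"
proof -
  have "Ck 1 f" using assms by (auto simp: test_function_def)
  then show ?thesis by (simp add: frechet_derivative_works)
qed

lemma test_function_deriv:
  assumes f: "test_function f"
  shows "test_function (\<lambda>x. frechet_derivative f (at x) v)"
proof -
  have "Ck k (\<lambda>x. frechet_derivative f (at x) v)" for k
    using f by (auto simp: test_function_def dest: spec[of _ "Suc k"])
  moreover have "{x. frechet_derivative f (at x) v \<noteq> 0} \<subseteq> closure {x. f x \<noteq> 0}"
  proof
    fix x assume x: "x \<in> {x. frechet_derivative f (at x) v \<noteq> 0}"
    show "x \<in> closure {x. f x \<noteq> 0}"
    proof (rule ccontr)
      assume nx: "x \<notin> closure {x. f x \<noteq> 0}"
      have "((\<lambda>y. 0) has_derivative (\<lambda>v. 0)) (at x)" by simp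
      then have "(f has_derivative (\<lambda>v. 0)) (at x)"
      proof (rule has_derivative_transform_within_open)
        show "open (- closure {x. f x \<noteq> 0})" by auto
        show "0 = f y" if "y \<in> - closure {x. f x \<noteq> 0}" for y
          using that closure_subset[of "{x. f x \<noteq> 0}"] by auto
      qed (use nx in auto)
      then have e: "frechet_derivative f (at x) = (\<lambda>v. 0)" by (rule frechet_derivative_at[symmetric])
      show False using x by (simp add: e)
    qed
  qed
  then have sub: "closure {x. frechet_derivative f (at x) v \<noteq> 0} \<subseteq> closure {x. f x \<noteq> 0}"
    by (rule closure_minimal) simp
  have "compact (closure {x. f x \<noteq> 0} \<inter> closure {x. frechet_derivative f (at x) v \<noteq> 0})"
    using f by (intro compact_Int_closed) (auto simp: test_function_def)
  then have "compact (closure {x. frechet_derivative f (at x) v \<noteq> 0})"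
    using sub by (simp add: inf.absorb2)
  ultimately show ?thesis by (simp add: test_function_def)
qed

lemma test_function_continuous: "test_function f \<Longrightarrow> continuous_on UNIV f"
  by (auto simp: test_function_def dest: spec[of _ 0])

lemma test_function_bounded:
  assumes f: "test_function f"
  shows "\<exists>M\<ge>0. \<forall>x. norm (f x) \<le> M"
proof -
  have "compact (f ` closure {x. f x \<noteq> 0})"
    using f by (intro compact_continuous_image continuous_on_subset[OF test_function_continuous]) (auto simp: test_function_def)
  then have "bounded (f ` closure {x. f x \<noteq> 0})" by (rule compact_imp_bounded)
  then obtain M where M: "\<And>x. x \<in> closure {x. f x \<noteq> 0} \<Longrightarrow> norm (f x) \<le> M"
    unfolding bounded_iff by blast
  have "norm (f x) \<le> max M 0" for x
  proof (cases "f x = 0")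
    case False
    then have "x \<in> closure {x. f x \<noteq> 0}"
      by (intro subsetD[OF closure_subset]) simp
    then show ?thesis by (rule max.coboundedI1[OF M])
  qed simp
  then show ?thesis by (intro exI[of _ "max M 0"]) auto
qed

lemma test_function_lipschitz:
  fixes f :: "'a::euclidean_space \<Rightarrow> 'b::euclidean_space"
  assumes f: "test_function f"
  shows "\<exists>L\<ge>0. \<forall>x y. norm (f x - f y) \<le> L * norm (x - y)"
proof -
  have "\<forall>b. \<exists>M\<ge>0. \<forall>x. norm (frechet_derivative f (at x) b) \<le> M"
    using test_function_bounded[OF test_function_deriv[OF f]] by blast
  then obtain M where M: "\<And>b. M b \<ge> 0" "\<And>b x. norm (frechet_derivative f (at x) b) \<le> M b" by metis
  define L where "L = (\<Sum>b\<in>Basis. M b)"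
  have "norm (f x - f y) \<le> L * norm (x - y)" for x y
  proof (rule differentiable_bound[where S = UNIV])
    fix z :: 'a
    show d: "(f has_derivative frechet_derivative f (at z)) (at z within UNIV)"
      using test_function_has_derivative[OF f] by simp
    show "onorm (frechet_derivative f (at z)) \<le> L"
    proof (rule onorm_le)
      fix v :: 'a
      interpret bounded_linear "frechet_derivative f (at z)" using d by (rule has_derivative_bounded_linear)
      have "frechet_derivative f (at z) v = frechet_derivative f (at z) (\<Sum>b\<in>Basis. (v \<bullet> b) *\<^sub>R b)"
        by (simp add: euclidean_representation)
      also have "\<dots> = (\<Sum>b\<in>Basis. (v \<bullet> b) *\<^sub>R frechet_derivative f (at z) b)" by (simp add: sum scaleR)
      also have "norm \<dots> \<le> (\<Sum>b\<in>Basis. norm v * M b)"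
        by (rule order_trans[OF norm_sum sum_mono]) (auto intro!: mult_mono M simp: Basis_le_norm)
      also have "\<dots> = L * norm v" by (simp add: L_def sum_distrib_left mult.commute)
      finally show "norm (frechet_derivative f (at z) v) \<le> L * norm v" .
    qed
  qed auto
  moreover have "L \<ge> 0" unfolding L_def using M by (intro sum_nonneg) auto
  ultimately show ?thesis by blast
qed

section \<open>Rotations in the plane of two axes, and radial averages\<close>

definition rot :: "'n::finite \<Rightarrow> 'n \<Rightarrow> real \<Rightarrow> real ^ 'n \<Rightarrow> real ^ 'n" where
  "rot j k t z = z + ((cos t - 1) * z $ j - sin t * z $ k) *\<^sub>R axis j 1
                   + (sin t * z $ j + (cos t - 1) * z $ k) *\<^sub>R axis k 1"

lemma linear_rot: "linear (rot j k t)"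
  by (rule linearI) (simp_all add: rot_def algebra_simps)

lemma norm_rot:
  assumes "j \<noteq> k"
  shows "norm (rot j k t z) = norm z"
proof -
  define a b where "a = (cos t - 1) * z $ j - sin t * z $ k" and "b = sin t * z $ j + (cos t - 1) * z $ k"
  have "(x + (a *\<^sub>R v + b *\<^sub>R w)) \<bullet> (x + (a *\<^sub>R v + b *\<^sub>R w))
      = x \<bullet> x + (2 * a * (x \<bullet> v) + 2 * b * (x \<bullet> w) + a\<^sup>2 * (v \<bullet> v) + b\<^sup>2 * (w \<bullet> w)) + 2 * a * b * (v \<bullet> w)"
    for x v w :: "real ^ 'a"
    by (simp add: inner_add_left inner_add_right inner_commute[of v x] inner_commute[of w x] inner_commute[of w v]
        power2_eq_square algebra_simps)
  note eq = this[of z "axis j 1" "axis k 1"]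
  have "rot j k t z = z + (a *\<^sub>R axis j 1 + b *\<^sub>R axis k 1)" by (simp add: rot_def a_def b_def)
  moreover have "z \<bullet> axis j 1 = z $ j" "z \<bullet> axis k 1 = z $ k" by (simp_all add: inner_axis)
  moreover have "axis j (1::real) \<bullet> axis j 1 = 1" "axis k (1::real) \<bullet> axis k 1 = 1" "axis j (1::real) \<bullet> axis k 1 = 0"
    using assms by (simp_all add: inner_axis_axis)
  ultimately have "rot j k t z \<bullet> rot j k t z = z \<bullet> z + (2 * a * z $ j + 2 * b * z $ k + a\<^sup>2 + b\<^sup>2)"
    using eq by simp
  moreover have "2 * ((c - 1) * x - s * y) * x + 2 * (s * x + (c - 1) * y) * y + ((c - 1) * x - s * y)\<^sup>2 + (s * x + (c - 1) * y)\<^sup>2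
      = (s\<^sup>2 + c\<^sup>2 - 1) * (x\<^sup>2 + y\<^sup>2)" for s c x y :: real
    by algebra
  then have "2 * a * z $ j + 2 * b * z $ k + a\<^sup>2 + b\<^sup>2 = ((sin t)\<^sup>2 + (cos t)\<^sup>2 - 1) * ((z $ j)\<^sup>2 + (z $ k)\<^sup>2)"
    unfolding a_def b_def .
  then have "2 * a * z $ j + 2 * b * z $ k + a\<^sup>2 + b\<^sup>2 = 0" by simp
  ultimately have "rot j k t z \<bullet> rot j k t z = z \<bullet> z" by simp
  then show ?thesis by (simp add: norm_eq_sqrt_inner)
qed

lemma rot_has_derivative:
  "((\<lambda>t. rot j k t z) has_derivative
     (\<lambda>h. h *\<^sub>R ((- sin t * z $ j - cos t * z $ k) *\<^sub>R axis j 1 + (cos t * z $ j - sin t * z $ k) *\<^sub>R axis k 1))) (at t)"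
  unfolding rot_def by (auto intro!: derivative_eq_intros simp: algebra_simps)

text \<open>The integral of \<open>\<rho> z / (norm z)\<^sup>2 * \<phi> (rot j k t z)\<close> does
  not depend on the angle \<open>t\<close>, because \<open>\<rho>\<close> is radial and rotations
  preserve the measure. The integrand of the claim is the derivative of this integrand at t =
  0.\<close>

lemma radial_rotation_average_zero:
  fixes \<rho> :: "real ^ 'n \<Rightarrow> real" and \<psi> :: "real ^ 'n \<Rightarrow> real"
  assumes rad: "radial \<rho>" and \<rho>: "integrable lebesgue \<rho>" and \<psi>: "test_function \<psi>" and jk: "j \<noteq> k"
  defines "D \<equiv> \<lambda>y l. frechet_derivative \<psi> (at y) (axis l 1)"
  shows "has_bochner_integral lebesgue
    (\<lambda>z. \<rho> z / (norm z)\<^sup>2 * ((D x k - D (x - z) k) * z $ j - (D x j - D (x - z) j) * z $ k)) 0"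
proof -
  have [measurable]: "\<rho> \<in> borel_measurable lebesgue" using \<rho> by auto
  have d\<psi>: "(\<psi> has_derivative frechet_derivative \<psi> (at y)) (at y)" for y
    by (rule test_function_has_derivative[OF \<psi>])
  have "\<forall>v. \<exists>L\<ge>0. \<forall>y y'. norm (frechet_derivative \<psi> (at y) v - frechet_derivative \<psi> (at y') v) \<le> L * norm (y - y')"
    using test_function_lipschitz[OF test_function_deriv[OF \<psi>]] by blast
  then obtain M where M: "\<And>v. M v \<ge> 0" "\<And>v y y'. norm (frechet_derivative \<psi> (at y) v - frechet_derivative \<psi> (at y') v) \<le> M v * norm (y - y')"
    by metis
  \<comment> \<open>The remainder of the first order Taylor expansion replaces
    \<open>\<psi> (x - z)\<close> itself: it is of size |z|^2 and its gradient of size |z|, which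
    makes up for the weight 1/|z|^2, so that integrability of \<open>\<rho>\<close> yields all the
    bounds.\<close>
  define \<phi> where "\<phi> z = \<psi> (x - z) - \<psi> x + frechet_derivative \<psi> (at x) z" for z
  define \<phi>' where "\<phi>' z v = frechet_derivative \<psi> (at x) v - frechet_derivative \<psi> (at (x - z)) v" for z v
  have bl: "bounded_linear (frechet_derivative \<psi> (at y))" for y
    using d\<psi> by (rule has_derivative_bounded_linear)
  have d\<phi>: "(\<phi> has_derivative \<phi>' z) (at z)" for z
  proof -
    have "((\<lambda>z. x - z) has_derivative (\<lambda>v. - v)) (at z)" by (auto intro!: derivative_eq_intros)
    then have "((\<lambda>z. \<psi> (x - z)) has_derivative (\<lambda>v. frechet_derivative \<psi> (at (x - z)) (- v))) (at z)"
      by (rule has_derivative_compose[OF _ d\<psi>])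
    moreover have "(frechet_derivative \<psi> (at x) has_derivative frechet_derivative \<psi> (at x)) (at z)"
      using bl by (rule bounded_linear_imp_has_derivative)
    ultimately have "(\<phi> has_derivative (\<lambda>v. frechet_derivative \<psi> (at (x - z)) (- v) - 0 + frechet_derivative \<psi> (at x) v)) (at z)"
      unfolding \<phi>_def[abs_def] by (intro has_derivative_add has_derivative_diff has_derivative_const)
    moreover have "frechet_derivative \<psi> (at (x - z)) (- v) = - frechet_derivative \<psi> (at (x - z)) v" for v
      using bl[of "x - z"] by (simp add: linear_neg bounded_linear.linear)
    ultimately show ?thesis by (simp add: \<phi>'_def[abs_def])
  qed
  have \<phi>'_le: "\<bar>\<phi>' z v\<bar> \<le> M v * norm z" for z v
    using M(2)[of x v "x - z"] by (simp add: \<phi>'_def)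
  have \<phi>'_lin: "linear (\<phi>' z)" for z using d\<phi> by (rule has_derivative_linear)
  define L where "L = (\<Sum>b\<in>Basis. M b)"
  have L: "L \<ge> 0" unfolding L_def using M by (intro sum_nonneg) auto
  have M_le: "M (axis l 1) \<le> L" for l
    unfolding L_def by (rule member_le_sum) (use M in \<open>auto simp: axis_in_Basis_iff\<close>)
  have \<phi>_le: "\<bar>\<phi> z\<bar> \<le> L * (norm z)\<^sup>2" for z
  proof -
    have "norm (\<phi> z - \<phi> 0) \<le> (L * norm z) * norm (z - 0)"
    proof (rule differentiable_bound[where S = "cball 0 (norm z)"])
      fix y :: "real ^ 'n" assume y: "y \<in> cball 0 (norm z)"
      show "(\<phi> has_derivative \<phi>' y) (at y within cball 0 (norm z))" using d\<phi> by (rule has_derivative_at_withinI)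
      show "onorm (\<phi>' y) \<le> L * norm z"
      proof (rule onorm_le)
        fix v :: "real ^ 'n"
        have "\<phi>' y v = \<phi>' y (\<Sum>b\<in>Basis. (v \<bullet> b) *\<^sub>R b)" by (simp add: euclidean_representation)
        also have "\<dots> = (\<Sum>b\<in>Basis. (v \<bullet> b) * \<phi>' y b)"
          using \<phi>'_lin[of y] by (simp add: linear_sum linear_cmul)
        also have "norm \<dots> \<le> (\<Sum>b\<in>Basis. norm v * (M b * norm z))"
        proof (rule order_trans[OF norm_sum sum_mono])
          fix b :: "real ^ 'n" assume "b \<in> Basis"
          have "\<bar>\<phi>' y b\<bar> \<le> M b * norm z"
            using \<phi>'_le[of y b] mult_left_mono[of "norm y" "norm z" "M b"] y M by simp
          then show "norm ((v \<bullet> b) * \<phi>' y b) \<le> norm v * (M b * norm z)"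
            using \<open>b \<in> Basis\<close> by (auto simp: abs_mult intro!: mult_mono Basis_le_norm)
        qed
        also have "\<dots> = (L * norm z) * norm v"
          by (simp add: L_def sum_distrib_left sum_distrib_right mult.commute mult.left_commute)
        finally show "norm (\<phi>' y v) \<le> (L * norm z) * norm v" .
      qed
    qed auto
    moreover have "\<phi> 0 = 0" using bl[of x] by (simp add: \<phi>_def linear_0 bounded_linear.linear)
    ultimately show ?thesis by (simp add: power2_eq_square mult.assoc)
  qed
  have cont: "continuous_on UNIV \<phi>"
    using d\<phi> has_derivative_continuous continuous_at_imp_continuous_on by blast
  have rot_lin: "linear (rot j k t)" for t by (rule linear_rot)
  have rot_cont: "continuous_on UNIV (rot j k t)" for t
    by (rule linear_continuous_on[OF linear_conv_bounded_linear[THEN iffD1, OF rot_lin]])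
  have rot_borel: "rot j k t \<in> borel_measurable borel" for t
    using rot_cont by (rule borel_measurable_continuous_onI)
  define F where "F t z = \<rho> z / (norm z)\<^sup>2 * \<phi> (rot j k t z)" for t z
  have F_meas [measurable]: "F t \<in> borel_measurable lebesgue" for t
  proof -
    have "(\<lambda>z. \<phi> (rot j k t z)) \<in> borel_measurable borel"
      by (intro borel_measurable_continuous_onI continuous_on_compose2[OF cont rot_cont]) auto
    then have [measurable]: "(\<lambda>z. \<phi> (rot j k t z)) \<in> borel_measurable lebesgue" by (intro measurable_completion) simp
    have [measurable]: "(\<lambda>z::real^'n. (norm z)\<^sup>2) \<in> borel_measurable lebesgue" by (intro measurable_completion) simp
    show ?thesis unfolding F_def[abs_def] by measurable
  qed
  have F_int: "integrable lebesgue (F t)" for t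
  proof (rule Bochner_Integration.integrable_bound)
    show "integrable lebesgue (\<lambda>z. L * \<rho> z)" using \<rho> by simp
    have "\<bar>F t z\<bar> \<le> \<bar>L * \<rho> z\<bar>" for z
    proof (cases "z = 0")
      case False
      have "\<bar>\<phi> (rot j k t z)\<bar> \<le> L * (norm z)\<^sup>2" using \<phi>_le[of "rot j k t z"] norm_rot[OF jk] by simp
      then have "\<bar>\<rho> z\<bar> / (norm z)\<^sup>2 * \<bar>\<phi> (rot j k t z)\<bar> \<le> \<bar>\<rho> z\<bar> / (norm z)\<^sup>2 * (L * (norm z)\<^sup>2)"
        by (intro mult_left_mono) auto
      also have "\<dots> = \<bar>L * \<rho> z\<bar>" using False L by (simp add: abs_mult)
      finally show ?thesis by (simp add: F_def abs_mult)
    qed (simp add: F_def)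
    then show "AE z in lebesgue. norm (F t z) \<le> norm (L * \<rho> z)" by simp
  qed measurable
  have rot0: "rot j k 0 z = z" for z by (simp add: rot_def)
  have F_const: "(\<integral>z. F t z \<partial>lebesgue) = (\<integral>z. F 0 z \<partial>lebesgue)" for t
  proof -
    have "F t z = F 0 (rot j k t z)" for z
    proof (cases "z = 0")
      case True
      then show ?thesis by (simp add: F_def rot_def)
    next
      case False
      then have "rot j k t z \<noteq> 0" using norm_rot[OF jk, of t z] by auto
      then have "\<rho> (rot j k t z) = \<rho> z" using rad False norm_rot[OF jk, of t z] unfolding radial_def by metis
      then show ?thesis by (simp add: F_def rot0 norm_rot[OF jk])
    qed
    then show ?thesis
      using lebesgue_measure_preserving(2)[OF lborel_distr_isometry[OF rot_lin norm_rot[OF jk]] rot_borel F_meas[of 0], of t] by simp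
  qed
  define \<tau> where "\<tau> t z = (- sin t * z $ j - cos t * z $ k) * \<phi>' (rot j k t z) (axis j 1)
     + (cos t * z $ j - sin t * z $ k) * \<phi>' (rot j k t z) (axis k 1)" for t z
  have d\<tau>: "((\<lambda>t. \<phi> (rot j k t z)) has_real_derivative \<tau> t z) (at t)" for t z
  proof -
    have "((\<lambda>t. \<phi> (rot j k t z)) has_derivative (\<lambda>h. \<phi>' (rot j k t z)
       (h *\<^sub>R ((- sin t * z $ j - cos t * z $ k) *\<^sub>R axis j 1 + (cos t * z $ j - sin t * z $ k) *\<^sub>R axis k 1)))) (at t)"
      by (rule has_derivative_compose[OF rot_has_derivative d\<phi>])
    moreover have "\<phi>' (rot j k t z) (h *\<^sub>R (a *\<^sub>R axis j 1 + b *\<^sub>R axis k 1))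
       = (a * \<phi>' (rot j k t z) (axis j 1) + b * \<phi>' (rot j k t z) (axis k 1)) * h" for h a b
      using \<phi>'_lin[of "rot j k t z"] by (simp add: linear_add linear_cmul mult.commute)
    ultimately show ?thesis by (simp add: has_field_derivative_def \<tau>_def mult_commute_abs)
  qed
  have \<tau>_le: "\<bar>\<tau> t z\<bar> \<le> 4 * L * (norm z)\<^sup>2" for t z
  proof -
    have coef: "\<bar>u * z $ l\<bar> \<le> norm z" if "\<bar>u\<bar> \<le> 1" for u l
      using mult_mono[OF that component_le_norm_cart[of z l]] by (simp add: abs_mult)
    have "\<bar>- sin t * z $ j - cos t * z $ k\<bar> \<le> 2 * norm z" "\<bar>cos t * z $ j - sin t * z $ k\<bar> \<le> 2 * norm z"
      using coef[of "sin t" j] coef[of "cos t" k] coef[of "cos t" j] coef[of "sin t" k] by auto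
    moreover have "\<bar>\<phi>' (rot j k t z) (axis l 1)\<bar> \<le> L * norm z" for l
      using \<phi>'_le[of "rot j k t z" "axis l 1"] norm_rot[OF jk, of t z] mult_right_mono[OF M_le[of l], of "norm z"] by simp
    ultimately have "\<bar>- sin t * z $ j - cos t * z $ k\<bar> * \<bar>\<phi>' (rot j k t z) (axis j 1)\<bar> \<le> (2 * norm z) * (L * norm z)"
      "\<bar>cos t * z $ j - sin t * z $ k\<bar> * \<bar>\<phi>' (rot j k t z) (axis k 1)\<bar> \<le> (2 * norm z) * (L * norm z)"
      by (auto intro!: mult_mono)
    moreover have "\<bar>\<tau> t z\<bar> \<le> \<bar>- sin t * z $ j - cos t * z $ k\<bar> * \<bar>\<phi>' (rot j k t z) (axis j 1)\<bar>
       + \<bar>cos t * z $ j - sin t * z $ k\<bar> * \<bar>\<phi>' (rot j k t z) (axis k 1)\<bar>"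
      unfolding \<tau>_def abs_mult[symmetric] by (rule abs_triangle_ineq)
    moreover have "(2 * norm z) * (L * norm z) = 2 * L * (norm z)\<^sup>2" by (simp add: power2_eq_square)
    ultimately show ?thesis by linarith
  qed
  \<comment> \<open>Difference quotients in the angle along 1/(n + 1). Each has integral 0, and by
    the mean value theorem all are dominated by the same multiple of \<open>\<rho>\<close> in
    absolute value, so dominated convergence applies to the derivative.\<close>
  define h where "h n = inverse (real (Suc n))" for n
  have h: "h n > 0" for n by (simp add: h_def)
  define S where "S n z = (F (h n) z - F 0 z) / h n" for n z
  have S_int: "(\<integral>z. S n z \<partial>lebesgue) = 0" for n
    using F_int F_const[of "h n"] by (simp add: S_def)
  have S_eq: "S n z = \<rho> z / (norm z)\<^sup>2 * ((\<phi> (rot j k (h n) z) - \<phi> (rot j k 0 z)) / h n)" for n z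
    by (simp add: S_def F_def right_diff_distrib diff_divide_distrib)
  have S_le: "\<bar>S n z\<bar> \<le> 4 * L * \<bar>\<rho> z\<bar>" for n z
  proof (cases "z = 0")
    case False
    obtain t where "\<phi> (rot j k (h n) z) - \<phi> (rot j k 0 z) = (h n - 0) * \<tau> t z"
      using MVT2[OF h[of n], of "\<lambda>t. \<phi> (rot j k t z)" "\<lambda>t. \<tau> t z"] d\<tau> by blast
    then have "S n z = \<rho> z / (norm z)\<^sup>2 * \<tau> t z" using h[of n] by (simp add: S_eq)
    then have "\<bar>S n z\<bar> = \<bar>\<rho> z\<bar> / (norm z)\<^sup>2 * \<bar>\<tau> t z\<bar>" by (simp add: abs_mult)
    also have "\<dots> \<le> \<bar>\<rho> z\<bar> / (norm z)\<^sup>2 * (4 * L * (norm z)\<^sup>2)" using \<tau>_le by (intro mult_left_mono) auto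
    also have "\<dots> = 4 * L * \<bar>\<rho> z\<bar>" using False by simp
    finally show ?thesis .
  qed (use L in \<open>simp add: S_def F_def\<close>)
  have S_lim: "(\<lambda>n. S n z) \<longlonglongrightarrow> \<rho> z / (norm z)\<^sup>2 * \<tau> 0 z" for z
  proof -
    have "((\<lambda>u. (\<phi> (rot j k (0 + u) z) - \<phi> (rot j k 0 z)) / u) \<longlongrightarrow> \<tau> 0 z) (at 0)"
      using d\<tau>[of z 0] by (simp add: DERIV_def)
    moreover have "filterlim h (at 0) sequentially"
      unfolding filterlim_at h_def[abs_def] using LIMSEQ_inverse_real_of_nat by auto
    ultimately have "(\<lambda>n. (\<phi> (rot j k (0 + h n) z) - \<phi> (rot j k 0 z)) / h n) \<longlonglongrightarrow> \<tau> 0 z"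
      by (rule filterlim_compose)
    then show ?thesis unfolding S_eq by (intro tendsto_mult tendsto_const) simp
  qed
  have T_meas: "(\<lambda>z. \<rho> z / (norm z)\<^sup>2 * \<tau> 0 z) \<in> borel_measurable lebesgue"
    by (rule borel_measurable_LIMSEQ_real[of _ S, OF S_lim]) (simp add: S_def[abs_def])
  have "has_bochner_integral lebesgue (\<lambda>z. \<rho> z / (norm z)\<^sup>2 * \<tau> 0 z) 0"
  proof -
    have i: "integrable lebesgue (\<lambda>z. 4 * L * \<bar>\<rho> z\<bar>)" using \<rho> by simp
    have ae: "AE z in lebesgue. (\<lambda>n. S n z) \<longlonglongrightarrow> \<rho> z / (norm z)\<^sup>2 * \<tau> 0 z" using S_lim by simp
    have le: "\<And>n. AE z in lebesgue. norm (S n z) \<le> 4 * L * \<bar>\<rho> z\<bar>" using S_le by simp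
    have Sm: "S n \<in> borel_measurable lebesgue" for n unfolding S_def[abs_def] by measurable
    have "integrable lebesgue (\<lambda>z. \<rho> z / (norm z)\<^sup>2 * \<tau> 0 z)"
      by (rule integrable_dominated_convergence[OF T_meas Sm i ae le])
    moreover have "(\<lambda>n. \<integral>z. S n z \<partial>lebesgue) \<longlonglongrightarrow> (\<integral>z. \<rho> z / (norm z)\<^sup>2 * \<tau> 0 z \<partial>lebesgue)"
      by (rule integral_dominated_convergence[OF T_meas Sm i ae le])
    then have "(\<integral>z. \<rho> z / (norm z)\<^sup>2 * \<tau> 0 z \<partial>lebesgue) = 0"
      unfolding S_int by (simp add: LIMSEQ_const_iff)
    ultimately show ?thesis by (simp add: has_bochner_integral_iff)
  qed
  moreover have "\<tau> 0 z = (D x k - D (x - z) k) * z $ j - (D x j - D (x - z) j) * z $ k" for z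
    by (simp add: \<tau>_def \<phi>'_def D_def rot0)
  ultimately show ?thesis by simp
qed

text \<open>The field has the single row \<open>i\<close>: the gradient of \<open>\<psi>\<close> in
  the (j, k) plane turned by a right angle. Its increments applied to z = x - y give the angular
  derivative of \<open>radial_rotation_average_zero\<close>.\<close>

lemma nonlocal_div_curl:
  fixes \<rho> :: "real ^ 'n \<Rightarrow> real" and \<psi> :: "real ^ 'n \<Rightarrow> real"
  assumes rad: "radial \<rho>" and \<rho>: "integrable lebesgue \<rho>" and \<psi>: "test_function \<psi>"
  defines "D \<equiv> \<lambda>y l. frechet_derivative \<psi> (at y) (axis l 1)"
  shows "nonlocal_div \<rho> (\<lambda>y. D y k *\<^sub>R axis i (axis j 1) - D y j *\<^sub>R axis i (axis k 1)) x = 0"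
proof (cases "j = k")
  case True
  then show ?thesis by (simp add: nonlocal_div_def)
next
  case False
  define f where "f z = \<rho> z / (norm z)\<^sup>2 * ((D x k - D (x - z) k) * z $ j - (D x j - D (x - z) j) * z $ k)" for z
  have f: "has_bochner_integral lebesgue f 0"
    using radial_rotation_average_zero[OF rad \<rho> \<psi> False, of x] by (simp add: f_def[abs_def] D_def)
  define \<Phi> where "\<Phi> y = D y k *\<^sub>R axis i (axis j (1::real)) - D y j *\<^sub>R axis i (axis k 1)" for y
  have mv: "(a *\<^sub>R axis i (axis j (1::real)) - b *\<^sub>R axis i (axis k 1)) *v z = (a * z $ j - b * z $ k) *\<^sub>R axis i 1" for a b z
  proof -
    have "(axis i (axis m (1::real)) *v z) = z $ m *\<^sub>R axis i 1" for m
      by (simp add: vec_eq_iff matrix_vector_mult_def axis_def if_distrib[where f = "\<lambda>x. x * _"] if_distribR cong: if_cong)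
    then show ?thesis
      by (simp add: matrix_vector_mult_diff_rdistrib scaleR_matrix_vector_assoc[symmetric] algebra_simps)
  qed
  have "\<rho> (x - y) *\<^sub>R (((\<Phi> x - \<Phi> y) /\<^sub>R norm (x - y)) *v ((x - y) /\<^sub>R norm (x - y))) = f (x - y) *\<^sub>R axis i 1" for y
  proof -
    have d: "\<Phi> x - \<Phi> y = (D x k - D y k) *\<^sub>R axis i (axis j (1::real)) - (D x j - D y j) *\<^sub>R axis i (axis k 1)"
      by (simp add: \<Phi>_def algebra_simps)
    have "((\<Phi> x - \<Phi> y) /\<^sub>R norm (x - y)) *v ((x - y) /\<^sub>R norm (x - y))
       = (1 / (norm (x - y))\<^sup>2) *\<^sub>R ((\<Phi> x - \<Phi> y) *v (x - y))"
      by (simp add: scaleR_matrix_vector_assoc[symmetric] matrix_vector_mult_scaleR power2_eq_square divide_inverse)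
    then show ?thesis unfolding d mv by (simp add: f_def)
  qed
  then have "nonlocal_div \<rho> \<Phi> x = (LINT y|lebesgue. f (x - y) *\<^sub>R axis i 1)"
    by (simp add: nonlocal_div_def)
  also have "\<dots> = (LINT y|lebesgue. f (x - y)) *\<^sub>R axis i 1"
  \<comment> \<open>If the scalar function is not integrable, neither is the vector valued one, and
    both integrals are 0 by convention.\<close>
  proof (cases "integrable lebesgue (\<lambda>y. f (x - y))")
    case False
    moreover have "integrable lebesgue (\<lambda>y. f (x - y))"
      if "integrable lebesgue (\<lambda>y. f (x - y) *\<^sub>R (axis i 1 :: real ^ 'n))"
      using integrable_inner_left[OF that, of "axis i 1"] by (simp add: inner_axis_axis)
    ultimately have "\<not> integrable lebesgue (\<lambda>y. f (x - y) *\<^sub>R (axis i 1 :: real ^ 'n))" by blast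
    then show ?thesis using False by (simp add: not_integrable_integral_eq)
  qed simp
  also have "(LINT y|lebesgue. f (x - y)) = 0"
  proof -
    have "f \<in> borel_measurable lebesgue" using f by (auto simp: has_bochner_integral_iff)
    then show ?thesis
      using lebesgue_measure_preserving(2)[OF lborel_distr_reflect[of x], of f] f by (simp add: has_bochner_integral_iff)
  qed
  finally show ?thesis by (simp add: \<Phi>_def[abs_def])
qed

section \<open>Smooth kernels compatible with differences\<close>

text \<open>The flat function exp(-1/s), continued by 0, with the powers of 1/s that differentiation
  produces: the linear span of the family is closed under derivatives.\<close>

definition expinv :: "nat \<Rightarrow> real \<Rightarrow> real" where
  "expinv m s = (if s > 0 then exp (- 1 / s) / s ^ m else 0)"

lemma expinv_nonneg: "0 \<le> expinv m s" by (simp add: expinv_def)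

lemma expinv_pos: "0 < s \<Longrightarrow> 0 < expinv m s" by (simp add: expinv_def)

lemma expinv_eq_0: "s \<le> 0 \<Longrightarrow> expinv m s = 0" by (simp add: expinv_def)

lemma expinv_tendsto_0: "(expinv m \<longlongrightarrow> 0) (at 0)"
proof -
  have "((\<lambda>x::real. x ^ m / exp x) \<longlongrightarrow> 0) at_top" by (rule tendsto_power_div_exp_0)
  then have "((\<lambda>x::real. (inverse x) ^ m / exp (inverse x)) \<longlongrightarrow> 0) (at_right 0)"
    by (rule filterlim_compose[OF _ filterlim_inverse_at_top_right])
  moreover have "eventually (\<lambda>x::real. (inverse x) ^ m / exp (inverse x) = expinv m x) (at_right 0)"
    using eventually_at_right_less[of "0::real"]
    by eventually_elim (auto simp: expinv_def exp_minus field_simps)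
  ultimately have R: "(expinv m \<longlongrightarrow> 0) (at_right 0)" using tendsto_cong by fast
  have "eventually (\<lambda>x. expinv m x = 0) (at_left 0)"
    by (auto simp: eventually_at_filter expinv_def)
  then have "(expinv m \<longlongrightarrow> 0) (at_left 0)" by (rule tendsto_eventually)
  then show ?thesis using R by (simp add: filterlim_split_at)
qed

lemma expinv_DERIV: "(expinv m has_real_derivative expinv (m + 2) s - real m * expinv (m + 1) s) (at s)"
proof -
  consider "s > 0" | "s < 0" | "s = 0" by linarith
  then show ?thesis
  proof cases
    case 1
    have "((\<lambda>s. exp (- 1 / s) / s ^ m) has_real_derivative expinv (m + 2) s - real m * expinv (m + 1) s) (at s)"
    proof (cases m)
      case 0
      then show ?thesis using 1
        by (auto intro!: derivative_eq_intros simp: expinv_def power2_eq_square)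
    next
      case (Suc m')
      then show ?thesis using 1
        by (auto intro!: derivative_eq_intros simp: expinv_def power2_eq_square field_simps) (cases m'; simp)
    qed
    then show ?thesis
      by (rule has_field_derivative_transform_within_open[of _ _ _ "{0<..}"]) (use 1 in \<open>auto simp: expinv_def\<close>)
  next
    case 2
    have "((\<lambda>s. 0) has_real_derivative 0) (at s)" by simp
    then have "(expinv m has_real_derivative 0) (at s)"
      by (rule has_field_derivative_transform_within_open[of _ _ _ "{..<0}"]) (use 2 in \<open>auto simp: expinv_def\<close>)
    then show ?thesis using 2 by (simp add: expinv_def)
  next
    case 3
    have "(\<lambda>h. expinv m h / h) = expinv (m + 1)" by (auto simp: expinv_def)
    then have "((\<lambda>h. (expinv m (0 + h) - expinv m 0) / h) \<longlongrightarrow> 0) (at 0)"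
      using expinv_tendsto_0[of "m + 1"] by (simp add: expinv_eq_0)
    then show ?thesis unfolding 3 DERIV_def by (simp add: expinv_eq_0)
  qed
qed

text \<open>A class of expressions closed under directional derivatives. Membership gives
  \<open>Ck\<close> for every order by one induction, in place of product and chain rules for
  \<open>Ck\<close>.\<close>

inductive smooth_expr :: "('a::euclidean_space \<Rightarrow> real) \<Rightarrow> bool" where
  const: "smooth_expr (\<lambda>x. c)"
| expinv: "smooth_expr (\<lambda>x. expinv m (x \<bullet> v + c))"
| add: "smooth_expr f \<Longrightarrow> smooth_expr g \<Longrightarrow> smooth_expr (\<lambda>x. f x + g x)"
| mult: "smooth_expr f \<Longrightarrow> smooth_expr g \<Longrightarrow> smooth_expr (\<lambda>x. f x * g x)"
| inverse: "smooth_expr f \<Longrightarrow> (\<And>x. f x \<noteq> 0) \<Longrightarrow> smooth_expr (\<lambda>x. inverse (f x))"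

lemma smooth_expr_deriv:
  assumes "smooth_expr f"
  shows "\<exists>f'. (\<forall>x. (f has_derivative f' x) (at x)) \<and> (\<forall>v. smooth_expr (\<lambda>x. f' x v))"
  using assms
proof induction
  case (const c)
  show ?case by (intro exI[of _ "\<lambda>x v. 0"]) (auto intro: smooth_expr.const)
next
  case (expinv m v c)
  define f' where "f' x u = (expinv (m + 2) (x \<bullet> v + c) + (- real m) * expinv (m + 1) (x \<bullet> v + c)) * (u \<bullet> v)" for x u
  have "((\<lambda>x. expinv m (x \<bullet> v + c)) has_derivative f' x) (at x)" for x
  proof -
    have "((\<lambda>x. x \<bullet> v + c) has_derivative (\<lambda>u. u \<bullet> v)) (at x)" by (auto intro!: derivative_eq_intros)
    from has_derivative_compose[OF this expinv_DERIV[unfolded has_field_derivative_def]]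
    show ?thesis by (simp add: f'_def[abs_def])
  qed
  moreover have "smooth_expr (\<lambda>x. f' x u)" for u
    unfolding f'_def by (intro smooth_expr.intros)
  ultimately show ?case by blast
next
  case (add f g)
  then obtain f' g' where "\<And>x. (f has_derivative f' x) (at x)" "\<And>v. smooth_expr (\<lambda>x. f' x v)"
    "\<And>x. (g has_derivative g' x) (at x)" "\<And>v. smooth_expr (\<lambda>x. g' x v)" by blast
  then show ?case
    by (intro exI[of _ "\<lambda>x v. f' x v + g' x v"]) (auto intro: smooth_expr.add has_derivative_add)
next
  case (mult f g)
  then obtain f' g' where "\<And>x. (f has_derivative f' x) (at x)" "\<And>v. smooth_expr (\<lambda>x. f' x v)"
    "\<And>x. (g has_derivative g' x) (at x)" "\<And>v. smooth_expr (\<lambda>x. g' x v)" by blast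
  then show ?case using mult.hyps
    by (intro exI[of _ "\<lambda>x v. f x * g' x v + f' x v * g x"])
      (auto intro!: smooth_expr.add smooth_expr.mult has_derivative_mult)
next
  case (inverse f)
  then obtain f' where f': "\<And>x. (f has_derivative f' x) (at x)" "\<And>v. smooth_expr (\<lambda>x. f' x v)" by blast
  have "((\<lambda>x. inverse (f x)) has_derivative (\<lambda>v. (- 1) * (inverse (f x) * f' x v * inverse (f x)))) (at x)" for x
    using Deriv.has_derivative_inverse[OF inverse.hyps(2) f'(1), of x] by simp
  moreover have "smooth_expr (\<lambda>x. (- 1) * (inverse (f x) * f' x v * inverse (f x)))" for v
    by (intro smooth_expr.mult smooth_expr.inverse smooth_expr.const f'(2) inverse.hyps)
  ultimately show ?case by (intro exI[of _ "\<lambda>x v. (- 1) * (inverse (f x) * f' x v * inverse (f x))"]) blast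
qed

lemma smooth_expr_Ck: "smooth_expr f \<Longrightarrow> Ck k f"
proof (induction k arbitrary: f)
  case 0
  then obtain f' where "\<And>x. (f has_derivative f' x) (at x)" using smooth_expr_deriv by blast
  then show ?case by (auto intro: continuous_at_imp_continuous_on has_derivative_continuous)
next
  case (Suc k)
  obtain f' where f': "\<And>x. (f has_derivative f' x) (at x)" "\<And>v. smooth_expr (\<lambda>x. f' x v)"
    using smooth_expr_deriv[OF Suc.prems] by blast
  have "frechet_derivative f (at x) = f' x" for x using frechet_derivative_at[OF f'(1)] by simp
  then show ?case using f' Suc.IH by (auto simp: differentiable_def)
qed

lemma smooth_expr_prod:
  "(\<And>i. i \<in> I \<Longrightarrow> smooth_expr (f i)) \<Longrightarrow> smooth_expr (\<lambda>x. \<Prod>i\<in>I. f i x)"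
  by (induction I rule: infinite_finite_induct) (auto intro: smooth_expr.intros)

section \<open>Smooth steps and bumps on the line\<close>

definition smooth_step :: "real \<Rightarrow> real" where
  "smooth_step s = expinv 0 s * inverse (expinv 0 s + expinv 0 (1 - s))"

text \<open>The derivative of \<open>smooth_step\<close>, written out by the quotient rule so that
  it is visibly a \<open>smooth_expr\<close>.\<close>

definition bump :: "real \<Rightarrow> real" where
  "bump s = (expinv 2 s * expinv 0 (1 - s) + expinv 0 s * expinv 2 (1 - s)) * inverse ((expinv 0 s + expinv 0 (1 - s))\<^sup>2)"

text \<open>The integral of \<open>bump\<close> over [s, s + 1]. Its derivative
  \<open>bump (s + 1) - bump s\<close> is a forward difference, which is the mechanism that turns
  derivatives into differences.\<close>

definition wide_bump :: "real \<Rightarrow> real" where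
  "wide_bump s = smooth_step (s + 1) - smooth_step s"

lemma step_denominator_pos: "0 < expinv 0 s + expinv 0 (1 - s)"
proof (cases "s > 0")
  case True then show ?thesis using expinv_nonneg[of 0 "1 - s"] expinv_pos[of s 0] by linarith
next
  case False then show ?thesis using expinv_nonneg[of 0 s] expinv_pos[of "1 - s" 0] by linarith
qed

lemma smooth_step_DERIV: "(smooth_step has_real_derivative bump s) (at s)"
proof -
  define e f where "e = expinv 0 s" and "f = expinv 0 (1 - s)"
  define e' f' where "e' = expinv 2 s" and "f' = expinv 2 (1 - s)"
  have d: "e + f \<noteq> 0" using step_denominator_pos[of s] by (simp add: e_def f_def)
  have 1: "(expinv 0 has_real_derivative e') (at s)" using expinv_DERIV[of 0 s] by (simp add: e'_def numeral_2_eq_2)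
  have "(expinv 0 has_real_derivative f') (at (1 - s))" using expinv_DERIV[of 0 "1 - s"] by (simp add: f'_def numeral_2_eq_2)
  then have 2: "((\<lambda>s. expinv 0 (1 - s)) has_real_derivative f' * (- 1)) (at s)"
    by (rule DERIV_chain2) (auto intro!: derivative_eq_intros)
  have "((\<lambda>s. expinv 0 s / (expinv 0 s + expinv 0 (1 - s))) has_real_derivative
      (e' * (e + f) - e * (e' + f' * (- 1))) / ((e + f) * (e + f))) (at s)"
    unfolding e_def f_def
    by (rule DERIV_divide[OF 1 DERIV_add[OF 1 2]]) (use d in \<open>simp add: e_def f_def\<close>)
  moreover have "(e' * (e + f) - e * (e' + f' * (- 1))) / ((e + f) * (e + f)) = bump s"
    unfolding bump_def e_def[symmetric] f_def[symmetric] e'_def[symmetric] f'_def[symmetric]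
    by (simp add: power2_eq_square divide_inverse algebra_simps)
  ultimately show ?thesis unfolding smooth_step_def[abs_def] by (simp add: divide_inverse)
qed

lemma bump_nonneg: "0 \<le> bump s"
  unfolding bump_def by (intro mult_nonneg_nonneg add_nonneg_nonneg expinv_nonneg) auto

lemma bump_eq_0: "s \<notin> {0<..<1} \<Longrightarrow> bump s = 0"
  by (auto simp: bump_def expinv_eq_0)

lemma bump_pos: "s \<in> {0<..<1} \<Longrightarrow> 0 < bump s"
  unfolding bump_def using step_denominator_pos[of s]
  by (intro mult_pos_pos add_pos_pos expinv_pos positive_imp_inverse_positive zero_less_power) auto

lemma smooth_step_mono: "s \<le> t \<Longrightarrow> smooth_step s \<le> smooth_step t"
  by (rule DERIV_nonneg_imp_nondecreasing) (use smooth_step_DERIV bump_nonneg in blast)+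

lemma smooth_step_eq: "s \<le> 0 \<Longrightarrow> smooth_step s = 0" "1 \<le> s \<Longrightarrow> smooth_step s = 1"
  using expinv_pos[of s 0] by (auto simp: smooth_step_def expinv_eq_0)

lemma wide_bump_nonneg: "0 \<le> wide_bump s"
  using smooth_step_mono[of s "s + 1"] by (simp add: wide_bump_def)

lemma wide_bump_eq_0: "s \<notin> {-1<..<1} \<Longrightarrow> wide_bump s = 0"
  by (auto simp: wide_bump_def smooth_step_eq not_less)

lemma wide_bump_0: "wide_bump 0 = 1" by (simp add: wide_bump_def smooth_step_eq)

lemma smooth_expr_step: "smooth_expr (\<lambda>y. smooth_step (y \<bullet> v + c))"
  and smooth_expr_bump: "smooth_expr (\<lambda>y. bump (y \<bullet> v + c))"
proof -
  have 1: "1 - (y \<bullet> v + c) = y \<bullet> (- v) + (1 - c)" for y by simp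
  have d: "expinv 0 (y \<bullet> v + c) + expinv 0 (y \<bullet> (- v) + (1 - c)) \<noteq> 0" for y
    using step_denominator_pos[of "y \<bullet> v + c"] unfolding 1 by linarith
  show "smooth_expr (\<lambda>y. smooth_step (y \<bullet> v + c))"
    unfolding smooth_step_def 1 by (intro smooth_expr.intros d)
  have d2: "(expinv 0 (y \<bullet> v + c) + expinv 0 (y \<bullet> (- v) + (1 - c))) * (expinv 0 (y \<bullet> v + c) + expinv 0 (y \<bullet> (- v) + (1 - c))) \<noteq> 0" for y
    using d by simp
  show "smooth_expr (\<lambda>y. bump (y \<bullet> v + c))"
    unfolding bump_def 1 power2_eq_square by (intro smooth_expr.intros d2)
qed

lemma smooth_expr_wide_bump: "smooth_expr (\<lambda>y. wide_bump (y \<bullet> v + c))"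
proof -
  have "smooth_expr (\<lambda>y. smooth_step (y \<bullet> v + (c + 1)) + (- 1) * smooth_step (y \<bullet> v + c))"
    by (intro smooth_expr.intros smooth_expr_step)
  then show ?thesis by (simp add: wide_bump_def add.assoc)
qed

section \<open>Kernels wide in one coordinate and their common potentials\<close>

definition kernel_numerator :: "real \<Rightarrow> 'n::finite \<Rightarrow> real ^ 'n \<Rightarrow> real" where
  "kernel_numerator h j x = wide_bump (x $ j / h) * (\<Prod>i\<in>UNIV - {j}. bump (x $ i / h))"

text \<open>Wide in both coordinates \<open>j\<close> and \<open>k\<close>. Differentiating along
  \<open>k\<close> replaces that wide factor by a difference and leaves the kernel wide in
  \<open>j\<close>, and conversely; one function thus accounts for the differences of two
  kernels.\<close>

definition kernel_potential :: "real \<Rightarrow> 'n::finite \<Rightarrow> 'n \<Rightarrow> real ^ 'n \<Rightarrow> real" where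
  "kernel_potential h j k x = wide_bump (x $ j / h) * wide_bump (x $ k / h) * (\<Prod>i\<in>UNIV - {j, k}. bump (x $ i / h))"

lemma kernel_numerator_split:
  assumes "j \<noteq> k"
  shows "kernel_numerator h j x = wide_bump (x $ j / h) * (bump (x $ k / h) * (\<Prod>i\<in>UNIV - {j, k}. bump (x $ i / h)))"
proof -
  have "UNIV - {j} = insert k (UNIV - {j, k})" using assms by auto
  then show ?thesis unfolding kernel_numerator_def by (simp add: insert_commute)
qed

lemma smooth_expr_kernel_potential: "smooth_expr (\<lambda>y. kernel_potential h j k (x - y))"
proof -
  have eq: "(x - y) $ i / h = y \<bullet> (- (1 / h) *\<^sub>R axis i 1) + x $ i / h" for y i
    by (simp add: inner_axis diff_divide_distrib)
  show ?thesis unfolding kernel_potential_def eq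
    by (intro smooth_expr.mult smooth_expr_prod smooth_expr_wide_bump smooth_expr_bump)
qed

lemma kernel_support:
  fixes z :: "real ^ 'n"
  assumes "h > 0" and "kernel_numerator h j z \<noteq> 0 \<or> kernel_potential h j k z \<noteq> 0"
  shows "norm z \<le> real CARD('n) * h"
proof -
  have "\<bar>z $ i\<bar> \<le> h" for i
  proof -
    have "wide_bump (z $ i / h) \<noteq> 0 \<or> bump (z $ i / h) \<noteq> 0"
      using assms(2)
    proof
      assume "kernel_numerator h j z \<noteq> 0"
      then show ?thesis unfolding kernel_numerator_def by (cases "i = j") auto
    next
      assume "kernel_potential h j k z \<noteq> 0"
      then show ?thesis unfolding kernel_potential_def by (cases "i \<in> {j, k}") auto
    qed
    then have "z $ i / h \<in> {-1<..<1} \<or> z $ i / h \<in> {0<..<1}"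
      using bump_eq_0 wide_bump_eq_0 by blast
    then show ?thesis using assms(1) by (auto simp: field_simps abs_le_iff)
  qed
  then have "(\<Sum>i\<in>UNIV. \<bar>z $ i\<bar>) \<le> (\<Sum>i\<in>(UNIV::'n set). h)" by (intro sum_mono)
  then show ?thesis using norm_le_l1_cart[of z] by simp
qed

text \<open>Along axis \<open>k\<close> only one factor varies, and its derivative is a difference
  of bumps at distance 1, which is a step of length \<open>h\<close> after scaling. The sign comes
  from the argument \<open>x - y\<close>.\<close>

lemma kernel_potential_deriv:
  fixes x y :: "real ^ 'n"
  assumes h: "h > 0" and jk: "j \<noteq> k"
  shows "frechet_derivative (\<lambda>y. kernel_potential h j k (x - y)) (at y) (axis k 1)
     = - (1 / h) * (kernel_numerator h j (x + h *\<^sub>R axis k 1 - y) - kernel_numerator h j (x - y))"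
proof -
  define f where "f y = kernel_potential h j k (x - y)" for y
  obtain f' where f': "\<And>x. (f has_derivative f' x) (at x)"
    using smooth_expr_deriv[OF smooth_expr_kernel_potential[of h j k x]] unfolding f_def[abs_def] by blast
  have "((\<lambda>t. y + t *\<^sub>R axis k 1) has_derivative (\<lambda>t. t *\<^sub>R axis k 1)) (at 0)"
    by (auto intro!: derivative_eq_intros)
  from has_derivative_compose[OF this f']
  have "((\<lambda>t. f (y + t *\<^sub>R axis k 1)) has_derivative (\<lambda>t. f' y (t *\<^sub>R axis k 1))) (at 0)" by simp
  moreover have "f' y (t *\<^sub>R axis k 1) = f' y (axis k 1) * t" for t
    using has_derivative_linear[OF f'] by (simp add: linear_cmul)
  ultimately have D1: "((\<lambda>t. f (y + t *\<^sub>R axis k 1)) has_real_derivative f' y (axis k 1)) (at 0)"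
    by (simp add: has_field_derivative_def mult_commute_abs)
  define z where "z = x - y"
  define P where "P = wide_bump (z $ j / h) * (\<Prod>i\<in>UNIV - {j, k}. bump (z $ i / h))"
  have f_eq: "f (y + t *\<^sub>R axis k 1) = P * wide_bump ((z $ k - t) / h)" for t
  proof -
    have xz: "(x - (y + t *\<^sub>R axis k 1)) $ i = (if i = k then z $ k - t else z $ i)" for i
      by (simp add: z_def axis_def)
    show ?thesis unfolding f_def kernel_potential_def xz P_def using jk by (simp cong: prod.cong_simp)
  qed
  have dw: "(wide_bump has_real_derivative bump (s + 1) - bump s) (at s)" for s
  proof -
    have "((\<lambda>s. smooth_step (s + 1)) has_real_derivative bump (s + 1) * 1) (at s)"
      by (rule DERIV_chain2[OF smooth_step_DERIV]) (auto intro!: derivative_eq_intros)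
    then show ?thesis unfolding wide_bump_def[abs_def] using smooth_step_DERIV by (auto intro!: DERIV_diff)
  qed
  have "((\<lambda>t. wide_bump ((z $ k - t) / h)) has_real_derivative (bump ((z $ k - 0) / h + 1) - bump ((z $ k - 0) / h)) * (- (1 / h))) (at 0)"
    by (rule DERIV_chain2[OF dw]) (use h in \<open>auto intro!: derivative_eq_intros\<close>)
  then have D2: "((\<lambda>t. f (y + t *\<^sub>R axis k 1)) has_real_derivative P * ((bump (z $ k / h + 1) - bump (z $ k / h)) * (- (1 / h)))) (at 0)"
    unfolding f_eq by (intro DERIV_cmult) simp
  have sh: "(x + h *\<^sub>R axis k 1 - y) $ i = (if i = k then z $ k + h else z $ i)" for i
    by (simp add: z_def axis_def)
  have "kernel_numerator h j (x + h *\<^sub>R axis k 1 - y) = P * bump (z $ k / h + 1)"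
    unfolding kernel_numerator_split[OF jk] P_def sh using jk h by (simp add: add_divide_distrib cong: prod.cong_simp)
  moreover have "kernel_numerator h j (x - y) = P * bump (z $ k / h)"
    unfolding kernel_numerator_split[OF jk] P_def z_def by simp
  moreover have "f' y (axis k 1) = P * ((bump (z $ k / h + 1) - bump (z $ k / h)) * (- (1 / h)))"
    by (rule DERIV_unique[OF D1 D2])
  moreover have "frechet_derivative f (at y) = f' y" using frechet_derivative_at[OF f'] by simp
  ultimately show ?thesis unfolding f_def[abs_def] by (simp add: algebra_simps)
qed

lemma kernel_potential_commute: "kernel_potential h j k = kernel_potential h k j"
  by (simp add: kernel_potential_def fun_eq_iff insert_commute mult.commute)

text \<open>\<open>R\<close> exchanges two coordinates and is an isometry. The lemma is there to
  show that all numerators have the same integral.\<close>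

lemma kernel_numerator_swap:
  fixes x :: "real ^ 'n"
  assumes "j \<noteq> k"
  defines "R \<equiv> \<lambda>x :: real ^ 'n. x + (x $ k - x $ j) *\<^sub>R axis j 1 + (x $ j - x $ k) *\<^sub>R axis k 1"
  shows "kernel_numerator h k x = kernel_numerator h j (R x)" "linear R" "norm (R x) = norm x"
proof -
  have R: "R x $ i = (if i = j then x $ k else if i = k then x $ j else x $ i)" for x i
    using assms(1) by (auto simp: R_def axis_def)
  show "linear R" unfolding R_def by (rule linearI) (simp_all add: algebra_simps)
  have "R x \<bullet> R x = (\<Sum>i\<in>UNIV. (R x $ i)\<^sup>2)" by (simp add: inner_vec_def power2_eq_square)
  also have "\<dots> = (R x $ j)\<^sup>2 + ((R x $ k)\<^sup>2 + (\<Sum>i\<in>UNIV - {j} - {k}. (R x $ i)\<^sup>2))"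
    using assms(1) by (simp add: sum.remove[of UNIV j] sum.remove[of "UNIV - {j}" k])
  also have "\<dots> = (x $ j)\<^sup>2 + ((x $ k)\<^sup>2 + (\<Sum>i\<in>UNIV - {j} - {k}. (x $ i)\<^sup>2))"
    using assms(1) by (simp add: R)
  also have "\<dots> = (\<Sum>i\<in>UNIV. (x $ i)\<^sup>2)"
    using assms(1) by (simp add: sum.remove[of UNIV j] sum.remove[of "UNIV - {j}" k])
  also have "\<dots> = x \<bullet> x" by (simp add: inner_vec_def power2_eq_square)
  finally show "norm (R x) = norm x" by (simp add: norm_eq_sqrt_inner)
  have "(\<Prod>i\<in>UNIV - {j, k}. bump (R x $ i / h)) = (\<Prod>i\<in>UNIV - {j, k}. bump (x $ i / h))"
    by (intro prod.cong) (auto simp: R)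
  moreover have "UNIV - {k, j} = UNIV - {j, k}" by auto
  ultimately show "kernel_numerator h k x = kernel_numerator h j (R x)"
    using kernel_numerator_split[OF assms(1), of h "R x"] kernel_numerator_split[OF assms(1)[symmetric], of h x] assms(1)
    by (simp add: R)
qed

lemma continuous_integral_pos:
  fixes f :: "'a::euclidean_space \<Rightarrow> real"
  assumes f: "continuous_on UNIV f" "integrable lborel f" and nn: "\<And>x. 0 \<le> f x" and x0: "0 < f x0"
  shows "0 < (LBINT x. f x)"
proof (rule ccontr)
  assume "\<not> 0 < (LBINT x. f x)"
  then have "(LBINT x. f x) = 0" using nn by (intro antisym) (auto simp: not_less)
  then have ae: "AE x in lborel. f x = 0"
    using integral_nonneg_eq_0_iff_AE[OF f(2)] nn by simp
  have "open (f -` {0<..})" using f(1) by (intro open_vimage) auto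
  then obtain r where r: "r > 0" "ball x0 r \<subseteq> f -` {0<..}"
    using x0 unfolding open_contains_ball by blast
  have "AE x in lborel. x \<notin> ball x0 r" using ae by eventually_elim (use r in force)
  then have "emeasure lborel (ball x0 r) = 0" by (subst (asm) AE_iff_measurable) auto
  then show False using content_ball_pos[OF r(1), of x0] by (simp add: measure_def)
qed

lemma bump_continuous: "continuous_on UNIV bump"
  using smooth_expr_Ck[OF smooth_expr_bump[of "1::real" 0], of 0] by simp

lemma wide_bump_continuous: "continuous_on UNIV wide_bump"
  using smooth_expr_Ck[OF smooth_expr_wide_bump[of "1::real" 0], of 0] by simp

lemma kernel_numerator_continuous: "continuous_on UNIV (kernel_numerator h j)"
  unfolding kernel_numerator_def[abs_def] divide_inverse
  by (intro continuous_on_mult continuous_on_prod continuous_on_compose2[OF bump_continuous]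
      continuous_on_compose2[OF wide_bump_continuous] continuous_intros) auto

text \<open>The kernels \<open>\<kappa> j\<close> turn a distributional gradient into a discrete one: convolving \<open>\<partial>\<^sub>j v\<close>
  with \<open>\<kappa> j\<close> yields a forward difference in direction \<open>j\<close> of a mollification of \<open>v\<close>.\<close>

lemma kernels_exist:
  fixes h :: real
  assumes h: "h > 0"
  shows "\<exists>\<kappa> :: 'n::finite \<Rightarrow> real ^ 'n \<Rightarrow> real.
    (\<forall>j. continuous_on UNIV (\<kappa> j) \<and> (\<forall>x. 0 \<le> \<kappa> j x) \<and> (\<exists>M. \<forall>x. \<kappa> j x \<le> M) \<and>
      (\<forall>x. real CARD('n) * h < norm x \<longrightarrow> \<kappa> j x = 0) \<and> has_bochner_integral lborel (\<kappa> j) 1) \<and>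
    (\<forall>j k x. j \<noteq> k \<longrightarrow> (\<exists>\<psi>. test_function \<psi> \<and> (\<forall>y.
       frechet_derivative \<psi> (at y) (axis k 1) = \<kappa> j (x + h *\<^sub>R axis k 1 - y) - \<kappa> j (x - y) \<and>
       frechet_derivative \<psi> (at y) (axis j 1) = \<kappa> k (x + h *\<^sub>R axis j 1 - y) - \<kappa> k (x - y))))"
proof -
  define r where "r = real CARD('n) * h"
  define N :: "'n \<Rightarrow> real ^ 'n \<Rightarrow> real" where "N = kernel_numerator h"
  have N_cont: "continuous_on UNIV (N j)" for j unfolding N_def by (rule kernel_numerator_continuous)
  have N_nn: "0 \<le> N j x" for j x
    unfolding N_def kernel_numerator_def by (intro mult_nonneg_nonneg prod_nonneg ballI bump_nonneg wide_bump_nonneg)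
  have N_supp: "N j x = 0" if "r < norm x" for j x
    using kernel_support[OF h disjI1, of j x] that unfolding N_def r_def by linarith
  have N_int: "integrable lborel (N j)" for j
  proof -
    have "integrable lborel (\<lambda>x. indicator (cball 0 r) x *\<^sub>R N j x)"
      by (rule borel_integrable_compact) (auto intro: continuous_on_subset[OF N_cont])
    moreover have "(\<lambda>x. indicator (cball 0 r) x *\<^sub>R N j x) = N j"
      using N_supp[of _ j] by (auto simp: indicator_def fun_eq_iff)
    ultimately show ?thesis by simp
  qed
  have N_bdd: "\<exists>M. \<forall>x. N j x \<le> M" for j
  proof -
    have "compact (N j ` cball 0 r)" by (intro compact_continuous_image continuous_on_subset[OF N_cont]) auto
    then have "bounded (N j ` cball 0 r)" by (rule compact_imp_bounded)
    then obtain M where M: "\<And>x. x \<in> cball 0 r \<Longrightarrow> \<bar>N j x\<bar> \<le> M"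
      unfolding bounded_iff real_norm_def by blast
    have "N j x \<le> max M 0" for x
    proof (cases "r < norm x")
      case False
      then have "\<bar>N j x\<bar> \<le> M" by (intro M) simp
      then show ?thesis by linarith
    qed (simp add: N_supp)
    then show ?thesis by blast
  qed
  define c where "c j = (LBINT x. N j x)" for j
  have c_pos: "c j > 0" for j
  proof -
    \<comment> \<open>The wide factor is 1 at 0, and h/2 is the centre of the narrow bumps.\<close>
    define x0 :: "real ^ 'n" where "x0 = (\<chi> i. if i = j then 0 else h / 2)"
    have "0 < N j x0"
      unfolding N_def kernel_numerator_def
      using h by (intro mult_pos_pos prod_pos) (auto simp: x0_def wide_bump_0 intro!: bump_pos)
    then show ?thesis unfolding c_def by (intro continuous_integral_pos[OF N_cont N_int N_nn])
  qed
  \<comment> \<open>One constant \<open>C\<close> has to normalise every kernel, because the same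
    \<open>\<psi>\<close> must produce the differences of both \<open>\<kappa> j\<close> and
    \<open>\<kappa> k\<close>.\<close>
  have c_eq: "c j = c k" for j k
  proof (cases "j = k")
    case False
    define R where "R x = x + (x $ k - x $ j) *\<^sub>R axis j 1 + (x $ j - x $ k) *\<^sub>R axis k 1" for x :: "real ^ 'n"
    note swap = kernel_numerator_swap[OF False, folded R_def]
    have R: "distr lborel borel R = lborel"
      by (rule lborel_distr_isometry) (use swap(2,3) in \<open>simp_all add: R_def[abs_def]\<close>)
    have "R \<in> borel_measurable borel"
      unfolding R_def[abs_def] by (intro borel_measurable_continuous_onI continuous_intros)
    then have "(\<integral>x. N j x \<partial>distr lborel borel R) = (LBINT x. N j (R x))"
      using borel_measurable_continuous_onI[OF N_cont] by (intro integral_distr) auto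
    moreover have "N k = (\<lambda>x. N j (R x))" unfolding N_def using swap(1)[of h] by (rule ext)
    ultimately show ?thesis unfolding R c_def by simp
  qed simp
  define C where "C = c undefined"
  have C: "C > 0" "(LBINT x. N j x) = C" for j using c_pos c_eq[of j undefined] by (auto simp: C_def c_def)
  define \<kappa> where "\<kappa> j x = N j x / C" for j x
  have "\<exists>\<psi>. test_function \<psi> \<and> (\<forall>y.
       frechet_derivative \<psi> (at y) (axis k 1) = \<kappa> j (x + h *\<^sub>R axis k 1 - y) - \<kappa> j (x - y) \<and>
       frechet_derivative \<psi> (at y) (axis j 1) = \<kappa> k (x + h *\<^sub>R axis j 1 - y) - \<kappa> k (x - y))"
    if jk: "j \<noteq> k" for j k and x :: "real ^ 'n"
  proof -
    define P where "P y = kernel_potential h j k (x - y)" for y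
    \<comment> \<open>The factor -h cancels the -1/h of \<open>kernel_potential_deriv\<close>, and
      1/C is the normalisation of the kernels.\<close>
    define \<psi> where "\<psi> y = (- h / C) * P y" for y
    have sP: "smooth_expr P" unfolding P_def[abs_def] by (rule smooth_expr_kernel_potential)
    then have "smooth_expr \<psi>" unfolding \<psi>_def[abs_def] by (intro smooth_expr.intros)
    then have Ck: "\<forall>k. Ck k \<psi>" using smooth_expr_Ck by blast
    have "{y. \<psi> y \<noteq> 0} \<subseteq> cball x r"
      using kernel_support[OF h, of j _ k] by (auto simp: \<psi>_def P_def r_def dist_norm)
    then have "bounded {y. \<psi> y \<noteq> 0}" using bounded_subset bounded_cball by blast
    then have tf: "test_function \<psi>" using Ck by (simp add: test_function_def)
    have fd: "frechet_derivative \<psi> (at y) v = (- h / C) * frechet_derivative P (at y) v" for y v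
    proof -
      obtain P' where P': "\<And>x. (P has_derivative P' x) (at x)" using smooth_expr_deriv[OF sP] by blast
      then have "(\<psi> has_derivative (\<lambda>v. (- h / C) * P' y v)) (at y)"
        unfolding \<psi>_def[abs_def] by (intro has_derivative_mult_right)
      then have "frechet_derivative \<psi> (at y) = (\<lambda>v. (- h / C) * P' y v)" by (rule frechet_derivative_at[symmetric])
      moreover have "frechet_derivative P (at y) = P' y" using P' by (rule frechet_derivative_at[symmetric])
      ultimately show ?thesis by simp
    qed
    have "frechet_derivative P (at y) (axis k 1) = - (1 / h) * (N j (x + h *\<^sub>R axis k 1 - y) - N j (x - y))" for y
      unfolding P_def[abs_def] N_def by (rule kernel_potential_deriv[OF h jk])
    moreover have "frechet_derivative P (at y) (axis j 1) = - (1 / h) * (N k (x + h *\<^sub>R axis j 1 - y) - N k (x - y))" for y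
      unfolding P_def[abs_def] N_def kernel_potential_commute[of h j k]
      by (rule kernel_potential_deriv[OF h jk[symmetric]])
    ultimately have "frechet_derivative \<psi> (at y) (axis k 1) = \<kappa> j (x + h *\<^sub>R axis k 1 - y) - \<kappa> j (x - y)"
       "frechet_derivative \<psi> (at y) (axis j 1) = \<kappa> k (x + h *\<^sub>R axis j 1 - y) - \<kappa> k (x - y)" for y
      unfolding fd using h C(1) by (simp_all add: \<kappa>_def field_simps)
    then show ?thesis using tf by blast
  qed
  moreover have "continuous_on UNIV (\<kappa> j) \<and> (\<forall>x. 0 \<le> \<kappa> j x) \<and> (\<exists>M. \<forall>x. \<kappa> j x \<le> M) \<and>
      (\<forall>x. real CARD('n) * h < norm x \<longrightarrow> \<kappa> j x = 0) \<and> has_bochner_integral lborel (\<kappa> j) 1" for j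
  proof (intro conjI)
    show "continuous_on UNIV (\<kappa> j)" unfolding \<kappa>_def[abs_def] using C by (intro continuous_intros N_cont) auto
    show "\<forall>x. 0 \<le> \<kappa> j x" using N_nn C by (simp add: \<kappa>_def)
    obtain M where "\<forall>x. N j x \<le> M" using N_bdd by blast
    then show "\<exists>M. \<forall>x. \<kappa> j x \<le> M" using C by (intro exI[of _ "M / C"]) (simp add: \<kappa>_def divide_right_mono)
    show "\<forall>x. real CARD('n) * h < norm x \<longrightarrow> \<kappa> j x = 0" using N_supp by (simp add: \<kappa>_def r_def)
    show "has_bochner_integral lborel (\<kappa> j) 1"
      using N_int[of j] C by (simp add: has_bochner_integral_iff \<kappa>_def[abs_def])
  qed
  ultimately show ?thesis by blast
qed

section \<open>Approximation in \<open>L\<^sup>p\<close>\<close>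

text \<open>Two dominated limits: \<open>f\<close> is first truncated in size and support, and the
  bounded result is then an almost everywhere limit of continuous functions. Each limit contributes
  an error \<open>e'\<close>, and \<open>powr_add_le\<close> the factor 2^p.\<close>

lemma lp_approx_continuous:
  fixes f :: "'a::euclidean_space \<Rightarrow> real"
  assumes p: "1 < p" and f: "f \<in> lp p" and e: "0 < e"
  shows "\<exists>\<phi> R. continuous_on UNIV \<phi> \<and> (\<forall>x. R < norm x \<longrightarrow> \<phi> x = 0) \<and> \<phi> \<in> lp p \<and>
    (LBINT x. \<bar>f x - \<phi> x\<bar> powr p) < e"
proof -
  note [measurable] = lp_measurable[OF f]
  define e' where "e' = e / (2 * 2 powr p)"
  have e': "e' > 0" using e by (simp add: e'_def)
  define I where "I n x = (if norm x \<le> real n \<and> \<bar>f x\<bar> \<le> real n then 1 else 0 :: real)" for n x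
  have [measurable]: "I n \<in> borel_measurable borel" for n unfolding I_def[abs_def] by measurable
  have "(\<lambda>n. LBINT x. \<bar>f x - I n x * f x\<bar> powr p) \<longlonglongrightarrow> (\<integral>x. 0 \<partial>(lborel :: 'a measure))"
  proof (rule integral_dominated_convergence[where w = "\<lambda>x. \<bar>f x\<bar> powr p"])
    show "AE x in lborel. (\<lambda>n. \<bar>f x - I n x * f x\<bar> powr p) \<longlonglongrightarrow> 0"
    proof (intro AE_I2)
      fix x :: 'a
      obtain n0 where "max (norm x) \<bar>f x\<bar> < real n0" using reals_Archimedean2 by blast
      then have "eventually (\<lambda>n. \<bar>f x - I n x * f x\<bar> powr p = 0) sequentially"
        by (intro eventually_sequentiallyI[of n0]) (auto simp: I_def)
      then show "(\<lambda>n. \<bar>f x - I n x * f x\<bar> powr p) \<longlonglongrightarrow> 0" by (rule tendsto_eventually)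
    qed
    show "AE x in lborel. norm (\<bar>f x - I n x * f x\<bar> powr p) \<le> \<bar>f x\<bar> powr p" for n
      by (intro AE_I2) (auto simp: I_def)
  qed (use lp_integrable[OF f] in auto)
  then have "eventually (\<lambda>n. (LBINT x. \<bar>f x - I n x * f x\<bar> powr p) < e') sequentially"
    using e' by (intro order_tendstoD) auto
  then obtain n where n: "(LBINT x. \<bar>f x - I n x * f x\<bar> powr p) < e'"
    by (auto simp: eventually_sequentially)
  define g where "g x = I n x * f x" for x
  have [measurable]: "g \<in> borel_measurable borel" unfolding g_def[abs_def] by measurable
  have g_le: "\<bar>g x\<bar> \<le> real n" for x by (auto simp: g_def I_def)
  have g_supp: "g x = 0" if "norm x > real n" for x using that by (auto simp: g_def I_def)
  have g_lp: "g \<in> lp p"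
  proof -
    have "integrable lborel (\<lambda>x. \<bar>g x\<bar> powr p)"
      by (rule Bochner_Integration.integrable_bound[OF lp_integrable[OF f]]) (auto simp: g_def I_def)
    then show ?thesis by (simp add: lp_def)
  qed
  have "g \<in> borel_measurable (lebesgue_on UNIV)"
    using measurable_completion[of g lborel borel] by (simp add: lebesgue_on_UNIV_eq)
  then have "g measurable_on UNIV" by (intro lebesgue_measurable_imp_measurable_on) auto
  then obtain Z \<gamma> where Z: "negligible Z" and \<gamma>: "\<And>m. continuous_on UNIV (\<gamma> m :: 'a \<Rightarrow> real)"
    and \<gamma>_lim: "\<And>x. x \<notin> Z \<Longrightarrow> (\<lambda>m. \<gamma> m x) \<longlonglongrightarrow> g x"
    unfolding measurable_on_def by auto
  \<comment> \<open>The approximants are clipped to the bound of \<open>g\<close> and multiplied by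
    a cutoff that is 1 for |x| <= n, so that one integrable function dominates them all.\<close>
  define \<phi> where "\<phi> m x = max 0 (min 1 (real n + 1 - norm x)) * max (- real n) (min (real n) (\<gamma> m x))" for m x
  have \<phi>_cont: "continuous_on UNIV (\<phi> m)" for m
    unfolding \<phi>_def[abs_def] by (intro continuous_intros \<gamma>)
  have \<phi>_supp: "\<phi> m x = 0" if "real n + 1 < norm x" for m x using that by (simp add: \<phi>_def)
  have \<phi>_le: "\<bar>\<phi> m x\<bar> \<le> real n" for m x
  proof -
    have "\<bar>\<phi> m x\<bar> \<le> 1 * real n"
      unfolding \<phi>_def abs_mult by (intro mult_mono) auto
    then show ?thesis by simp
  qed
  have [measurable]: "\<phi> m \<in> borel_measurable borel" for m using \<phi>_cont by (rule borel_measurable_continuous_onI)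
  define K where "K x = (2 * real n + 1) powr p * indicator (cball 0 (real n + 1)) x" for x :: 'a
  have K: "integrable lborel K"
    unfolding K_def[abs_def] using emeasure_compact_finite[OF compact_cball, of "0::'a" "real n + 1"]
    by (intro integrable_mult_right integrable_real_indicator) auto
  have dK: "\<bar>g x - \<phi> m x\<bar> powr p \<le> K x" for m x
  proof (cases "norm x \<le> real n + 1")
    case True
    have "\<bar>g x - \<phi> m x\<bar> \<le> 2 * real n + 1" using g_le[of x] \<phi>_le[of m x] by linarith
    then have "\<bar>g x - \<phi> m x\<bar> powr p \<le> (2 * real n + 1) powr p" using p by (intro powr_mono2) auto
    then show ?thesis using True by (simp add: K_def)
  next
    case False
    then show ?thesis by (simp add: g_supp \<phi>_supp K_def)
  qed
  have "(\<lambda>m. LBINT x. \<bar>g x - \<phi> m x\<bar> powr p) \<longlonglongrightarrow> (\<integral>x. 0 \<partial>(lborel :: 'a measure))"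
  proof (rule integral_dominated_convergence[where w = K])
    have "AE x in lebesgue. x \<notin> Z" using Z by (intro AE_not_in) (simp add: negligible_iff_null_sets)
    then have "AE x in lborel. x \<notin> Z" by (simp add: AE_completion_iff)
    then show "AE x in lborel. (\<lambda>m. \<bar>g x - \<phi> m x\<bar> powr p) \<longlonglongrightarrow> 0"
    proof eventually_elim
      case (elim x)
      have "(\<lambda>m. \<phi> m x) \<longlonglongrightarrow> max 0 (min 1 (real n + 1 - norm x)) * max (- real n) (min (real n) (g x))"
        unfolding \<phi>_def by (intro tendsto_intros \<gamma>_lim elim)
      moreover have "max 0 (min 1 (real n + 1 - norm x)) * max (- real n) (min (real n) (g x)) = g x"
        using g_le[of x] g_supp[of x] by (cases "norm x > real n") (auto simp: min_def max_def)
      ultimately have "(\<lambda>m. \<bar>g x - \<phi> m x\<bar>) \<longlonglongrightarrow> \<bar>g x - g x\<bar>" by (intro tendsto_intros) simp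
      then have "(\<lambda>m. \<bar>g x - \<phi> m x\<bar> powr p) \<longlonglongrightarrow> \<bar>g x - g x\<bar> powr p"
        using p by (intro tendsto_powr') auto
      then show ?case by simp
    qed
  qed (use dK K in auto)
  then have "eventually (\<lambda>m. (LBINT x. \<bar>g x - \<phi> m x\<bar> powr p) < e') sequentially"
    using e' by (intro order_tendstoD) auto
  then obtain m where m: "(LBINT x. \<bar>g x - \<phi> m x\<bar> powr p) < e'"
    by (auto simp: eventually_sequentially)
  have d_lp: "(\<lambda>x. g x - \<phi> m x) \<in> lp p"
  proof -
    have "integrable lborel (\<lambda>x. \<bar>g x - \<phi> m x\<bar> powr p)"
      by (rule Bochner_Integration.integrable_bound[OF K]) (use dK in \<open>auto intro: order_trans[OF _ abs_ge_self]\<close>)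
    then show ?thesis by (simp add: lp_def)
  qed
  have \<phi>_lp: "\<phi> m \<in> lp p" using lp_diff[OF p g_lp d_lp] by simp
  have fg_lp: "(\<lambda>x. f x - g x) \<in> lp p" by (rule lp_diff[OF p f g_lp])
  have "(LBINT x. \<bar>f x - \<phi> m x\<bar> powr p) \<le> (LBINT x. 2 powr p * (\<bar>f x - g x\<bar> powr p + \<bar>g x - \<phi> m x\<bar> powr p))"
  proof (rule integral_mono)
    show "\<bar>f x - \<phi> m x\<bar> powr p \<le> 2 powr p * (\<bar>f x - g x\<bar> powr p + \<bar>g x - \<phi> m x\<bar> powr p)" for x
      using powr_add_le[OF p, of "f x - g x" "g x - \<phi> m x"] by simp
  qed (use lp_diff[OF p f \<phi>_lp] fg_lp d_lp in \<open>auto simp: lp_def\<close>)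
  also have "\<dots> = 2 powr p * ((LBINT x. \<bar>f x - g x\<bar> powr p) + (LBINT x. \<bar>g x - \<phi> m x\<bar> powr p))"
    using fg_lp d_lp by (simp add: lp_def)
  also have "\<dots> < 2 powr p * (e' + e')"
    using n m by (intro mult_strict_left_mono add_strict_mono) (auto simp: g_def)
  also have "\<dots> = e" by (simp add: e'_def)
  finally show ?thesis using \<phi>_cont \<phi>_supp \<phi>_lp by blast
qed

text \<open>For a continuous function of compact support this is uniform continuity on a ball that
  contains all the translates involved. The general case follows by approximation, since a translate
  of the error has the same norm.\<close>

lemma lp_translation_continuous:
  fixes f :: "'a::euclidean_space \<Rightarrow> real"
  assumes p: "1 < p" and f: "f \<in> lp p" and e: "0 < e"
  shows "\<exists>\<delta>>0. \<forall>y. norm y \<le> \<delta> \<longrightarrow> (LBINT x. \<bar>f (x - y) - f x\<bar> powr p) \<le> e"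
proof -
  define c where "c = (2::real) powr p"
  have c: "c > 0" by (simp add: c_def)
  \<comment> \<open>\<open>powr_add_le\<close> is applied twice to three summands, so the two
    approximation errors weigh c^2 each and together amount to e/2. The other half is for the
    modulus of continuity \<open>t\<close> on a ball of volume \<open>V\<close>.\<close>
  define e1 where "e1 = e / (4 * c * c)"
  have e1: "e1 > 0" using e c by (simp add: e1_def)
  obtain \<phi> R where \<phi>: "continuous_on UNIV \<phi>" "\<And>x. R < norm x \<Longrightarrow> \<phi> x = 0" "\<phi> \<in> lp p"
    and d: "(LBINT x. \<bar>f x - \<phi> x\<bar> powr p) < e1"
    using lp_approx_continuous[OF p f e1] by blast
  define V where "V = (LBINT x. indicator (cball (0::'a) (R + 1)) x :: real)"
  have V: "V \<ge> 0" by (simp add: V_def)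
  define a where "a = e / (2 * c * (V + 1))"
  have a: "a > 0" unfolding a_def using e c V by (intro divide_pos_pos mult_pos_pos) auto
  define t where "t = a powr (1 / p)"
  have t: "t > 0" "c * (t powr p * V) \<le> e / 2"
  proof -
    show "t > 0" using a by (simp add: t_def)
    have "t powr p = a" using a p by (simp add: t_def powr_powr)
    moreover have "c * (e / (2 * c * W) * V) = e / 2 * (V / W)" for W
      using c by (cases "W = 0") (simp_all add: field_simps)
    ultimately have "c * (t powr p * V) = e / 2 * (V / (V + 1))" by (simp only: a_def)
    also have "\<dots> \<le> e / 2 * 1" using e V by (intro mult_left_mono) auto
    finally show "c * (t powr p * V) \<le> e / 2" by simp
  qed
  have "uniformly_continuous_on (cball 0 (R + 2)) \<phi>"
    by (intro compact_uniformly_continuous continuous_on_subset[OF \<phi>(1)]) auto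
  then obtain \<delta> where \<delta>: "\<delta> > 0" "\<And>x x'. x \<in> cball 0 (R + 2) \<Longrightarrow> x' \<in> cball 0 (R + 2) \<Longrightarrow> dist x' x < \<delta> \<Longrightarrow> dist (\<phi> x') (\<phi> x) < t"
    using t(1) unfolding uniformly_continuous_on_def by metis
  have "(LBINT x. \<bar>f (x - y) - f x\<bar> powr p) \<le> e" if y: "norm y \<le> min 1 (\<delta> / 2)" for y
  proof -
    define D where "D x = f x - \<phi> x" for x
    have D: "D \<in> lp p" unfolding D_def[abs_def] by (rule lp_diff[OF p f \<phi>(3)])
    have Ds: "(\<lambda>x. D (x - y)) \<in> lp p" and \<phi>s: "(\<lambda>x. \<phi> (x - y)) \<in> lp p" and fs: "(\<lambda>x. f (x - y)) \<in> lp p"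
      by (intro lp_translate D f \<phi>(3))+
    have D_int: "(LBINT x. \<bar>D (x - y)\<bar> powr p) = (LBINT x. \<bar>D x\<bar> powr p)"
      using lborel_integral_translate[of "\<lambda>x. \<bar>D x\<bar> powr p" "- y"] lp_measurable[OF D] by simp
    have \<phi>_int: "(LBINT x. \<bar>\<phi> (x - y) - \<phi> x\<bar> powr p) \<le> t powr p * V"
    proof -
      have I: "integrable lborel (indicator (cball (0::'a) (R + 1)) :: _ \<Rightarrow> real)"
        using emeasure_compact_finite[OF compact_cball, of "0::'a" "R + 1"] by (intro integrable_real_indicator) auto
      have "(LBINT x. \<bar>\<phi> (x - y) - \<phi> x\<bar> powr p) \<le> (LBINT x. t powr p * indicator (cball (0::'a) (R + 1)) x)"
      proof (rule integral_mono)
        show "integrable lborel (\<lambda>x. \<bar>\<phi> (x - y) - \<phi> x\<bar> powr p)"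
          using lp_diff[OF p \<phi>s \<phi>(3)] by (simp add: lp_def)
        show "integrable lborel (\<lambda>x. t powr p * indicator (cball (0::'a) (R + 1)) x)" using I by simp
        fix x :: 'a
        have tri: "norm (x - y) \<le> norm x + norm y" "norm x \<le> norm (x - y) + norm y"
          by (rule norm_triangle_ineq4) (metis diff_add_cancel norm_triangle_ineq)
        show "\<bar>\<phi> (x - y) - \<phi> x\<bar> powr p \<le> t powr p * indicator (cball 0 (R + 1)) x"
        proof (cases "norm x \<le> R + 1")
          case True
          then have "dist (\<phi> (x - y)) (\<phi> x) < t"
            using y tri \<delta>(1) by (intro \<delta>(2)) (auto simp: dist_norm norm_minus_commute)
          then have "\<bar>\<phi> (x - y) - \<phi> x\<bar> powr p \<le> t powr p" using p by (intro powr_mono2) (auto simp: dist_real_def)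
          then show ?thesis using True by simp
        next
          case False
          then have "R < norm x" "R < norm (x - y)" using tri y by linarith+
          then show ?thesis by (simp add: \<phi>(2))
        qed
      qed
      then show ?thesis using I by (simp add: V_def)
    qed
    have "(LBINT x. \<bar>f (x - y) - f x\<bar> powr p)
      \<le> (LBINT x. c * (c * (\<bar>D (x - y)\<bar> powr p + \<bar>D x\<bar> powr p) + \<bar>\<phi> (x - y) - \<phi> x\<bar> powr p))"
    proof (rule integral_mono)
      show "integrable lborel (\<lambda>x. \<bar>f (x - y) - f x\<bar> powr p)"
        using lp_diff[OF p fs f] by (simp add: lp_def)
      show "integrable lborel (\<lambda>x. c * (c * (\<bar>D (x - y)\<bar> powr p + \<bar>D x\<bar> powr p) + \<bar>\<phi> (x - y) - \<phi> x\<bar> powr p))"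
        using D Ds lp_diff[OF p \<phi>s \<phi>(3)] by (simp add: lp_def)
      fix x
      have "\<bar>f (x - y) - f x\<bar> powr p \<le> c * (\<bar>D (x - y) + - D x\<bar> powr p + \<bar>\<phi> (x - y) - \<phi> x\<bar> powr p)"
        using powr_add_le[OF p, of "D (x - y) + - D x" "\<phi> (x - y) - \<phi> x"] by (simp add: D_def c_def algebra_simps)
      also have "\<dots> \<le> c * (c * (\<bar>D (x - y)\<bar> powr p + \<bar>D x\<bar> powr p) + \<bar>\<phi> (x - y) - \<phi> x\<bar> powr p)"
        using powr_add_le[OF p, of "D (x - y)" "- D x"] c by (intro mult_left_mono add_right_mono) (auto simp: c_def)
      finally show "\<bar>f (x - y) - f x\<bar> powr p \<le> c * (c * (\<bar>D (x - y)\<bar> powr p + \<bar>D x\<bar> powr p) + \<bar>\<phi> (x - y) - \<phi> x\<bar> powr p)" .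
    qed
    also have "\<dots> = c * (c * ((LBINT x. \<bar>D (x - y)\<bar> powr p) + (LBINT x. \<bar>D x\<bar> powr p)) + (LBINT x. \<bar>\<phi> (x - y) - \<phi> x\<bar> powr p))"
      using D Ds lp_diff[OF p \<phi>s \<phi>(3)] by (simp add: lp_def)
    also have "\<dots> \<le> c * (c * (e1 + e1) + t powr p * V)"
      unfolding D_int using \<phi>_int d c by (intro mult_left_mono add_mono) (auto simp: D_def)
    also have "\<dots> = c * c * 2 * e1 + c * (t powr p * V)" by (simp add: algebra_simps)
    also have "c * c * 2 * e1 = e / 2" using c by (simp add: e1_def)
    finally show ?thesis using t(2) by simp
  qed
  then show ?thesis using \<delta>(1) by (intro exI[of _ "min 1 (\<delta> / 2)"]) auto
qed

text \<open>All three parts rest on |f| <= 1 + |f|^p and a kernel both bounded and integrable. The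
  last one, uniform in \<open>x\<close>, supplies the boundedness that \<open>discrete_korn\<close>
  asks for.\<close>

lemma kernel_product_integrable:
  fixes f \<kappa> :: "'a::euclidean_space \<Rightarrow> real"
  assumes p: "1 < p" and f: "f \<in> lp p" and \<kappa>m: "\<kappa> \<in> borel_measurable borel" and nn: "\<And>x. 0 \<le> \<kappa> x"
    and le: "\<And>x. \<kappa> x \<le> M" and one: "has_bochner_integral lborel \<kappa> 1"
  shows "integrable lborel (\<lambda>y. f (x - y) * \<kappa> y)"
    and "integrable lborel (\<lambda>y. \<bar>f (x - y)\<bar> powr p * \<kappa> y)"
    and "\<bar>LBINT y. f (x - y) * \<kappa> y\<bar> \<le> 1 + M * (LBINT y. \<bar>f y\<bar> powr p)"
proof -
  note [measurable] = lp_measurable[OF f] \<kappa>m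
  have \<kappa>: "integrable lborel \<kappa>" "(LBINT x. \<kappa> x) = 1" using one by (auto simp: has_bochner_integral_iff)
  have fp: "integrable lborel (\<lambda>y. \<bar>f (x - y)\<bar> powr p)"
  proof -
    have "integrable (distr lborel borel (\<lambda>y. x - y)) (\<lambda>y. \<bar>f y\<bar> powr p)"
      unfolding lborel_distr_reflect by (rule lp_integrable[OF f])
    then show ?thesis by (subst (asm) integrable_distr_eq) auto
  qed
  have fp_int: "(LBINT y. \<bar>f (x - y)\<bar> powr p) = (LBINT y. \<bar>f y\<bar> powr p)"
    using integral_distr[of "\<lambda>y. x - y" lborel borel "\<lambda>y. \<bar>f y\<bar> powr p"] by (simp add: lborel_distr_reflect)
  have le1: "\<bar>f (x - y) * \<kappa> y\<bar> \<le> \<kappa> y + M * \<bar>f (x - y)\<bar> powr p" for y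
  proof -
    have "\<bar>f (x - y)\<bar> \<le> 1 + \<bar>f (x - y)\<bar> powr p"
    proof (cases "\<bar>f (x - y)\<bar> \<le> 1")
      case False
      then have "\<bar>f (x - y)\<bar> powr 1 \<le> \<bar>f (x - y)\<bar> powr p" using p by (intro powr_mono) auto
      then show ?thesis by simp
    qed (simp add: add_increasing2)
    then have "\<bar>f (x - y)\<bar> * \<kappa> y \<le> (1 + \<bar>f (x - y)\<bar> powr p) * \<kappa> y" using nn by (intro mult_right_mono)
    also have "\<dots> \<le> \<kappa> y + M * \<bar>f (x - y)\<bar> powr p"
      using mult_right_mono[OF le[of y], of "\<bar>f (x - y)\<bar> powr p"] by (simp add: distrib_left distrib_right mult.commute)
    finally show ?thesis using nn by (simp add: abs_mult)
  qed
  have bi: "integrable lborel (\<lambda>y. \<kappa> y + M * \<bar>f (x - y)\<bar> powr p)" using \<kappa> fp by simp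
  show i: "integrable lborel (\<lambda>y. f (x - y) * \<kappa> y)"
    by (rule Bochner_Integration.integrable_bound[OF bi]) (use le1 in \<open>auto intro: order_trans[OF _ abs_ge_self]\<close>)
  have Mf: "integrable lborel (\<lambda>y. M * \<bar>f (x - y)\<bar> powr p)" using fp by simp
  show "integrable lborel (\<lambda>y. \<bar>f (x - y)\<bar> powr p * \<kappa> y)"
  proof (rule Bochner_Integration.integrable_bound[OF Mf])
    have "\<bar>\<bar>f (x - y)\<bar> powr p * \<kappa> y\<bar> \<le> \<bar>M * \<bar>f (x - y)\<bar> powr p\<bar>" for y
      using nn[of y] le[of y] by (simp add: abs_mult mult.commute mult_right_mono)
    then show "AE y in lborel. norm (\<bar>f (x - y)\<bar> powr p * \<kappa> y) \<le> norm (M * \<bar>f (x - y)\<bar> powr p)" by simp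
  qed measurable
  have "\<bar>LBINT y. f (x - y) * \<kappa> y\<bar> \<le> (LBINT y. \<bar>f (x - y) * \<kappa> y\<bar>)" by (rule integral_abs_bound)
  also have "\<dots> \<le> (LBINT y. \<kappa> y + M * \<bar>f (x - y)\<bar> powr p)"
    using i bi le1 by (intro integral_mono) auto
  also have "\<dots> = 1 + M * (LBINT y. \<bar>f y\<bar> powr p)" using \<kappa> fp by (simp add: fp_int)
  finally show "\<bar>LBINT y. f (x - y) * \<kappa> y\<bar> \<le> 1 + M * (LBINT y. \<bar>f y\<bar> powr p)" .
qed

text \<open>Jensen's inequality for the probability density \<open>\<kappa>\<close>, through the
  tangent at the mean \<open>A x\<close>, and then Tonelli: the translation error is averaged over
  shifts of length at most \<open>\<delta>\<close>. The nonnegative integral is used so that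
  integrability is a result of the estimate.\<close>

lemma mollify_close:
  fixes f \<kappa> :: "'a::euclidean_space \<Rightarrow> real"
  assumes p: "1 < p" and f: "f \<in> lp p" and \<kappa>m: "\<kappa> \<in> borel_measurable borel" and nn: "\<And>x. 0 \<le> \<kappa> x"
    and le: "\<And>x. \<kappa> x \<le> M" and one: "has_bochner_integral lborel \<kappa> 1" and supp: "\<And>x. \<delta> < norm x \<Longrightarrow> \<kappa> x = 0"
    and mod: "\<And>y. norm y \<le> \<delta> \<Longrightarrow> (LBINT x. \<bar>f (x - y) - f x\<bar> powr p) \<le> e" and e0: "0 \<le> e"
  shows "(\<lambda>x. (LBINT y. f (x - y) * \<kappa> y) - f x) \<in> lp p"
    and "(LBINT x. \<bar>(LBINT y. f (x - y) * \<kappa> y) - f x\<bar> powr p) \<le> e"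
proof -
  note [measurable] = lp_measurable[OF f] \<kappa>m
  note ki = kernel_product_integrable[OF p f \<kappa>m nn le one]
  have \<kappa>: "integrable lborel \<kappa>" "(LBINT x. \<kappa> x) = 1" using one by (auto simp: has_bochner_integral_iff)
  define A where "A x = (LBINT y. f (x - y) * \<kappa> y) - f x" for x
  have A_meas [measurable]: "A \<in> borel_measurable borel"
    unfolding A_def[abs_def] by measurable
  have pt: "ennreal (\<bar>A x\<bar> powr p) \<le> (\<integral>\<^sup>+y. ennreal (\<kappa> y * \<bar>f (x - y) - f x\<bar> powr p) \<partial>lborel)" for x
  proof -
    define z where "z y = f (x - y) - f x" for y
    define l where "l = p * \<bar>A x\<bar> powr (p - 1) * sgn (A x)"
    have zi: "integrable lborel (\<lambda>y. \<kappa> y * z y)" using ki(1)[of x] \<kappa> by (simp add: z_def algebra_simps)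
    have z_int: "(LBINT y. \<kappa> y * z y) = A x"
      using ki(1)[of x] \<kappa> by (simp add: z_def A_def right_diff_distrib mult.commute)
    have zp: "integrable lborel (\<lambda>y. \<kappa> y * \<bar>z y\<bar> powr p)"
    proof (rule Bochner_Integration.integrable_bound)
      show "integrable lborel (\<lambda>y. 2 powr p * (\<bar>f (x - y)\<bar> powr p * \<kappa> y + \<bar>f x\<bar> powr p * \<kappa> y))"
        using ki(2)[of x] \<kappa> by simp
      have "\<bar>\<kappa> y * \<bar>z y\<bar> powr p\<bar> \<le> \<bar>2 powr p * (\<bar>f (x - y)\<bar> powr p * \<kappa> y + \<bar>f x\<bar> powr p * \<kappa> y)\<bar>" for y
      proof -
        have "\<bar>z y\<bar> powr p \<le> 2 powr p * (\<bar>f (x - y)\<bar> powr p + \<bar>f x\<bar> powr p)"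
          using powr_add_le[OF p, of "f (x - y)" "- f x"] by (simp add: z_def)
        then have "\<kappa> y * \<bar>z y\<bar> powr p \<le> \<kappa> y * (2 powr p * (\<bar>f (x - y)\<bar> powr p + \<bar>f x\<bar> powr p))"
          using nn by (intro mult_left_mono)
        also have "\<dots> = 2 powr p * (\<bar>f (x - y)\<bar> powr p * \<kappa> y + \<bar>f x\<bar> powr p * \<kappa> y)" by (simp add: algebra_simps)
        finally show ?thesis using nn[of y] by (simp add: abs_mult)
      qed
      then show "AE y in lborel. norm (\<kappa> y * \<bar>z y\<bar> powr p) \<le> norm (2 powr p * (\<bar>f (x - y)\<bar> powr p * \<kappa> y + \<bar>f x\<bar> powr p * \<kappa> y))"
        by simp
    qed (unfold z_def, measurable)
    have "\<bar>A x\<bar> powr p = (LBINT y. \<kappa> y * \<bar>A x\<bar> powr p + (l * (\<kappa> y * z y) - l * A x * \<kappa> y))"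
      using \<kappa> zi z_int by simp
    also have "\<dots> \<le> (LBINT y. \<kappa> y * \<bar>z y\<bar> powr p)"
    proof (rule integral_mono)
      show "integrable lborel (\<lambda>y. \<kappa> y * \<bar>A x\<bar> powr p + (l * (\<kappa> y * z y) - l * A x * \<kappa> y))"
        using \<kappa> zi by simp
      fix y
      have "\<bar>A x\<bar> powr p + l * (z y - A x) \<le> \<bar>z y\<bar> powr p" using powr_tangent[OF p, of "A x" "z y"] by (simp add: l_def)
      then have "\<kappa> y * (\<bar>A x\<bar> powr p + l * (z y - A x)) \<le> \<kappa> y * \<bar>z y\<bar> powr p" using nn by (intro mult_left_mono)
      then show "\<kappa> y * \<bar>A x\<bar> powr p + (l * (\<kappa> y * z y) - l * A x * \<kappa> y) \<le> \<kappa> y * \<bar>z y\<bar> powr p"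
        by (simp add: algebra_simps)
    qed (rule zp)
    finally have "ennreal (\<bar>A x\<bar> powr p) \<le> ennreal (LBINT y. \<kappa> y * \<bar>z y\<bar> powr p)" by (rule ennreal_leI)
    also have "\<dots> = (\<integral>\<^sup>+y. ennreal (\<kappa> y * \<bar>z y\<bar> powr p) \<partial>lborel)"
      using zp nn by (intro nn_integral_eq_integral[symmetric]) auto
    finally show ?thesis by (simp add: z_def)
  qed
  have "(\<integral>\<^sup>+x. ennreal (\<bar>A x\<bar> powr p) \<partial>lborel) \<le> (\<integral>\<^sup>+x. \<integral>\<^sup>+y. ennreal (\<kappa> y * \<bar>f (x - y) - f x\<bar> powr p) \<partial>lborel \<partial>lborel)"
    by (intro nn_integral_mono pt)
  also have "\<dots> = (\<integral>\<^sup>+y. \<integral>\<^sup>+x. ennreal (\<kappa> y * \<bar>f (x - y) - f x\<bar> powr p) \<partial>lborel \<partial>lborel)"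
    by (rule lborel_pair.Fubini') measurable
  also have "\<dots> \<le> (\<integral>\<^sup>+y. ennreal (\<kappa> y * e) \<partial>lborel)"
  proof (rule nn_integral_mono)
    fix y
    show "(\<integral>\<^sup>+x. ennreal (\<kappa> y * \<bar>f (x - y) - f x\<bar> powr p) \<partial>lborel) \<le> ennreal (\<kappa> y * e)"
    proof (cases "norm y \<le> \<delta>")
      case True
      have i: "integrable lborel (\<lambda>x. \<kappa> y * \<bar>f (x - y) - f x\<bar> powr p)"
        using lp_diff[OF p lp_translate(2)[OF f] f] by (simp add: lp_def)
      have "(\<integral>\<^sup>+x. ennreal (\<kappa> y * \<bar>f (x - y) - f x\<bar> powr p) \<partial>lborel) = ennreal (LBINT x. \<kappa> y * \<bar>f (x - y) - f x\<bar> powr p)"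
        using i nn by (intro nn_integral_eq_integral) auto
      also have "\<dots> \<le> ennreal (\<kappa> y * e)" using mod[OF True] nn by (intro ennreal_leI) (simp add: mult_left_mono)
      finally show ?thesis .
    qed (simp add: supp)
  qed
  also have "(\<integral>\<^sup>+y. ennreal (\<kappa> y * e) \<partial>lborel) = ennreal e"
  proof -
    have "(\<integral>\<^sup>+y. ennreal (\<kappa> y * e) \<partial>lborel) = ennreal (LBINT y. \<kappa> y * e)"
      using \<kappa> nn e0 by (intro nn_integral_eq_integral) auto
    then show ?thesis using \<kappa> by simp
  qed
  finally have fin: "(\<integral>\<^sup>+x. ennreal (\<bar>A x\<bar> powr p) \<partial>lborel) \<le> ennreal e" .
  have Ai: "integrable lborel (\<lambda>x. \<bar>A x\<bar> powr p)"
    by (rule integrableI_bounded) (use fin in \<open>auto intro: le_less_trans\<close>)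
  then have "A \<in> lp p" by (simp add: lp_def)
  then show "(\<lambda>x. (LBINT y. f (x - y) * \<kappa> y) - f x) \<in> lp p" by (simp add: A_def[abs_def])
  have "ennreal (LBINT x. \<bar>A x\<bar> powr p) \<le> ennreal e"
    using fin by (subst nn_integral_eq_integral[symmetric]) (use Ai in auto)
  then have "(LBINT x. \<bar>A x\<bar> powr p) \<le> e" using e0 by (auto simp: ennreal_le_iff)
  then show "(LBINT x. \<bar>(LBINT y. f (x - y) * \<kappa> y) - f x\<bar> powr p) \<le> e" by (simp add: A_def)
qed

section \<open>Korn's inequality for curl free fields\<close>

lemma powr_sum_le:
  fixes a b p :: real
  assumes "1 < p"
  shows "\<bar>(a + b) / 2\<bar> powr p \<le> \<bar>a\<bar> powr p + \<bar>b\<bar> powr p"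
proof -
  have "\<bar>(a + b) / 2\<bar> \<le> max \<bar>a\<bar> \<bar>b\<bar>" by (auto simp: max_def abs_if)
  then have "\<bar>(a + b) / 2\<bar> powr p \<le> max \<bar>a\<bar> \<bar>b\<bar> powr p" using assms by (intro powr_mono2) auto
  also have "\<dots> \<le> \<bar>a\<bar> powr p + \<bar>b\<bar> powr p" by (auto simp: max_def)
  finally show ?thesis .
qed

text \<open>Column \<open>j\<close> is mollified with \<open>\<kappa> j\<close>. Testing curl
  freeness with the potential of two kernels then yields the difference identity of
  \<open>discrete_korn\<close> exactly. All entries move by at most \<open>e\<close> in the p-th
  power norm, with \<open>K'\<close> independent of the step, and \<open>e\<close> tends to
  0.\<close>

lemma korn_curl_free:
  fixes p :: real
  assumes p: "1 < p"
  shows "\<exists>K>0. \<forall>g :: 'n::finite \<Rightarrow> 'n \<Rightarrow> real ^ 'n \<Rightarrow> real.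
    (\<forall>i j. g i j \<in> lp p) \<longrightarrow>
    (\<forall>i j k \<psi>. test_function \<psi> \<longrightarrow>
      (LBINT y. g i j y * frechet_derivative \<psi> (at y) (axis k 1))
        = (LBINT y. g i k y * frechet_derivative \<psi> (at y) (axis j 1))) \<longrightarrow>
    (\<forall>i j. (LBINT x. \<bar>g i j x\<bar> powr p)
       \<le> K * (\<Sum>a\<in>UNIV. \<Sum>b\<in>UNIV. LBINT x. \<bar>(g a b x + g b a x) / 2\<bar> powr p))"
proof -
  define q where "q = p / (p - 1)"
  have pq: "1 < p" "1 < q" "1 / p + 1 / q = 1" using p by (auto simp: q_def field_simps)
  obtain K' where K': "K' > 0" and dk: "\<forall>(w :: 'n \<Rightarrow> real ^ 'n) (G :: 'n \<Rightarrow> 'n \<Rightarrow> real ^ 'n \<Rightarrow> real).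
    (\<forall>k. w k \<noteq> 0) \<longrightarrow> (\<forall>i j. G i j \<in> lp p) \<longrightarrow> (\<forall>i j. \<exists>M. \<forall>x. \<bar>G i j x\<bar> \<le> M) \<longrightarrow>
    (\<forall>i j k x. G i j (x + w k) - G i j x = G i k (x + w j) - G i k x) \<longrightarrow>
    (\<forall>i j. (LBINT x. \<bar>G i j x\<bar> powr p)
       \<le> K' * (\<Sum>a\<in>UNIV. \<Sum>b\<in>UNIV. LBINT x. \<bar>(G a b x + G b a x) / 2\<bar> powr p))"
    using discrete_korn[OF pq, where 'n = 'n and 'a = "real ^ 'n"] by (elim exE conjE) (rule that)
  define c where "c = (2::real) powr p"
  have c: "c > 0" by (simp add: c_def)
  define N where "N = real CARD('n)"
  have N: "N > 0" by (simp add: N_def)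
  have "(LBINT x. \<bar>g i j x\<bar> powr p)
       \<le> (c * K' * c) * (\<Sum>a\<in>UNIV. \<Sum>b\<in>UNIV. LBINT x. \<bar>(g a b x + g b a x) / 2\<bar> powr p)"
    if g: "\<And>i j. g i j \<in> lp p" and curl: "\<And>i j k \<psi>. test_function \<psi> \<Longrightarrow>
      (LBINT y. g i j y * frechet_derivative \<psi> (at y) (axis k 1))
        = (LBINT y. g i k y * frechet_derivative \<psi> (at y) (axis j 1))"
    for g :: "'n \<Rightarrow> 'n \<Rightarrow> real ^ 'n \<Rightarrow> real" and i j
  proof -
    note [measurable] = lp_measurable[OF g]
    define S where "S = (\<Sum>a\<in>UNIV. \<Sum>b\<in>UNIV. LBINT x. \<bar>(g a b x + g b a x) / 2\<bar> powr p)"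
    have main: "(LBINT x. \<bar>g i j x\<bar> powr p) \<le> (c * K' * c) * S + e * (2 * c * K' * c * N * N + c)"
      if e: "e > 0" for e
    proof -
      have "\<forall>i j. \<exists>\<delta>>0. \<forall>y. norm y \<le> \<delta> \<longrightarrow> (LBINT x. \<bar>g i j (x - y) - g i j x\<bar> powr p) \<le> e"
        using lp_translation_continuous[OF p g e] by blast
      then obtain \<delta> where \<delta>: "\<And>i j. \<delta> i j > 0"
        "\<And>i j y. norm y \<le> \<delta> i j \<Longrightarrow> (LBINT x. \<bar>g i j (x - y) - g i j x\<bar> powr p) \<le> e" by metis
      define d where "d = Min (range (\<lambda>(i, j). \<delta> i j))"
      have d_le: "d \<le> \<delta> i j" for i j unfolding d_def by (rule Min_le) auto
      have d_pos: "d > 0" unfolding d_def using \<delta>(1) by (subst Min_gr_iff) auto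
      \<comment> \<open>The kernels of step \<open>h\<close> live in a ball of radius N h = d,
        within which all translation errors are at most \<open>e\<close>.\<close>
      define h where "h = d / N"
      have h: "h > 0" using d_pos N by (simp add: h_def)
      have hd: "real CARD('n) * h = d" using N by (simp add: h_def N_def)
      obtain \<kappa> :: "'n \<Rightarrow> real ^ 'n \<Rightarrow> real" where
        \<kappa>_all: "\<forall>j. continuous_on UNIV (\<kappa> j) \<and> (\<forall>x. 0 \<le> \<kappa> j x) \<and> (\<exists>M. \<forall>x. \<kappa> j x \<le> M) \<and>
          (\<forall>x. d < norm x \<longrightarrow> \<kappa> j x = 0) \<and> has_bochner_integral lborel (\<kappa> j) 1"
        and \<kappa>_curl: "\<forall>j k x. j \<noteq> k \<longrightarrow> (\<exists>\<psi>. test_function \<psi> \<and> (\<forall>y.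
       frechet_derivative \<psi> (at y) (axis k 1) = \<kappa> j (x + h *\<^sub>R axis k 1 - y) - \<kappa> j (x - y) \<and>
       frechet_derivative \<psi> (at y) (axis j 1) = \<kappa> k (x + h *\<^sub>R axis j 1 - y) - \<kappa> k (x - y)))"
        using kernels_exist[OF h, where 'n = 'n] unfolding hd by (elim exE conjE) (rule that)
      have nn: "0 \<le> \<kappa> j x" and supp: "d < norm x \<Longrightarrow> \<kappa> j x = 0" and one: "has_bochner_integral lborel (\<kappa> j) 1"
        and \<kappa>m [measurable]: "\<kappa> j \<in> borel_measurable borel" for j x
        using \<kappa>_all by (auto intro: borel_measurable_continuous_onI)
      obtain M where M: "\<And>j x. \<kappa> j x \<le> M j" using \<kappa>_all by metis
      define G where "G i j x = (LBINT y. g i j (x - y) * \<kappa> j y)" for i j x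
      note ki = kernel_product_integrable[OF p g \<kappa>m nn M one]
      have mod: "(LBINT x. \<bar>g i j (x - y) - g i j x\<bar> powr p) \<le> e" if "norm y \<le> d" for i j y
        using that d_le[of i j] by (intro \<delta>(2)) simp
      note mc = mollify_close[OF p g \<kappa>m nn M one supp mod less_imp_le[OF e]]
      have D_lp: "(\<lambda>x. G i j x - g i j x) \<in> lp p" for i j
        unfolding G_def by (rule mc(1))
      have D_le: "(LBINT x. \<bar>G i j x - g i j x\<bar> powr p) \<le> e" for i j
        unfolding G_def by (rule mc(2))
      have G_lp: "G i j \<in> lp p" for i j using lp_add[OF p D_lp g, of i j i j] by simp
      \<comment> \<open>The reflected form puts \<open>x\<close> into the kernel, so that a
        difference of \<open>G\<close> is the pairing of \<open>g\<close> with a difference of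
        kernels.\<close>
      have G_alt: "G i j x = (LBINT y. g i j y * \<kappa> j (x - y))"
        and G_alt_int: "integrable lborel (\<lambda>y. g i j y * \<kappa> j (x - y))" for i j x
      proof -
        show "G i j x = (LBINT y. g i j y * \<kappa> j (x - y))"
          using integral_distr[of "\<lambda>y. x - y" lborel borel "\<lambda>y. g i j y * \<kappa> j (x - y)"]
          by (simp add: lborel_distr_reflect G_def)
        have "integrable (distr lborel borel (\<lambda>y. x - y)) (\<lambda>y. g i j (x - y) * \<kappa> j y)"
          unfolding lborel_distr_reflect by (rule ki(1))
        then show "integrable lborel (\<lambda>y. g i j y * \<kappa> j (x - y))" by (subst (asm) integrable_distr_eq) auto
      qed
      have G_curl: "G i j (x + h *\<^sub>R axis k 1) - G i j x = G i k (x + h *\<^sub>R axis j 1) - G i k x" for i j k x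
      proof (cases "j = k")
        case False
        then obtain \<psi> where \<psi>: "test_function \<psi>"
          "\<And>y. frechet_derivative \<psi> (at y) (axis k 1) = \<kappa> j (x + h *\<^sub>R axis k 1 - y) - \<kappa> j (x - y)"
          "\<And>y. frechet_derivative \<psi> (at y) (axis j 1) = \<kappa> k (x + h *\<^sub>R axis j 1 - y) - \<kappa> k (x - y)"
          using \<kappa>_curl[THEN spec, of j, THEN spec, of k, THEN spec, of x] by blast
        have "G i j (x + h *\<^sub>R axis k 1) - G i j x = (LBINT y. g i j y * (\<kappa> j (x + h *\<^sub>R axis k 1 - y) - \<kappa> j (x - y)))"
          unfolding G_alt using G_alt_int by (simp add: right_diff_distrib)
        also have "\<dots> = (LBINT y. g i k y * (\<kappa> k (x + h *\<^sub>R axis j 1 - y) - \<kappa> k (x - y)))"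
          using curl[OF \<psi>(1), of i j k] unfolding \<psi>(2,3) .
        also have "\<dots> = G i k (x + h *\<^sub>R axis j 1) - G i k x"
          unfolding G_alt using G_alt_int by (simp add: right_diff_distrib)
        finally show ?thesis .
      qed simp
      have G_bdd: "\<exists>M. \<forall>x. \<bar>G i j x\<bar> \<le> M" for i j unfolding G_def using ki(3) by blast
      have wnz: "h *\<^sub>R axis k (1::real) \<noteq> 0" for k :: 'n using h by (simp add: axis_eq_0_iff)
      \<comment> \<open>\<open>G a b\<close> and \<open>G b a\<close> come from different kernels,
        so their half sum is not a mollification of the half sum of \<open>g\<close>; it is only
        close to it.\<close>
      have E_le: "(LBINT x. \<bar>(G a b x + G b a x) / 2\<bar> powr p)
          \<le> c * (LBINT x. \<bar>(g a b x + g b a x) / 2\<bar> powr p) + 2 * c * e" for a b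
      proof -
        have s_lp: "(\<lambda>x. (u x + v x) / 2) \<in> lp p" if "u \<in> lp p" "v \<in> lp p" for u v :: "real ^ 'n \<Rightarrow> real"
          using lp_cmult[OF lp_add[OF p that], of "1/2"] by simp
        have "(LBINT x. \<bar>(G a b x + G b a x) / 2\<bar> powr p)
          \<le> (LBINT x. c * (\<bar>(g a b x + g b a x) / 2\<bar> powr p + (\<bar>G a b x - g a b x\<bar> powr p + \<bar>G b a x - g b a x\<bar> powr p)))"
        proof (rule integral_mono)
          show "integrable lborel (\<lambda>x. \<bar>(G a b x + G b a x) / 2\<bar> powr p)" using s_lp[OF G_lp G_lp] by (rule lp_integrable)
          show "integrable lborel (\<lambda>x. c * (\<bar>(g a b x + g b a x) / 2\<bar> powr p + (\<bar>G a b x - g a b x\<bar> powr p + \<bar>G b a x - g b a x\<bar> powr p)))"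
            by (intro integrable_mult_right Bochner_Integration.integrable_add lp_integrable s_lp g D_lp)
          fix x
          have "(G a b x + G b a x) / 2 = (g a b x + g b a x) / 2 + ((G a b x - g a b x) + (G b a x - g b a x)) / 2"
            by (simp add: field_simps)
          then have "\<bar>(G a b x + G b a x) / 2\<bar> powr p
             \<le> c * (\<bar>(g a b x + g b a x) / 2\<bar> powr p + \<bar>((G a b x - g a b x) + (G b a x - g b a x)) / 2\<bar> powr p)"
            using powr_add_le[OF p] by (simp only: c_def)
          also have "\<dots> \<le> c * (\<bar>(g a b x + g b a x) / 2\<bar> powr p + (\<bar>G a b x - g a b x\<bar> powr p + \<bar>G b a x - g b a x\<bar> powr p))"
            using powr_sum_le[OF p] c by (intro mult_left_mono add_left_mono) auto
          finally show "\<bar>(G a b x + G b a x) / 2\<bar> powr p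
             \<le> c * (\<bar>(g a b x + g b a x) / 2\<bar> powr p + (\<bar>G a b x - g a b x\<bar> powr p + \<bar>G b a x - g b a x\<bar> powr p))" .
        qed
        also have "\<dots> = c * ((LBINT x. \<bar>(g a b x + g b a x) / 2\<bar> powr p)
            + ((LBINT x. \<bar>G a b x - g a b x\<bar> powr p) + (LBINT x. \<bar>G b a x - g b a x\<bar> powr p)))"
          using lp_integrable[OF s_lp[OF g g]] lp_integrable[OF D_lp] by simp
        also have "\<dots> \<le> c * ((LBINT x. \<bar>(g a b x + g b a x) / 2\<bar> powr p) + (e + e))"
          using D_le c by (intro mult_left_mono add_left_mono add_mono) auto
        finally show ?thesis by (simp add: algebra_simps)
      qed
      have "(LBINT x. \<bar>G i j x\<bar> powr p)
       \<le> K' * (\<Sum>a\<in>UNIV. \<Sum>b\<in>UNIV. LBINT x. \<bar>(G a b x + G b a x) / 2\<bar> powr p)"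
        using dk[THEN spec, of "\<lambda>k. h *\<^sub>R axis k 1", THEN spec, of G] wnz G_lp G_bdd G_curl by blast
      also have "\<dots> \<le> K' * (\<Sum>a\<in>UNIV. \<Sum>b\<in>UNIV. c * (LBINT x. \<bar>(g a b x + g b a x) / 2\<bar> powr p) + 2 * c * e)"
        using K' E_le by (intro mult_left_mono sum_mono) auto
      also have "\<dots> = K' * (c * S + N * N * (2 * c * e))"
        by (simp add: S_def sum.distrib sum_distrib_left N_def mult.assoc)
      finally have G_le: "(LBINT x. \<bar>G i j x\<bar> powr p) \<le> K' * (c * S + N * N * (2 * c * e))" .
      have "(LBINT x. \<bar>g i j x\<bar> powr p) \<le> (LBINT x. c * (\<bar>G i j x\<bar> powr p + \<bar>G i j x - g i j x\<bar> powr p))"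
      proof (rule integral_mono)
        show "integrable lborel (\<lambda>x. c * (\<bar>G i j x\<bar> powr p + \<bar>G i j x - g i j x\<bar> powr p))"
          by (intro integrable_mult_right Bochner_Integration.integrable_add lp_integrable G_lp D_lp)
        show "\<bar>g i j x\<bar> powr p \<le> c * (\<bar>G i j x\<bar> powr p + \<bar>G i j x - g i j x\<bar> powr p)" for x
          using powr_add_le[OF p, of "G i j x" "- (G i j x - g i j x)"] by (simp add: c_def abs_minus_commute)
      qed (rule lp_integrable[OF g])
      also have "\<dots> = c * ((LBINT x. \<bar>G i j x\<bar> powr p) + (LBINT x. \<bar>G i j x - g i j x\<bar> powr p))"
        using lp_integrable[OF G_lp] lp_integrable[OF D_lp] by simp
      also have "\<dots> \<le> c * (K' * (c * S + N * N * (2 * c * e)) + e)"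
        using G_le D_le c by (intro mult_left_mono add_mono) auto
      also have "\<dots> = (c * K' * c) * S + e * (2 * c * K' * c * N * N + c)" by (simp add: algebra_simps)
      finally show ?thesis .
    qed
    have "(LBINT x. \<bar>g i j x\<bar> powr p) \<le> (c * K' * c) * S"
    proof (rule field_le_epsilon)
      fix e :: real assume "0 < e"
      \<comment> \<open>\<open>A\<close> does not depend on \<open>e\<close>, so \<open>main\<close>
        with e / A leaves an arbitrarily small error.\<close>
      define A where "A = 2 * c * K' * c * N * N + c"
      have A: "A > 0" unfolding A_def using c K' N by (intro add_nonneg_pos mult_nonneg_nonneg) auto
      then show "(LBINT x. \<bar>g i j x\<bar> powr p) \<le> (c * K' * c) * S + e"
        using main[of "e / A"] \<open>0 < e\<close> unfolding A_def[symmetric] by simp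
    qed
    then show ?thesis by (simp add: S_def)
  qed
  moreover have "c * K' * c > 0" using c K' by simp
  ultimately show ?thesis by blast
qed

section \<open>Combinations of test functions, and norms of matrices\<close>

lemma Ck_diff: "Ck k f \<Longrightarrow> Ck k g \<Longrightarrow> Ck k (\<lambda>x. f x - g x)"
proof (induction k arbitrary: f g)
  case 0
  then show ?case by (auto intro: continuous_on_diff)
next
  case (Suc k)
  have f: "(f has_derivative frechet_derivative f (at x)) (at x)" and g: "(g has_derivative frechet_derivative g (at x)) (at x)" for x
    using Suc.prems by (simp_all add: frechet_derivative_works)
  have "frechet_derivative (\<lambda>x. f x - g x) (at x) = (\<lambda>v. frechet_derivative f (at x) v - frechet_derivative g (at x) v)" for x
    by (rule frechet_derivative_at[symmetric]) (rule has_derivative_diff[OF f g])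
  then show ?case using Suc by (auto intro: differentiable_diff)
qed

lemma Ck_scaleR: "Ck k f \<Longrightarrow> Ck k (\<lambda>x. f x *\<^sub>R A)"
proof (induction k arbitrary: f)
  case 0
  then show ?case by (auto intro: continuous_intros)
next
  case (Suc k)
  have f: "(f has_derivative frechet_derivative f (at x)) (at x)" for x
    using Suc.prems by (simp add: frechet_derivative_works)
  then have d: "((\<lambda>x. f x *\<^sub>R A) has_derivative (\<lambda>v. frechet_derivative f (at x) v *\<^sub>R A)) (at x)" for x
    by (rule has_derivative_scaleR_left)
  then have "frechet_derivative (\<lambda>x. f x *\<^sub>R A) (at x) = (\<lambda>v. frechet_derivative f (at x) v *\<^sub>R A)" for x
    by (rule frechet_derivative_at[symmetric])
  then show ?case using Suc d by (auto simp: differentiable_def)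
qed

lemma test_function_combination:
  assumes f: "test_function f" and g: "test_function g"
  shows "test_function (\<lambda>x. f x *\<^sub>R A - g x *\<^sub>R B)"
proof -
  have "{x. f x *\<^sub>R A - g x *\<^sub>R B \<noteq> 0} \<subseteq> {x. f x \<noteq> 0} \<union> {x. g x \<noteq> 0}" by auto
  then have "{x. f x *\<^sub>R A - g x *\<^sub>R B \<noteq> 0} \<subseteq> closure {x. f x \<noteq> 0} \<union> closure {x. g x \<noteq> 0}"
    by (rule order_trans[OF _ Un_mono[OF closure_subset closure_subset]])
  moreover have "bounded (closure {x. f x \<noteq> 0} \<union> closure {x. g x \<noteq> 0})"
    using f g by (auto simp: test_function_def intro: compact_imp_bounded)
  ultimately have "bounded {x. f x *\<^sub>R A - g x *\<^sub>R B \<noteq> 0}" by (rule bounded_subset[rotated])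
  then show ?thesis using f g by (simp add: test_function_def Ck_diff Ck_scaleR)
qed

lemma test_function_lp:
  fixes f :: "'a::euclidean_space \<Rightarrow> real"
  assumes f: "test_function f" and p: "0 < p"
  shows "f \<in> lp p"
proof -
  have [measurable]: "f \<in> borel_measurable borel"
    by (rule borel_measurable_continuous_onI[OF test_function_continuous[OF f]])
  obtain M where M: "M \<ge> 0" "\<And>x. \<bar>f x\<bar> \<le> M" using test_function_bounded[OF f] by auto
  define S where "S = closure {x. f x \<noteq> 0}"
  have S: "compact S" using f by (simp add: S_def test_function_def)
  then have [measurable]: "S \<in> sets borel" by (intro borel_closed compact_imp_closed)
  have out: "f x = 0" if "x \<notin> S" for x using that closure_subset[of "{x. f x \<noteq> 0}"] unfolding S_def by blast
  have "integrable lborel (\<lambda>x. \<bar>f x\<bar> powr p)"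
  proof (rule Bochner_Integration.integrable_bound)
    show "integrable lborel (\<lambda>x. M powr p * indicator S x)"
      using emeasure_compact_finite[OF S] by (intro integrable_mult_right integrable_real_indicator) auto
    show "AE x in lborel. norm (\<bar>f x\<bar> powr p) \<le> norm (M powr p * indicator S x)"
      using M p by (intro AE_I2) (auto simp: indicator_def out intro!: powr_mono2)
  qed measurable
  then show ?thesis by (simp add: lp_def)
qed

lemma norm_matrix_le:
  fixes A :: "real ^ 'n ^ 'n"
  shows "norm A \<le> (\<Sum>i\<in>UNIV. \<Sum>j\<in>UNIV. \<bar>A $ i $ j\<bar>)"
proof -
  have "norm A \<le> (\<Sum>i\<in>UNIV. norm (A $ i))" unfolding norm_vec_def by (rule L2_set_le_sum) auto
  also have "\<dots> \<le> (\<Sum>i\<in>UNIV. \<Sum>j\<in>UNIV. \<bar>A $ i $ j\<bar>)" by (intro sum_mono norm_le_l1_cart)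
  finally show ?thesis .
qed

lemma entry_le_norm:
  fixes A :: "real ^ 'n ^ 'n"
  shows "\<bar>A $ i $ j\<bar> \<le> norm A"
  using component_le_norm_cart[of "A $ i" j] Finite_Cartesian_Product.norm_nth_le[of A i] by linarith

text \<open>Comparison with a largest entry: N^2 times it bounds the norm, and its p-th power is one
  of the summands.\<close>

lemma norm_matrix_powr_le:
  fixes A :: "real ^ 'n ^ 'n"
  assumes p: "0 < p"
  shows "norm A powr p \<le> ((real CARD('n))\<^sup>2) powr p * (\<Sum>i\<in>UNIV. \<Sum>j\<in>UNIV. \<bar>A $ i $ j\<bar> powr p)"
proof -
  define F where "F = range (\<lambda>(i, j). \<bar>A $ i $ j\<bar>)"
  have F: "finite F" "F \<noteq> {}" by (auto simp: F_def)
  have "Max F \<in> F" using F by (rule Max_in)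
  moreover have "\<exists>a b. m = \<bar>A $ a $ b\<bar>" if "m \<in> F" for m using that by (auto simp: F_def)
  ultimately obtain a b where ab: "Max F = \<bar>A $ a $ b\<bar>" by blast
  have le: "\<bar>A $ i $ j\<bar> \<le> \<bar>A $ a $ b\<bar>" for i j
    unfolding ab[symmetric] by (rule Max_ge[OF F(1)]) (auto simp: F_def)
  have "norm A \<le> (\<Sum>i\<in>(UNIV::'n set). \<Sum>j\<in>(UNIV::'n set). \<bar>A $ a $ b\<bar>)"
    by (rule order_trans[OF norm_matrix_le]) (intro sum_mono le)
  also have "\<dots> = (real CARD('n))\<^sup>2 * \<bar>A $ a $ b\<bar>" by (simp add: power2_eq_square)
  finally have "norm A powr p \<le> ((real CARD('n))\<^sup>2 * \<bar>A $ a $ b\<bar>) powr p" using p by (intro powr_mono2) auto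
  also have "\<dots> = ((real CARD('n))\<^sup>2) powr p * \<bar>A $ a $ b\<bar> powr p" by (simp add: powr_mult)
  also have "\<bar>A $ a $ b\<bar> powr p \<le> (\<Sum>j\<in>UNIV. \<bar>A $ a $ j\<bar> powr p)"
    by (rule member_le_sum) auto
  also have "\<dots> \<le> (\<Sum>i\<in>UNIV. \<Sum>j\<in>UNIV. \<bar>A $ i $ j\<bar> powr p)"
    by (rule member_le_sum) (auto intro: sum_nonneg)
  finally show ?thesis by (simp add: mult_left_mono)
qed

lemma linear_sym_part: "linear sym_part"
  unfolding sym_part_def
  by (rule linearI) (simp_all add: vec_eq_iff transpose_def algebra_simps)

lemma sym_part_nth: "sym_part A $ i $ j = (A $ i $ j + A $ j $ i) / 2"
  by (simp add: sym_part_def transpose_def)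

lemma norm_sym_part_le: "norm (sym_part A) \<le> (real CARD('n))\<^sup>2 * norm A"
  for A :: "real ^ 'n ^ 'n"
proof -
  have "\<bar>sym_part A $ i $ j\<bar> \<le> norm A" for i j
    using entry_le_norm[of A i j] entry_le_norm[of A j i] by (simp add: sym_part_nth)
  then have "norm (sym_part A) \<le> (\<Sum>i\<in>(UNIV::'n set). \<Sum>j\<in>(UNIV::'n set). norm A)"
    by (intro order_trans[OF norm_matrix_le] sum_mono)
  then show ?thesis by (simp add: power2_eq_square)
qed

text \<open>The test field \<open>\<Phi>\<close> has vanishing nonlocal divergence, so the weak
  definition of the gradient gives 0 whatever \<open>u\<close> is.\<close>

lemma weak_nonlocal_grad_curl_free:
  fixes \<rho> :: "real ^ 'n \<Rightarrow> real"
  assumes rad: "radial \<rho>" and \<rho>: "integrable lebesgue \<rho>"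
    and G: "weak_nonlocal_grad \<rho> p u G" and \<psi>: "test_function \<psi>"
  shows "(LINT x|lebesgue. G x $ i $ j * frechet_derivative \<psi> (at x) (axis k 1)
     - G x $ i $ k * frechet_derivative \<psi> (at x) (axis j 1)) = 0"
proof -
  define \<Phi> where "\<Phi> x = frechet_derivative \<psi> (at x) (axis k 1) *\<^sub>R axis i (axis j (1::real))
     - frechet_derivative \<psi> (at x) (axis j 1) *\<^sub>R axis i (axis k 1)" for x
  have "test_function \<Phi>" unfolding \<Phi>_def[abs_def]
    by (intro test_function_combination test_function_deriv \<psi>)
  then have "(LINT x|lebesgue. G x \<bullet> \<Phi> x) = - (LINT x|lebesgue. u x \<bullet> nonlocal_div \<rho> \<Phi> x)"
    using G by (simp add: weak_nonlocal_grad_def)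
  moreover have "nonlocal_div \<rho> \<Phi> x = 0" for x
    unfolding \<Phi>_def[abs_def] by (rule nonlocal_div_curl[OF rad \<rho> \<psi>])
  moreover have "G x \<bullet> \<Phi> x = G x $ i $ j * frechet_derivative \<psi> (at x) (axis k 1)
     - G x $ i $ k * frechet_derivative \<psi> (at x) (axis j 1)" for x
    by (simp add: \<Phi>_def inner_diff_right inner_axis mult.commute)
  ultimately show ?thesis by simp
qed

theorem proposition4p2:
  fixes \<rho> :: "real ^ 'n \<Rightarrow> real" and \<epsilon> p :: real
  assumes "kernel_compact_support \<rho>"
    and "\<epsilon> > 0"
    and "K0 \<epsilon> \<rho>" and "K1 \<epsilon> \<rho>" and "K2 \<epsilon> \<rho>" and "K3 \<epsilon> \<rho>" and "K4 \<epsilon> \<rho>"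
    and "(LINT x|lebesgue. \<rho> x) = real CARD('n)"
    and "1 < p"
  shows "\<exists>c>0. \<forall>u\<in>H_space \<rho> p. \<forall>G. weak_nonlocal_grad \<rho> p u G \<longrightarrow>
           Lp_norm p (\<lambda>x. sym_part (G x)) \<ge> c * Lp_norm p G"
proof -
  have rad: "radial \<rho>" using assms(3) by (simp add: K0_def)
  \<comment> \<open>The integral of a function that is not integrable is 0 by convention, while here
    it is the dimension, which is positive.\<close>
  have \<rho>: "integrable lebesgue \<rho>"
    using assms(8) not_integrable_integral_eq[of lebesgue \<rho>] by (cases "integrable lebesgue \<rho>") auto
  define q where "q = p / (p - 1)"
  have pq: "1 < p" "1 < q" "1 / p + 1 / q = 1" using assms(9) by (auto simp: q_def field_simps)
  define N where "N = real CARD('n)"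
  have N: "N > 0" by (simp add: N_def)
  obtain K where K: "K > 0" and korn: "\<forall>g :: 'n \<Rightarrow> 'n \<Rightarrow> real ^ 'n \<Rightarrow> real.
    (\<forall>i j. g i j \<in> lp p) \<longrightarrow>
    (\<forall>i j k \<psi>. test_function \<psi> \<longrightarrow>
      (LBINT y. g i j y * frechet_derivative \<psi> (at y) (axis k 1))
        = (LBINT y. g i k y * frechet_derivative \<psi> (at y) (axis j 1))) \<longrightarrow>
    (\<forall>i j. (LBINT x. \<bar>g i j x\<bar> powr p)
       \<le> K * (\<Sum>a\<in>UNIV. \<Sum>b\<in>UNIV. LBINT x. \<bar>(g a b x + g b a x) / 2\<bar> powr p))"
    using korn_curl_free[OF pq(1), where 'n = 'n] by (elim exE conjE) (rule that)
  \<comment> \<open>From right to left: N^2 symmetrised entries, each bounded by the norm of the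
    symmetric part; the constant \<open>K\<close>; N^2 entries of \<open>G\<close>; and the passage
    from entries to the norm.\<close>
  define C where "C = (N\<^sup>2) powr p * (N * N * (K * (N * N)))"
  have C: "C > 0" unfolding C_def using N K by (intro mult_pos_pos) auto
  have main: "(LINT x|lebesgue. norm (G x) powr p) \<le> C * (LINT x|lebesgue. norm (sym_part (G x)) powr p)"
    if G: "weak_nonlocal_grad \<rho> p u G" for u G
  proof -
    have Gm [measurable]: "G \<in> borel_measurable lebesgue" and Gi: "integrable lebesgue (\<lambda>x. norm (G x) powr p)"
      using G by (auto simp: weak_nonlocal_grad_def Lp_def)
    have entry_m [measurable]: "(\<lambda>x. G x $ i $ j) \<in> borel_measurable lebesgue" for i j
      by (rule measurable_compose[OF Gm]) (intro borel_measurable_continuous_onI continuous_intros)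
    \<comment> \<open>The entries of \<open>G\<close> are only Lebesgue measurable; Borel
      representatives make them members of \<open>lp\<close>.\<close>
    have "\<forall>i j. \<exists>g. g \<in> borel_measurable lborel \<and> (AE x in lborel. G x $ i $ j = g x)"
      using completion_ex_borel_measurable_real[OF entry_m] by blast
    then obtain g where gm: "\<And>i j. g i j \<in> borel_measurable lborel"
      and g_ae: "\<And>i j. AE x in lborel. G x $ i $ j = g i j x" by metis
    have [measurable]: "g i j \<in> borel_measurable borel" for i j using gm[of i j] by simp
    have g_ae': "AE x in lebesgue. G x $ i $ j = g i j x" for i j using g_ae by (rule AE_completion)
    have gl [measurable]: "g i j \<in> borel_measurable lebesgue" for i j by (rule measurable_completion[OF gm])
    have entry_i: "integrable lebesgue (\<lambda>x. \<bar>G x $ i $ j\<bar> powr p)" for i j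
    proof (rule Bochner_Integration.integrable_bound[OF Gi])
      have "\<bar>G x $ i $ j\<bar> powr p \<le> norm (G x) powr p" for x
        using pq entry_le_norm by (intro powr_mono2) auto
      then show "AE x in lebesgue. norm (\<bar>G x $ i $ j\<bar> powr p) \<le> norm (norm (G x) powr p)" by simp
    qed measurable
    have entry_int: "(LINT x|lebesgue. \<bar>G x $ i $ j\<bar> powr p) = (LBINT x. \<bar>g i j x\<bar> powr p)" for i j
    proof -
      have "(LINT x|lebesgue. \<bar>G x $ i $ j\<bar> powr p) = (LINT x|lebesgue. \<bar>g i j x\<bar> powr p)"
      proof (rule integral_cong_AE)
        show "AE x in lebesgue. \<bar>G x $ i $ j\<bar> powr p = \<bar>g i j x\<bar> powr p"
          using g_ae'[of i j] by eventually_elim simp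
      qed measurable
      then show ?thesis by (simp add: integral_completion)
    qed
    have g_lp: "g i j \<in> lp p" for i j
    proof -
      have "integrable lebesgue (\<lambda>x. \<bar>g i j x\<bar> powr p)"
      proof (rule integrable_cong_AE_imp[OF entry_i[of i j]])
        show "AE x in lebesgue. \<bar>G x $ i $ j\<bar> powr p = \<bar>g i j x\<bar> powr p"
          using g_ae'[of i j] by eventually_elim simp
      qed measurable
      then have "integrable lborel (\<lambda>x. \<bar>g i j x\<bar> powr p)" by (simp add: integrable_completion)
      then show ?thesis by (simp add: lp_def)
    qed
    have curl: "(LBINT y. g i j y * frechet_derivative \<psi> (at y) (axis k 1))
        = (LBINT y. g i k y * frechet_derivative \<psi> (at y) (axis j 1))"
      if \<psi>: "test_function \<psi>" for i j k \<psi>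
    proof -
      \<comment> \<open>With the derivatives in L^q both products are integrable, so that the
        integral of the difference, as delivered by the weak formulation, can be split.\<close>
      have Dlp: "(\<lambda>y. frechet_derivative \<psi> (at y) v) \<in> lp q" for v
        using pq by (intro test_function_lp test_function_deriv \<psi>) auto
      note [measurable] = lp_measurable[OF Dlp]
      have Dl [measurable]: "(\<lambda>y. frechet_derivative \<psi> (at y) v) \<in> borel_measurable lebesgue" for v
        using lp_measurable[OF Dlp] by (intro measurable_completion) simp
      have "(LINT x|lebesgue. g i j x * frechet_derivative \<psi> (at x) (axis k 1)
           - g i k x * frechet_derivative \<psi> (at x) (axis j 1))
         = (LINT x|lebesgue. G x $ i $ j * frechet_derivative \<psi> (at x) (axis k 1)
           - G x $ i $ k * frechet_derivative \<psi> (at x) (axis j 1))"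
      proof (rule integral_cong_AE)
        show "AE x in lebesgue. g i j x * frechet_derivative \<psi> (at x) (axis k 1)
           - g i k x * frechet_derivative \<psi> (at x) (axis j 1)
          = G x $ i $ j * frechet_derivative \<psi> (at x) (axis k 1)
           - G x $ i $ k * frechet_derivative \<psi> (at x) (axis j 1)"
          using g_ae'[of i j] g_ae'[of i k] by eventually_elim simp
      qed measurable
      also have "\<dots> = 0" by (rule weak_nonlocal_grad_curl_free[OF rad \<rho> G \<psi>])
      finally have "(LBINT x. g i j x * frechet_derivative \<psi> (at x) (axis k 1)
           - g i k x * frechet_derivative \<psi> (at x) (axis j 1)) = 0"
        by (simp add: integral_completion)
      then show ?thesis using lp_mult_integrable[OF pq g_lp Dlp] by simp
    qed
    define S where "S = (LINT x|lebesgue. norm (sym_part (G x)) powr p)"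
    have sym_m [measurable]: "(\<lambda>x. sym_part (G x)) \<in> borel_measurable lebesgue"
      by (rule measurable_compose[OF Gm])
        (intro borel_measurable_continuous_onI linear_continuous_on linear_conv_bounded_linear[THEN iffD1] linear_sym_part)
    have sym_i: "integrable lebesgue (\<lambda>x. norm (sym_part (G x)) powr p)"
    proof (rule Bochner_Integration.integrable_bound)
      show "integrable lebesgue (\<lambda>x. (N\<^sup>2) powr p * norm (G x) powr p)" using Gi by simp
      have "norm (sym_part (G x)) powr p \<le> (N\<^sup>2 * norm (G x)) powr p" for x
        using pq norm_sym_part_le[of "G x"] by (intro powr_mono2) (auto simp: N_def)
      then show "AE x in lebesgue. norm (norm (sym_part (G x)) powr p) \<le> norm ((N\<^sup>2) powr p * norm (G x) powr p)"
        by (simp add: powr_mult)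
    qed measurable
    have E_le: "(LBINT x. \<bar>(g a b x + g b a x) / 2\<bar> powr p) \<le> S" for a b
    proof -
      have "(LBINT x. \<bar>(g a b x + g b a x) / 2\<bar> powr p) = (LINT x|lebesgue. \<bar>(g a b x + g b a x) / 2\<bar> powr p)"
        by (simp add: integral_completion)
      also have "\<dots> \<le> S"
        unfolding S_def
      proof (rule integral_mono_AE)
        have "(\<lambda>x. 1 / 2 * (g a b x + g b a x)) \<in> lp p" by (intro lp_cmult lp_add pq g_lp)
        then have "integrable lborel (\<lambda>x. \<bar>(g a b x + g b a x) / 2\<bar> powr p)" using lp_integrable by fastforce
        then show "integrable lebesgue (\<lambda>x. \<bar>(g a b x + g b a x) / 2\<bar> powr p)" by (simp add: integrable_completion)
        show "AE x in lebesgue. \<bar>(g a b x + g b a x) / 2\<bar> powr p \<le> norm (sym_part (G x)) powr p"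
          using g_ae'[of a b] g_ae'[of b a]
        proof eventually_elim
          case (elim x)
          have "\<bar>(g a b x + g b a x) / 2\<bar> \<le> norm (sym_part (G x))"
            using entry_le_norm[of "sym_part (G x)" a b] elim by (simp add: sym_part_nth)
          then show ?case using pq by (intro powr_mono2) auto
        qed
      qed (rule sym_i)
      finally show ?thesis .
    qed
    have g_le: "(LBINT x. \<bar>g i j x\<bar> powr p) \<le> K * (N * N * S)" for i j
    proof -
      have "(LBINT x. \<bar>g i j x\<bar> powr p)
         \<le> K * (\<Sum>a\<in>UNIV. \<Sum>b\<in>UNIV. LBINT x. \<bar>(g a b x + g b a x) / 2\<bar> powr p)"
        using korn[THEN spec, of g] g_lp curl by blast
      also have "\<dots> \<le> K * (\<Sum>a\<in>(UNIV::'n set). \<Sum>b\<in>(UNIV::'n set). S)"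
        using K E_le by (intro mult_left_mono sum_mono) auto
      finally show ?thesis by (simp add: N_def mult.assoc)
    qed
    have "(LINT x|lebesgue. norm (G x) powr p) \<le> (LINT x|lebesgue. (N\<^sup>2) powr p * (\<Sum>i\<in>UNIV. \<Sum>j\<in>UNIV. \<bar>G x $ i $ j\<bar> powr p))"
      using Gi entry_i pq norm_matrix_powr_le[of p] unfolding N_def by (intro integral_mono) auto
    also have "\<dots> = (N\<^sup>2) powr p * (\<Sum>i\<in>UNIV. \<Sum>j\<in>UNIV. (LBINT x. \<bar>g i j x\<bar> powr p))"
      using entry_i by (simp add: entry_int)
    also have "\<dots> \<le> (N\<^sup>2) powr p * (\<Sum>i\<in>(UNIV::'n set). \<Sum>j\<in>(UNIV::'n set). K * (N * N * S))"
      using g_le by (intro mult_left_mono sum_mono) auto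
    also have "\<dots> = C * S" by (simp add: C_def N_def mult.assoc)
    finally show ?thesis by (simp add: S_def)
  qed
  define c where "c = (1 / C) powr (1 / p)"
  have "c > 0" using C by (simp add: c_def)
  moreover have "c * Lp_norm p G \<le> Lp_norm p (\<lambda>x. sym_part (G x))" if "weak_nonlocal_grad \<rho> p u G" for u G
  proof -
    have "1 / C * (LINT x|lebesgue. norm (G x) powr p) \<le> (LINT x|lebesgue. norm (sym_part (G x)) powr p)"
      using main[OF that] C by (simp add: field_simps)
    then have "(1 / C * (LINT x|lebesgue. norm (G x) powr p)) powr (1 / p) \<le> (LINT x|lebesgue. norm (sym_part (G x)) powr p) powr (1 / p)"
      using pq C by (intro powr_mono2 mult_nonneg_nonneg) auto
    then show ?thesis using C by (simp only: c_def Lp_norm_def powr_mult)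
  qed
  ultimately show ?thesis by blast
qed

end
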